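(* Let $X$ and $Y$ be finite simplicial sets. The canonical map $$\kappa \colon \operatorname{Sd}(X \times Y) \longrightarrow \operatorname{Sd} X \times \operatorname{Sd} Y, \qquad \kappa = (\operatorname{Sd}(\mathrm{pr}_1), \operatorname{Sd}(\mathrm{pr}_2)),$$ from the Kan subdivision of the product $X \times Y$ to the product of the Kan subdivisions, is a simple map.
   Context: A simplicial set is finite if it has only finitely many non-degenerate simplices. $|\cdot|$ denotes geometric realization. A map $f \colon A \to B$ of finite simplicial sets is called simple if for each point $b \in |B|$ the preimage $|f|^{-1}(b)$ under $|f| \colon |A| \to |B|$ is contractible. Kan subdivision: $\Delta[n]$ denotes the standard $n$-simplex. Let $\Delta[n]^\#$ be the set of non-degenerate simplices of $\Delta[n]$, partially ordered by $x \le y$ if $x$ is a face of $y$ (equivalently, the poset of non-empty subsets of $[n]=\{0<1<\dots<n\}$ under inclusion). An operator $\alpha \colon [n] \to [p]$ (order-preserving function) induces the order-preserving function $\Delta[n]^\# \to \Delta[p]^\#$ that takes a non-empty subset to its image. The Kan subdivision $\operatorname{Sd}$, a functor from simplicial sets to simplicial sets, is the left Kan extension of the functor $[n] \mapsto N(\Delta[n]^\#)$ (nerve of the poset) along the Yoneda embedding $[n] \mapsto \Delta[n]$. $\mathrm{pr}_1 \colon X \times Y \to X$ and $\mathrm{pr}_2 \colon X \times Y \to Y$ are the projections. *)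

theory Defs
  imports "HOL-Analysis.Analysis" "HOL-Homology.Simplices"
begin

section \<open>Simplicial sets\<close>

text \<open>The order-preserving functions from \<open>[m] = {0<1<\<dots><m}\<close> to \<open>[n]\<close>. They are extensional, so that
  composition is \<^const>\<open>compose\<close> \<open>{..m}\<close> and equality of operators is equality of functions.\<close>

definition operators :: "nat \<Rightarrow> nat \<Rightarrow> (nat \<Rightarrow> nat) set" where
  "operators m n = {\<alpha> \<in> {..m} \<rightarrow>\<^sub>E {..n}. mono_on {..m} \<alpha>}"

text \<open>For \<open>\<alpha> : [m] \<rightarrow> [n]\<close>, the function \<open>action X m n \<alpha>\<close> is the induced map \<open>\<alpha>\<^sup>* : X\<^sub>n \<rightarrow> X\<^sub>m\<close>.
  The sets \<open>simplices X n\<close> for different \<open>n\<close> need not be disjoint.\<close>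

record 'a sset =
  simplices :: "nat \<Rightarrow> 'a set"
  action :: "nat \<Rightarrow> nat \<Rightarrow> (nat \<Rightarrow> nat) \<Rightarrow> 'a \<Rightarrow> 'a"

definition is_sset :: "'a sset \<Rightarrow> bool" where
  "is_sset X \<longleftrightarrow>
    (\<forall>m n. \<forall>\<alpha> \<in> operators m n. \<forall>x \<in> simplices X n. action X m n \<alpha> x \<in> simplices X m) \<and>
    (\<forall>n. \<forall>x \<in> simplices X n. action X n n (\<lambda>i\<in>{..n}. i) x = x) \<and>
    (\<forall>l m n. \<forall>\<alpha> \<in> operators l m. \<forall>\<beta> \<in> operators m n. \<forall>x \<in> simplices X n.
       action X l n (compose {..l} \<beta> \<alpha>) x = action X l m \<alpha> (action X m n \<beta> x))"

definition sset_map :: "'a sset \<Rightarrow> 'b sset \<Rightarrow> (nat \<Rightarrow> 'a \<Rightarrow> 'b) \<Rightarrow> bool" where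
  "sset_map X Y f \<longleftrightarrow>
    (\<forall>n. \<forall>x \<in> simplices X n. f n x \<in> simplices Y n) \<and>
    (\<forall>m n. \<forall>\<alpha> \<in> operators m n. \<forall>x \<in> simplices X n.
       f m (action X m n \<alpha> x) = action Y m n \<alpha> (f n x))"

definition degenerate :: "'a sset \<Rightarrow> nat \<Rightarrow> 'a \<Rightarrow> bool" where
  "degenerate X n x \<longleftrightarrow>
    (\<exists>m \<sigma> y. m < n \<and> \<sigma> \<in> operators n m \<and> \<sigma> ` {..n} = {..m} \<and> y \<in> simplices X m \<and>
       x = action X n m \<sigma> y)"

definition finite_sset :: "'a sset \<Rightarrow> bool" where
  "finite_sset X \<longleftrightarrow> is_sset X \<and> finite {(n, x). x \<in> simplices X n \<and> \<not> degenerate X n x}"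

definition sset_prod :: "'a sset \<Rightarrow> 'b sset \<Rightarrow> ('a \<times> 'b) sset" where
  "sset_prod X Y =
    \<lparr>simplices = (\<lambda>n. simplices X n \<times> simplices Y n),
     action = (\<lambda>m n \<alpha>. map_prod (action X m n \<alpha>) (action Y m n \<alpha>))\<rparr>"

definition nerve :: "'p set \<Rightarrow> ('p \<Rightarrow> 'p \<Rightarrow> bool) \<Rightarrow> (nat \<Rightarrow> 'p) sset" where
  "nerve P leq =
    \<lparr>simplices = (\<lambda>q. {s \<in> {..q} \<rightarrow>\<^sub>E P. \<forall>i j. i \<le> j \<longrightarrow> j \<le> q \<longrightarrow> leq (s i) (s j)}),
     action = (\<lambda>p q \<beta> s. compose {..p} s \<beta>)\<rparr>"

definition nerve_map :: "('p \<Rightarrow> 'r) \<Rightarrow> nat \<Rightarrow> (nat \<Rightarrow> 'p) \<Rightarrow> (nat \<Rightarrow> 'r)" where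
  "nerve_map h q s = compose {..q} h s"


section \<open>Coends over the simplex category\<close>

text \<open>Let \<open>T\<close> be a covariant functor on the simplex category, given on objects by \<open>n \<mapsto> T n\<close> and on
  operators \<open>\<alpha> : [m] \<rightarrow> [n]\<close> by \<open>F m n \<alpha> : T m \<rightarrow> T n\<close>. The coend of \<open>X\<close> and \<open>T\<close> is the quotient of the
  disjoint union of all \<open>X\<^sub>n \<times> T n\<close> by the equivalence relation generated by
  \<open>(\<alpha>\<^sup>* x, t) \<sim> (x, \<alpha>\<^sub>* t)\<close>. It is the colimit of \<open>T n\<close> over the category of simplices \<open>(n, x)\<close>
  of \<open>X\<close>, i.e. the value at \<open>X\<close> of the left Kan extension of \<open>T\<close> along the Yoneda embedding.\<close>

definition coend_points :: "'a sset \<Rightarrow> (nat \<Rightarrow> 't set) \<Rightarrow> (nat \<times> 'a \<times> 't) set" where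
  "coend_points X T = (SIGMA n : UNIV. simplices X n \<times> T n)"

definition coend_step ::
  "'a sset \<Rightarrow> (nat \<Rightarrow> 't set) \<Rightarrow> (nat \<Rightarrow> nat \<Rightarrow> (nat \<Rightarrow> nat) \<Rightarrow> 't \<Rightarrow> 't) \<Rightarrow> (nat \<times> 'a \<times> 't) rel" where
  "coend_step X T F =
    {((m, action X m n \<alpha> x, t), (n, x, F m n \<alpha> t)) | m n \<alpha> x t.
       \<alpha> \<in> operators m n \<and> x \<in> simplices X n \<and> t \<in> T m}"

definition coend_rel ::
  "'a sset \<Rightarrow> (nat \<Rightarrow> 't set) \<Rightarrow> (nat \<Rightarrow> nat \<Rightarrow> (nat \<Rightarrow> nat) \<Rightarrow> 't \<Rightarrow> 't) \<Rightarrow> (nat \<times> 'a \<times> 't) rel" where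
  "coend_rel X T F = (coend_step X T F \<union> (coend_step X T F)\<inverse>)\<^sup>*"

definition coend ::
  "'a sset \<Rightarrow> (nat \<Rightarrow> 't set) \<Rightarrow> (nat \<Rightarrow> nat \<Rightarrow> (nat \<Rightarrow> nat) \<Rightarrow> 't \<Rightarrow> 't) \<Rightarrow> (nat \<times> 'a \<times> 't) set set" where
  "coend X T F = coend_points X T // coend_rel X T F"

text \<open>The map into the coend of \<open>X\<close>, \<open>T\<close>, \<open>F\<close> that sends the class of \<open>(n, x, t)\<close> to the class of
  \<open>(n, f n x, g n t)\<close>.\<close>

definition coend_map ::
  "'b sset \<Rightarrow> (nat \<Rightarrow> 'u set) \<Rightarrow> (nat \<Rightarrow> nat \<Rightarrow> (nat \<Rightarrow> nat) \<Rightarrow> 'u \<Rightarrow> 'u) \<Rightarrow>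
   (nat \<Rightarrow> 'a \<Rightarrow> 'b) \<Rightarrow> (nat \<Rightarrow> 't \<Rightarrow> 'u) \<Rightarrow> (nat \<times> 'a \<times> 't) set \<Rightarrow> (nat \<times> 'b \<times> 'u) set" where
  "coend_map X T F f g c = coend_rel X T F `` ((\<lambda>(n, x, t). (n, f n x, g n t)) ` c)"


section \<open>Geometric realization and simple maps\<close>

definition simplex_push :: "nat \<Rightarrow> nat \<Rightarrow> (nat \<Rightarrow> nat) \<Rightarrow> (nat \<Rightarrow> real) \<Rightarrow> (nat \<Rightarrow> real)" where
  "simplex_push m n \<alpha> t = (\<lambda>i. \<Sum>j | j \<le> m \<and> \<alpha> j = i. t j)"

definition simplex_space :: "nat \<Rightarrow> (nat \<Rightarrow> real) topology" where
  "simplex_space n = subtopology (powertop_real UNIV) (standard_simplex n)"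

definition realization_sum :: "'a sset \<Rightarrow> (nat \<times> 'a \<times> (nat \<Rightarrow> real)) topology" where
  "realization_sum X =
    sum_topology (\<lambda>n. prod_topology (discrete_topology (simplices X n)) (simplex_space n)) UNIV"

definition realization :: "'a sset \<Rightarrow> (nat \<times> 'a \<times> (nat \<Rightarrow> real)) set topology" where
  "realization X = topology (\<lambda>U. U \<subseteq> coend X standard_simplex simplex_push \<and>
     openin (realization_sum X)
       {p \<in> topspace (realization_sum X). coend_rel X standard_simplex simplex_push `` {p} \<in> U})"

definition realization_map ::
  "'b sset \<Rightarrow> (nat \<Rightarrow> 'a \<Rightarrow> 'b) \<Rightarrow>
   (nat \<times> 'a \<times> (nat \<Rightarrow> real)) set \<Rightarrow> (nat \<times> 'b \<times> (nat \<Rightarrow> real)) set" where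
  "realization_map B f = coend_map B standard_simplex simplex_push f (\<lambda>n t. t)"

text \<open>According to \<^const>\<open>contractible_space\<close> the empty space is contractible; here it is not,
  so that in particular simple maps are surjective.\<close>

definition simple_map :: "'a sset \<Rightarrow> 'b sset \<Rightarrow> (nat \<Rightarrow> 'a \<Rightarrow> 'b) \<Rightarrow> bool" where
  "simple_map A B f \<longleftrightarrow>
    finite_sset A \<and> finite_sset B \<and> sset_map A B f \<and>
    (\<forall>b \<in> topspace (realization B).
       let fibre = {a \<in> topspace (realization A). realization_map B f a = b}
       in fibre \<noteq> {} \<and> contractible_space (subtopology (realization A) fibre))"


section \<open>Kan subdivision\<close>

definition nonempty_subsets :: "nat \<Rightarrow> nat set set" where
  "nonempty_subsets n = {S. S \<subseteq> {..n} \<and> S \<noteq> {}}"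

definition subdivided_simplex :: "nat \<Rightarrow> (nat \<Rightarrow> nat set) sset" where
  "subdivided_simplex n = nerve (nonempty_subsets n) (\<subseteq>)"

definition subdivided_push ::
  "nat \<Rightarrow> nat \<Rightarrow> nat \<Rightarrow> (nat \<Rightarrow> nat) \<Rightarrow> (nat \<Rightarrow> nat set) \<Rightarrow> (nat \<Rightarrow> nat set)" where
  "subdivided_push q m n \<alpha> = nerve_map (image \<alpha>) q"

text \<open>Colimits of simplicial sets are formed degreewise.\<close>

definition Sd :: "'a sset \<Rightarrow> (nat \<times> 'a \<times> (nat \<Rightarrow> nat set)) set sset" where
  "Sd X =
    \<lparr>simplices = (\<lambda>q. coend X (\<lambda>n. simplices (subdivided_simplex n) q) (subdivided_push q)),
     action = (\<lambda>p q \<beta>. coend_map X (\<lambda>n. simplices (subdivided_simplex n) p) (subdivided_push p)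
                (\<lambda>n x. x) (\<lambda>n. action (subdivided_simplex n) p q \<beta>))\<rparr>"

definition Sd_map ::
  "'b sset \<Rightarrow> (nat \<Rightarrow> 'a \<Rightarrow> 'b) \<Rightarrow>
   nat \<Rightarrow> (nat \<times> 'a \<times> (nat \<Rightarrow> nat set)) set \<Rightarrow> (nat \<times> 'b \<times> (nat \<Rightarrow> nat set)) set" where
  "Sd_map Y f q =
    coend_map Y (\<lambda>n. simplices (subdivided_simplex n) q) (subdivided_push q) f (\<lambda>n s. s)"

definition kappa ::
  "'a sset \<Rightarrow> 'b sset \<Rightarrow> nat \<Rightarrow> (nat \<times> ('a \<times> 'b) \<times> (nat \<Rightarrow> nat set)) set \<Rightarrow>
   (nat \<times> 'a \<times> (nat \<Rightarrow> nat set)) set \<times> (nat \<times> 'b \<times> (nat \<Rightarrow> nat set)) set" where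
  "kappa X Y q c = (Sd_map X (\<lambda>n. fst) q c, Sd_map Y (\<lambda>n. snd) q c)"


section \<open>Well-definedness\<close>

lemma operators_app: "\<alpha> \<in> operators m n \<Longrightarrow> i \<le> m \<Longrightarrow> \<alpha> i \<le> n"
  by (auto simp: operators_def PiE_iff)

lemma operators_mono: "\<alpha> \<in> operators m n \<Longrightarrow> i \<le> j \<Longrightarrow> j \<le> m \<Longrightarrow> \<alpha> i \<le> \<alpha> j"
  by (auto simp: operators_def mono_on_def)

lemma operators_id: "(\<lambda>i\<in>{..n}. i) \<in> operators n n"
  by (auto simp: operators_def mono_on_def)

lemma operators_compose:
  "\<alpha> \<in> operators l m \<Longrightarrow> \<beta> \<in> operators m n \<Longrightarrow> compose {..l} \<beta> \<alpha> \<in> operators l n"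
  by (auto simp: operators_def mono_on_def compose_def PiE_iff)

lemma is_sset_prod: "is_sset X \<Longrightarrow> is_sset Y \<Longrightarrow> is_sset (sset_prod X Y)"
  by (auto simp: is_sset_def sset_prod_def)

lemma sset_map_fst: "sset_map (sset_prod X Y) X (\<lambda>n. fst)"
  by (auto simp: sset_map_def sset_prod_def)

lemma sset_map_snd: "sset_map (sset_prod X Y) Y (\<lambda>n. snd)"
  by (auto simp: sset_map_def sset_prod_def)

lemma sset_map_pair:
  "sset_map Z X f \<Longrightarrow> sset_map Z Y g \<Longrightarrow> sset_map Z (sset_prod X Y) (\<lambda>n z. (f n z, g n z))"
  by (auto simp: sset_map_def sset_prod_def)

lemma is_sset_nerve: "is_sset (nerve P leq)"
proof -
  have "compose {..m} s \<alpha> \<in> simplices (nerve P leq) m"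
    if "\<alpha> \<in> operators m n" "s \<in> simplices (nerve P leq) n" for m n \<alpha> s
    using that operators_app[OF that(1)] operators_mono[OF that(1)]
    by (auto simp: nerve_def compose_def PiE_iff)
  moreover have "compose {..n} s (\<lambda>i\<in>{..n}. i) = s" if "s \<in> simplices (nerve P leq) n" for n s
    using that by (auto simp: nerve_def compose_def PiE_iff extensional_def fun_eq_iff)
  moreover have "compose {..l} s (compose {..l} \<beta> \<alpha>) = compose {..l} (compose {..m} s \<beta>) \<alpha>"
    if "\<alpha> \<in> operators l m" for l m \<alpha> and \<beta> :: "nat \<Rightarrow> nat" and s :: "nat \<Rightarrow> 'a"
    using operators_app[OF that] by (auto simp: compose_def fun_eq_iff)
  ultimately show ?thesis
    by (simp add: is_sset_def) (simp add: nerve_def)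
qed

lemma sset_map_subdivided_push:
  assumes "\<alpha> \<in> operators m n"
  shows "sset_map (subdivided_simplex m) (subdivided_simplex n) (\<lambda>q. subdivided_push q m n \<alpha>)"
proof -
  have "subdivided_push q m n \<alpha> s \<in> simplices (subdivided_simplex n) q"
    if s: "s \<in> simplices (subdivided_simplex m) q" for q s
  proof -
    have sub: "s i \<subseteq> {..m}" "s i \<noteq> {}" if "i \<le> q" for i
      using s that by (auto simp: subdivided_simplex_def nerve_def nonempty_subsets_def PiE_iff)
    have mono: "s i \<subseteq> s j" if "i \<le> j" "j \<le> q" for i j
      using s that by (auto simp: subdivided_simplex_def nerve_def)
    have "\<alpha> ` s i \<in> nonempty_subsets n" if "i \<le> q" for i
      using sub[OF that] operators_app[OF assms] by (auto simp: nonempty_subsets_def)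
    moreover have "\<alpha> ` s i \<subseteq> \<alpha> ` s j" if "i \<le> j" "j \<le> q" for i j
      using mono[OF that] by (rule image_mono)
    ultimately show ?thesis
      by (simp add: subdivided_push_def subdivided_simplex_def nerve_def nerve_map_def compose_def PiE_iff)
  qed
  moreover have "subdivided_push p m n \<alpha> (action (subdivided_simplex m) p q \<beta> s)
      = action (subdivided_simplex n) p q \<beta> (subdivided_push q m n \<alpha> s)"
    if "\<beta> \<in> operators p q" for p q \<beta> s
    using operators_app[OF that]
    by (auto simp: subdivided_push_def subdivided_simplex_def nerve_def nerve_map_def
        compose_def fun_eq_iff)
  ultimately show ?thesis
    by (simp add: sset_map_def)
qed

lemma simplex_push_standard_simplex:
  assumes "\<alpha> \<in> operators m n" "t \<in> standard_simplex m"
  shows "simplex_push m n \<alpha> t \<in> standard_simplex n"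
proof -
  have t: "\<And>i. 0 \<le> t i" "(\<Sum>i\<le>m. t i) = 1"
    using assms by (auto simp: standard_simplex_def)
  have nonneg: "0 \<le> simplex_push m n \<alpha> t i" for i
    by (auto simp: simplex_push_def t sum_nonneg)
  have "simplex_push m n \<alpha> t i \<le> (\<Sum>j\<le>m. t j)" for i
    unfolding simplex_push_def by (rule sum_mono2) (auto simp: t)
  moreover have "simplex_push m n \<alpha> t i = 0" if "i > n" for i
  proof -
    have "{j. j \<le> m \<and> \<alpha> j = i} = {}"
      using operators_app[OF assms(1)] that by fastforce
    then show ?thesis by (simp only: simplex_push_def sum.empty)
  qed
  moreover have "(\<Sum>i\<le>n. simplex_push m n \<alpha> t i) = (\<Sum>j\<le>m. t j)"
    using sum.group[of "{..m}" "{..n}" \<alpha> t] operators_app[OF assms(1)]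
    by (auto simp: simplex_push_def image_subset_iff)
  ultimately show ?thesis
    using nonneg t by (auto simp: standard_simplex_def)
qed

lemma equiv_coend_rel: "equiv UNIV (coend_rel X T F)"
  unfolding coend_rel_def
  by (intro equivI refl_rtrancl sym_rtrancl trans_rtrancl sym_Un_converse) auto

lemma coend_step_rel: "(p, p') \<in> coend_step X T F \<Longrightarrow> (p, p') \<in> coend_rel X T F"
  unfolding coend_rel_def by auto

lemma coend_rel_induct:
  assumes "(p, p') \<in> coend_rel X T F" and "equiv UNIV R"
    and "\<And>p p'. (p, p') \<in> coend_step X T F \<Longrightarrow> (h p, h p') \<in> R"
  shows "(h p, h p') \<in> R"
  using assms(1) unfolding coend_rel_def
proof (induction rule: rtrancl_induct)
  case base
  then show ?case using assms(2) by (auto simp: equiv_def refl_on_def)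
next
  case (step y z)
  then have "(h y, h z) \<in> R"
    using assms(3)[of y z] assms(3)[of z y] assms(2) by (auto simp: equiv_def dest: symD)
  with step show ?case using assms(2) by (auto simp: equiv_def dest: transD)
qed

lemma coend_map_class:
  assumes "\<And>n x t n' x' t'. ((n, x, t), (n', x', t')) \<in> coend_step X T F \<Longrightarrow>
      ((n, f n x, g n t), (n', f n' x', g n' t')) \<in> coend_rel Y U G"
  shows "coend_map Y U G f g (coend_rel X T F `` {(n, x, t)}) = coend_rel Y U G `` {(n, f n x, g n t)}"
proof -
  define h where "h = (\<lambda>(n, x, t). (n, f n x, g n t))"
  have h: "(h p, h p') \<in> coend_rel Y U G" if "(p, p') \<in> coend_rel X T F" for p p'
    using that equiv_coend_rel
  proof (rule coend_rel_induct)
    fix p p' assume "(p, p') \<in> coend_step X T F"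
    then show "(h p, h p') \<in> coend_rel Y U G"
      using assms by (cases p; cases p') (simp add: h_def)
  qed
  have "coend_rel Y U G `` {h p'} = coend_rel Y U G `` {h p}" if "(p, p') \<in> coend_rel X T F" for p p'
    using equiv_class_eq[OF equiv_coend_rel h[OF that]] by simp
  moreover have "(p, p) \<in> coend_rel X T F" for p
    by (simp add: coend_rel_def)
  ultimately have "coend_rel Y U G `` (h ` (coend_rel X T F `` {p})) = coend_rel Y U G `` {h p}" for p
    by blast
  from this[of "(n, x, t)"] show ?thesis
    by (simp add: coend_map_def h_def)
qed

lemma Sd_simplices_iff:
  "c \<in> simplices (Sd X) q \<longleftrightarrow>
    (\<exists>n x s. x \<in> simplices X n \<and> s \<in> simplices (subdivided_simplex n) q \<and>
       c = coend_rel X (\<lambda>n. simplices (subdivided_simplex n) q) (subdivided_push q) `` {(n, x, s)})"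
  by (auto simp: Sd_def coend_def coend_points_def quotient_def)

lemma is_sset_subdivided_simplex: "is_sset (subdivided_simplex n)"
  by (simp add: subdivided_simplex_def is_sset_nerve)

lemma Sd_action_class:
  assumes "\<beta> \<in> operators p q"
  shows "action (Sd X) p q \<beta>
      (coend_rel X (\<lambda>n. simplices (subdivided_simplex n) q) (subdivided_push q) `` {(n, x, s)})
    = coend_rel X (\<lambda>n. simplices (subdivided_simplex n) p) (subdivided_push p)
        `` {(n, x, action (subdivided_simplex n) p q \<beta> s)}"
proof -
  have "((m, action X m n \<alpha> x, action (subdivided_simplex m) p q \<beta> s),
         (n, x, action (subdivided_simplex n) p q \<beta> (subdivided_push q m n \<alpha> s)))
      \<in> coend_step X (\<lambda>n. simplices (subdivided_simplex n) p) (subdivided_push p)"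
    if "\<alpha> \<in> operators m n" "x \<in> simplices X n" "s \<in> simplices (subdivided_simplex m) q"
    for m n \<alpha> x s
  proof -
    have "action (subdivided_simplex n) p q \<beta> (subdivided_push q m n \<alpha> s)
        = subdivided_push p m n \<alpha> (action (subdivided_simplex m) p q \<beta> s)"
      using sset_map_subdivided_push[OF that(1)] assms that by (simp add: sset_map_def)
    moreover have "action (subdivided_simplex m) p q \<beta> s \<in> simplices (subdivided_simplex m) p"
      using is_sset_subdivided_simplex assms that by (simp add: is_sset_def)
    ultimately show ?thesis
      using that by (auto simp: coend_step_def)
  qed
  then show ?thesis
    unfolding Sd_def sset.simps
    by (intro coend_map_class coend_step_rel) (auto simp: coend_step_def[of X "\<lambda>n. simplices (subdivided_simplex n) q"])
qed

lemma is_sset_Sd: "is_sset (Sd X)"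
proof -
  note S = is_sset_subdivided_simplex[unfolded is_sset_def]
  have "action (Sd X) p q \<beta> c \<in> simplices (Sd X) p"
    if "\<beta> \<in> operators p q" "c \<in> simplices (Sd X) q" for p q \<beta> c
    using that S by (fastforce simp: Sd_simplices_iff Sd_action_class)
  moreover have "action (Sd X) q q (\<lambda>i\<in>{..q}. i) c = c" if "c \<in> simplices (Sd X) q" for q c
    using that S by (auto simp: Sd_simplices_iff Sd_action_class[OF operators_id])
  moreover have "action (Sd X) l n (compose {..l} \<beta> \<alpha>) c
      = action (Sd X) l m \<alpha> (action (Sd X) m n \<beta> c)"
    if "\<alpha> \<in> operators l m" "\<beta> \<in> operators m n" "c \<in> simplices (Sd X) n" for l m n \<alpha> \<beta> c
    using that S by (auto simp: Sd_simplices_iff Sd_action_class operators_compose)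
  ultimately show ?thesis
    by (simp add: is_sset_def)
qed

lemma coend_map_induced_class:
  assumes "sset_map X Y f"
  shows "coend_map Y T F f (\<lambda>n t. t) (coend_rel X T F `` {(n, x, t)})
    = coend_rel Y T F `` {(n, f n x, t)}"
  using assms
  by (intro coend_map_class coend_step_rel) (fastforce simp: coend_step_def sset_map_def)

lemma sset_map_Sd_map:
  assumes "sset_map X Y f"
  shows "sset_map (Sd X) (Sd Y) (Sd_map Y f)"
proof -
  have f: "\<And>n x. x \<in> simplices X n \<Longrightarrow> f n x \<in> simplices Y n"
    using assms by (auto simp: sset_map_def)
  have "Sd_map Y f q c \<in> simplices (Sd Y) q" if "c \<in> simplices (Sd X) q" for q c
    using that f coend_map_induced_class[OF assms] by (fastforce simp: Sd_simplices_iff Sd_map_def)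
  moreover have "Sd_map Y f p (action (Sd X) p q \<beta> c) = action (Sd Y) p q \<beta> (Sd_map Y f q c)"
    if "\<beta> \<in> operators p q" "c \<in> simplices (Sd X) q" for p q \<beta> c
    using that by (auto simp: Sd_simplices_iff Sd_action_class Sd_map_def
        coend_map_induced_class[OF assms])
  ultimately show ?thesis
    by (simp add: sset_map_def)
qed

lemma sset_map_kappa:
  "sset_map (Sd (sset_prod X Y)) (sset_prod (Sd X) (Sd Y)) (kappa X Y)"
  using sset_map_pair[OF sset_map_Sd_map[OF sset_map_fst[of X Y]] sset_map_Sd_map[OF sset_map_snd[of X Y]]]
  by (simp add: kappa_def[abs_def])

text \<open>The universal property of \<open>Sd X\<close> as a pointwise left Kan extension: it is the colimit of the
  nerves \<open>subdivided_simplex n\<close> over the category of simplices \<open>(n, x)\<close> of \<open>X\<close>.\<close>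

lemma Sd_cocone:
  assumes "x \<in> simplices X n"
  shows "sset_map (subdivided_simplex n) (Sd X)
    (\<lambda>q s. coend_rel X (\<lambda>n. simplices (subdivided_simplex n) q) (subdivided_push q) `` {(n, x, s)})"
  using assms unfolding sset_map_def
  by (auto simp: Sd_simplices_iff Sd_action_class)

lemma Sd_cocone_natural:
  assumes "\<alpha> \<in> operators m n" "x \<in> simplices X n" "s \<in> simplices (subdivided_simplex m) q"
  shows "coend_rel X (\<lambda>n. simplices (subdivided_simplex n) q) (subdivided_push q)
           `` {(m, action X m n \<alpha> x, s)}
       = coend_rel X (\<lambda>n. simplices (subdivided_simplex n) q) (subdivided_push q)
           `` {(n, x, subdivided_push q m n \<alpha> s)}"
  using assms
  by (intro equiv_class_eq[OF equiv_coend_rel] coend_step_rel) (auto simp: coend_step_def)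

lemma Sd_universal:
  assumes map: "\<And>n x. x \<in> simplices X n \<Longrightarrow> sset_map (subdivided_simplex n) Z (\<phi> n x)"
    and natural: "\<And>m n \<alpha> x q s. \<alpha> \<in> operators m n \<Longrightarrow> x \<in> simplices X n \<Longrightarrow>
      s \<in> simplices (subdivided_simplex m) q \<Longrightarrow>
      \<phi> m (action X m n \<alpha> x) q s = \<phi> n x q (subdivided_push q m n \<alpha> s)"
  obtains h where "sset_map (Sd X) Z h"
    "\<And>n x q s. x \<in> simplices X n \<Longrightarrow> s \<in> simplices (subdivided_simplex n) q \<Longrightarrow>
      h q (coend_rel X (\<lambda>n. simplices (subdivided_simplex n) q) (subdivided_push q) `` {(n, x, s)})
        = \<phi> n x q s"
    "\<And>h'. (\<And>n x q s. x \<in> simplices X n \<Longrightarrow> s \<in> simplices (subdivided_simplex n) q \<Longrightarrow>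
      h' q (coend_rel X (\<lambda>n. simplices (subdivided_simplex n) q) (subdivided_push q) `` {(n, x, s)})
        = \<phi> n x q s) \<Longrightarrow> \<forall>q. \<forall>c \<in> simplices (Sd X) q. h' q c = h q c"
proof -
  define R where "R q = coend_rel X (\<lambda>n. simplices (subdivided_simplex n) q) (subdivided_push q)" for q
  define h where "h q c = (\<lambda>(n, x, s). \<phi> n x q s) (SOME p. p \<in> c)" for q c
  have const: "(\<lambda>(n, x, s). \<phi> n x q s) p = (\<lambda>(n, x, s). \<phi> n x q s) p'"
    if "(p, p') \<in> R q" for p p' q
  proof -
    have "((\<lambda>(n, x, s). \<phi> n x q s) p, (\<lambda>(n, x, s). \<phi> n x q s) p') \<in> Id"
      using that[unfolded R_def]
    proof (rule coend_rel_induct)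
      show "equiv UNIV (Id :: 'b rel)"
        by (auto simp: equiv_def refl_Id sym_Id trans_Id)
    qed (auto simp: coend_step_def natural)
    then show ?thesis by simp
  qed
  have h: "h q (R q `` {(n, x, s)}) = \<phi> n x q s" for q n x s
  proof -
    have "(n, x, s) \<in> R q `` {(n, x, s)}"
      by (simp add: R_def coend_rel_def)
    then have "((n, x, s), SOME p. p \<in> R q `` {(n, x, s)}) \<in> R q"
      by (metis (mono_tags, lifting) Image_singleton_iff someI)
    from const[OF this] show ?thesis
      by (simp add: h_def)
  qed
  have "sset_map (Sd X) Z h"
    unfolding sset_map_def
  proof (intro conjI allI ballI)
    fix q c assume "c \<in> simplices (Sd X) q"
    then show "h q c \<in> simplices Z q"
      using map h unfolding Sd_simplices_iff R_def sset_map_def by fastforce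
  next
    fix p q \<beta> c assume b: "\<beta> \<in> operators p q" and "c \<in> simplices (Sd X) q"
    then obtain n x s where x: "x \<in> simplices X n" "s \<in> simplices (subdivided_simplex n) q"
      and c: "c = R q `` {(n, x, s)}"
      unfolding Sd_simplices_iff R_def by blast
    have "action (Sd X) p q \<beta> c = R p `` {(n, x, action (subdivided_simplex n) p q \<beta> s)}"
      unfolding c R_def by (rule Sd_action_class[OF b])
    then show "h p (action (Sd X) p q \<beta> c) = action Z p q \<beta> (h q c)"
      using map[OF x(1)] b x by (simp add: h c sset_map_def)
  qed
  moreover have "\<forall>q. \<forall>c \<in> simplices (Sd X) q. h' q c = h q c"
    if "\<And>n x q s. x \<in> simplices X n \<Longrightarrow> s \<in> simplices (subdivided_simplex n) q \<Longrightarrow>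
      h' q (R q `` {(n, x, s)}) = \<phi> n x q s" for h'
  proof (intro allI ballI)
    fix q c assume "c \<in> simplices (Sd X) q"
    then obtain n x s where "x \<in> simplices X n" "s \<in> simplices (subdivided_simplex n) q"
      "c = R q `` {(n, x, s)}"
      unfolding Sd_simplices_iff R_def by blast
    then show "h' q c = h q c" using that h by simp
  qed
  ultimately show thesis
    using that h unfolding R_def by blast
qed

lemma topspace_realization_sum [simp]:
  "topspace (realization_sum X) = coend_points X standard_simplex"
  by (auto simp: realization_sum_def coend_points_def simplex_space_def)

lemma openin_realization:
  "openin (realization X) U \<longleftrightarrow> U \<subseteq> coend X standard_simplex simplex_push \<and>
     openin (realization_sum X)
       {p \<in> topspace (realization_sum X). coend_rel X standard_simplex simplex_push `` {p} \<in> U}"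
proof -
  let ?q = "\<lambda>p. coend_rel X standard_simplex simplex_push `` {p}"
  let ?S = "realization_sum X"
  have "{p \<in> topspace ?S. ?q p \<in> U \<inter> V} = {p \<in> topspace ?S. ?q p \<in> U} \<inter> {p \<in> topspace ?S. ?q p \<in> V}"
    for U V by auto
  moreover have "{p \<in> topspace ?S. ?q p \<in> \<Union>\<K>} = (\<Union>U\<in>\<K>. {p \<in> topspace ?S. ?q p \<in> U})" for \<K>
    by auto
  ultimately have "istopology (\<lambda>U. U \<subseteq> coend X standard_simplex simplex_push \<and>
      openin ?S {p \<in> topspace ?S. ?q p \<in> U})"
    unfolding istopology_def by (simp only:) blast
  then show ?thesis
    by (simp add: realization_def)
qed

lemma topspace_realization [simp]:
  "topspace (realization X) = coend X standard_simplex simplex_push"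
proof -
  have "{p \<in> topspace (realization_sum X). coend_rel X standard_simplex simplex_push `` {p}
      \<in> coend X standard_simplex simplex_push} = topspace (realization_sum X)"
    by (auto simp: coend_def quotientI)
  then have "openin (realization X) (coend X standard_simplex simplex_push)"
    unfolding openin_realization by (metis openin_topspace subset_refl)
  then show ?thesis
    by (meson openin_realization openin_subset openin_topspace subset_antisym)
qed

lemma quotient_map_realization:
  "quotient_map (realization_sum X) (realization X)
     (\<lambda>p. coend_rel X standard_simplex simplex_push `` {p})"
  unfolding quotient_map_def
  by (auto simp: openin_realization) (auto simp: coend_def quotient_def)

end

(* The realization of the n-simplex's subdivision is the set M_n of functions w : [n] -> [0,1] with
   maximum 1, a point sum_l t_l s_l of a chain of subsets s_l being sent to the function
   sum_l t_l 1_{s_l}; an operator acts by w |-> (j |-> max of w over the preimage of j). Hence |Sd X| is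
   the coend of X with the M_n, and each of its points has a normal form (x, u) with x a nondegenerate
   simplex and u > 0 on all vertices. The fibre of |kappa| over the pair of points with normal forms
   (x, u) and (y, v) is therefore independent of X and Y: it is the space of nonnegative matrices whose
   support is a chain of positions and whose row and column maxima are u and v (max-plus couplings).
   By induction on the number of rows and columns this space is built from smaller ones by gluing along
   closed subspaces, and a union of two absolute extensors along a closed absolute extensor is again
   one; so it is an absolute extensor and in particular contractible. *)

theory Submission
  imports Defs
begin

section \<open>Absolute extensors\<close>

text \<open>Unions of contractible spaces along closed contractible subspaces need not be
  contractible; extension properties glue without any cofibration argument. Removing the least
  position (i, j) does not stay within exact couplings. In a tie \<open>u i = v j\<close> the corner
  alone serves its row and its column, so the surviving arm is only bounded; hence a second family
  with an additional bounded column takes part in the induction. If the rest of a tie is unbalanced,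
  say with a dominating row, column j must serve the largest remaining row, and its maximum is
  lowered to that value (symmetrically for columns). Maxima appear because operators take images of
  sets: along a chain, the vertex over j that enters first carries the whole weight of j. Points of
  the realization of Sd X x Sd Y are compared without identifying it with a product of realizations:
  a pair of chains of sets is a single chain of subsets of the disjoint union of the vertex sets.
  The comparison of a fibre with the couplings is handled as a relation. It is a continuous
  bijection from a compact to a Hausdorff space, so continuity of the inverse comes for
  free.\<close>

text \<open>The type argument fixes where the test spaces live, since types cannot be quantified
  inside a formula; \<open>U\<close> ranges over all subsets of that type. Contractibility will use
  pairs of a real and a point.\<close>

definition absolute_extensor ::
  "'z::{metric_space,second_countable_topology} itself \<Rightarrow> 'a::topological_space set \<Rightarrow> bool" where
  "absolute_extensor (_ :: 'z itself) S \<longleftrightarrow>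
    (\<forall>U C (f :: 'z \<Rightarrow> 'a). closedin (top_of_set U) C \<longrightarrow> continuous_on C f \<longrightarrow> f ` C \<subseteq> S \<longrightarrow>
      (\<exists>g. continuous_on U g \<and> g ` U \<subseteq> S \<and> (\<forall>x\<in>C. g x = f x)))"

lemma absolute_extensorD:
  fixes f :: "'z::{metric_space,second_countable_topology} \<Rightarrow> 'a::topological_space"
  assumes "absolute_extensor TYPE('z) S" "closedin (top_of_set U) C" "continuous_on C f" "f ` C \<subseteq> S"
  obtains g where "continuous_on U g" "g ` U \<subseteq> S" "\<And>x. x \<in> C \<Longrightarrow> g x = f x"
  using assms unfolding absolute_extensor_def by metis

lemma absolute_extensor_retract:
  fixes S :: "'a::topological_space set" and T :: "'b::topological_space set"
  assumes S: "absolute_extensor TYPE('z::{metric_space,second_countable_topology}) S"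
    and r: "continuous_on S r" "r ` S \<subseteq> T"
    and i: "continuous_on T i" "i ` T \<subseteq> S" "\<And>x. x \<in> T \<Longrightarrow> r (i x) = x"
  shows "absolute_extensor TYPE('z) T"
  unfolding absolute_extensor_def
proof (intro allI impI)
  fix U C and f :: "'z \<Rightarrow> 'b"
  assume C: "closedin (top_of_set U) C" and f: "continuous_on C f" "f ` C \<subseteq> T"
  have "continuous_on C (i \<circ> f)" "(i \<circ> f) ` C \<subseteq> S"
    using f i continuous_on_compose[OF f(1) continuous_on_subset[OF i(1) f(2)]] by auto
  then obtain g where g: "continuous_on U g" "g ` U \<subseteq> S" "\<And>x. x \<in> C \<Longrightarrow> g x = (i \<circ> f) x"
    using absolute_extensorD[OF S C] by metis
  have "continuous_on U (r \<circ> g)" "(r \<circ> g) ` U \<subseteq> T"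
    using g r continuous_on_compose[OF g(1) continuous_on_subset[OF r(1) g(2)]] by auto
  moreover have "\<forall>x\<in>C. (r \<circ> g) x = f x"
    using g i f by auto
  ultimately show "\<exists>g. continuous_on U g \<and> g ` U \<subseteq> T \<and> (\<forall>x\<in>C. g x = f x)"
    by blast
qed

lemma absolute_extensor_singleton:
  "absolute_extensor TYPE('z::{metric_space,second_countable_topology}) {a}"
  unfolding absolute_extensor_def by (auto intro!: exI[of _ "\<lambda>x. a"])

text \<open>The empty map on the closed set {} extends to the whole test type, and types are
  inhabited.\<close>

lemma absolute_extensor_nonempty:
  assumes "absolute_extensor TYPE('z::{metric_space,second_countable_topology}) S"
  shows "S \<noteq> {}"
proof -
  have "closedin (top_of_set (UNIV :: 'z set)) {}" by simp
  from absolute_extensorD[OF assms this, of undefined] obtain g :: "'z \<Rightarrow> 'a" where "g ` UNIV \<subseteq> S"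
    by (metis continuous_on_empty empty_subsetI image_empty)
  then show ?thesis by blast
qed

text \<open>The map that is the identity on the end 0 and constant on the end 1 extends from {0,1} x
  S to [0,1] x S; the extension is a contraction.\<close>

lemma absolute_extensor_contractible:
  fixes S :: "'a::{metric_space,second_countable_topology} set"
  assumes S: "absolute_extensor TYPE(real \<times> 'a) S"
  shows "contractible S"
proof -
  obtain a where a: "a \<in> S"
    using absolute_extensor_nonempty[OF S] by auto
  let ?U = "{0..1::real} \<times> S" and ?C = "{0,1::real} \<times> S"
  define f where "f = (\<lambda>(t :: real, x). if t = 0 then x else a)"
  have C: "closedin (top_of_set ?U) ?C"
  proof -
    have "?C = ?U \<inter> ({0,1} \<times> UNIV)" by auto
    moreover have "closed ({0,1::real} \<times> (UNIV :: 'a set))" by (intro closed_Times) auto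
    ultimately show ?thesis by (metis closedin_closed)
  qed
  have "continuous_on ({0} \<times> S \<union> {1} \<times> S) f"
  proof (rule continuous_on_Un_local)
    have "{0::real} \<times> S = ({0} \<times> S \<union> {1} \<times> S) \<inter> ({0} \<times> UNIV)" by auto
    moreover have "closed ({0::real} \<times> (UNIV :: 'a set))" by (intro closed_Times) auto
    ultimately show "closedin (top_of_set ({0} \<times> S \<union> {1} \<times> S)) ({0::real} \<times> S)"
      by (metis closedin_closed)
    have "{1::real} \<times> S = ({0} \<times> S \<union> {1} \<times> S) \<inter> ({1} \<times> UNIV)" by auto
    moreover have "closed ({1::real} \<times> (UNIV :: 'a set))" by (intro closed_Times) auto
    ultimately show "closedin (top_of_set ({0} \<times> S \<union> {1} \<times> S)) ({1::real} \<times> S)"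
      by (metis closedin_closed)
    show "continuous_on ({0} \<times> S) f"
      by (rule continuous_on_eq[of _ snd]) (auto simp: f_def continuous_on_snd continuous_on_id)
    show "continuous_on ({1} \<times> S) f"
      by (rule continuous_on_eq[of _ "\<lambda>_. a"]) (auto simp: f_def)
  qed
  moreover have "{0} \<times> S \<union> {1} \<times> S = ?C" by auto
  ultimately have f: "continuous_on ?C f" by simp
  have "f ` ?C \<subseteq> S" using a by (auto simp: f_def)
  from absolute_extensorD[OF S C f this] obtain g
    where g: "continuous_on ?U g" "g ` ?U \<subseteq> S" "\<And>p. p \<in> ?C \<Longrightarrow> g p = f p" by metis
  have "homotopic_with_canon (\<lambda>x. True) S S id (\<lambda>x. a)"
    using g by (subst homotopic_with) (auto simp: f_def intro!: exI[of _ g])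
  then show ?thesis
    unfolding contractible_def by blast
qed

text \<open>The domain is divided into the points closer to the part mapped to \<open>A\<close> and those closer to the
  part mapped to \<open>B\<close>; one extends first over the equidistant points.\<close>

lemma absolute_extensor_Un:
  fixes A B :: "'a::topological_space set"
  assumes A: "absolute_extensor TYPE('z::{metric_space,second_countable_topology}) A"
    and B: "absolute_extensor TYPE('z) B" and AB: "absolute_extensor TYPE('z) (A \<inter> B)"
    and clA: "closedin (top_of_set (A \<union> B)) A" and clB: "closedin (top_of_set (A \<union> B)) B"
  shows "absolute_extensor TYPE('z) (A \<union> B)"
  unfolding absolute_extensor_def
proof (intro allI impI)
  fix U C and f :: "'z \<Rightarrow> 'a"
  assume C: "closedin (top_of_set U) C" and f: "continuous_on C f" "f ` C \<subseteq> A \<union> B"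
  define CA where "CA = {x \<in> C. f x \<in> A}"
  define CB where "CB = {x \<in> C. f x \<in> B}"
  have cl: "closedin (top_of_set C) CA" "closedin (top_of_set C) CB"
  proof -
    have "f \<in> C \<rightarrow> A \<union> B" using f(2) by blast
    moreover have "CA = C \<inter> f -` A" "CB = C \<inter> f -` B" by (auto simp: CA_def CB_def)
    ultimately show "closedin (top_of_set C) CA" "closedin (top_of_set C) CB"
      using continuous_closedin_preimage_gen[OF f(1) _ clA] continuous_closedin_preimage_gen[OF f(1) _ clB]
      by metis+
  qed
  then have clU: "closedin (top_of_set U) CA" "closedin (top_of_set U) CB"
    using closedin_trans[OF _ C] by auto
  have Ceq: "C = CA \<union> CB" using f by (auto simp: CA_def CB_def)
  show "\<exists>g. continuous_on U g \<and> g ` U \<subseteq> A \<union> B \<and> (\<forall>x\<in>C. g x = f x)"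
  \<comment> \<open>\<open>setdist\<close> to the empty set is 0 by convention, so distances can be
    compared only when both preimages are nonempty. Otherwise \<open>f\<close> maps into one of the
    two sets.\<close>
  proof (cases "CA = {} \<or> CB = {}")
    case True
    then have cases: "f ` C \<subseteq> A \<or> f ` C \<subseteq> B"
      using f by (auto simp: CA_def CB_def)
    show ?thesis
      using cases
    proof
      assume "f ` C \<subseteq> A"
      from absolute_extensorD[OF A C f(1) this] show ?thesis by (metis le_supI1)
    next
      assume "f ` C \<subseteq> B"
      from absolute_extensorD[OF B C f(1) this] show ?thesis by (metis le_supI2)
    qed
  next
    case False
    define d where "d x = setdist {x} CA - setdist {x} CB" for x
    have d: "continuous_on U d"
      unfolding d_def by (intro continuous_intros continuous_on_setdist)
    have zero: "x \<in> CA \<longleftrightarrow> setdist {x} CA = 0" "x \<in> CB \<longleftrightarrow> setdist {x} CB = 0" if "x \<in> U" for x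
      using setdist_eq_0_closedin[OF clU(1) that] setdist_eq_0_closedin[OF clU(2) that] False by auto
    define UA where "UA = {x \<in> U. d x \<le> 0}"
    define UB where "UB = {x \<in> U. d x \<ge> 0}"
    have U: "U = UA \<union> UB" by (auto simp: UA_def UB_def)
    have "UA = U \<inter> d -` {..0}" "UB = U \<inter> d -` {0..}" by (auto simp: UA_def UB_def)
    then have clUAB: "closedin (top_of_set U) UA" "closedin (top_of_set U) UB"
      using continuous_closedin_preimage[OF d] by auto
    have CU: "C \<subseteq> U" using C closedin_imp_subset by blast
    have sub: "CA \<subseteq> UA" "CB \<subseteq> UB"
      using zero CU setdist_pos_le[of _ CA] setdist_pos_le[of _ CB]
      by (auto simp: UA_def UB_def d_def Ceq)
    \<comment> \<open>A point of \<open>C\<close> outside \<open>CA\<close> lies in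
      \<open>CB\<close>, at distance 0 from it. Being in \<open>UA\<close> then forces distance 0
      from \<open>CA\<close>, hence membership, because \<open>CA\<close> is closed in
      \<open>U\<close>.\<close>
    have CUA: "C \<inter> UA = CA"
    proof
      show "C \<inter> UA \<subseteq> CA"
      proof
        fix x assume x: "x \<in> C \<inter> UA"
        show "x \<in> CA"
        proof (cases "x \<in> CA")
          case False
          then have "x \<in> CB" using x Ceq by auto
          with x have "setdist {x} CA \<le> 0" using zero[of x] CU by (auto simp: UA_def d_def)
          with x show ?thesis using zero(1)[of x] CU setdist_pos_le[of "{x}" CA] by force
        qed
      qed
    qed (use sub Ceq in auto)
    have CUB: "C \<inter> UB = CB"
    proof
      show "C \<inter> UB \<subseteq> CB"
      proof
        fix x assume x: "x \<in> C \<inter> UB"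
        show "x \<in> CB"
        proof (cases "x \<in> CB")
          case False
          then have "x \<in> CA" using x Ceq by auto
          with x have "setdist {x} CB \<le> 0" using zero[of x] CU by (auto simp: UB_def d_def)
          with x show ?thesis using zero(2)[of x] CU setdist_pos_le[of "{x}" CB] by force
        qed
      qed
    qed (use sub Ceq in auto)
    let ?V = "UA \<inter> UB"
    have "closedin (top_of_set ?V) (C \<inter> ?V)"
    proof -
      obtain K where "closed K" "C = U \<inter> K" using C unfolding closedin_closed by blast
      moreover have "?V \<subseteq> U" using U by blast
      ultimately have "C \<inter> ?V = ?V \<inter> K" "closed K" by auto
      then show ?thesis unfolding closedin_closed by blast
    qed
    moreover have "continuous_on (C \<inter> ?V) f" using f(1) continuous_on_subset by blast
    moreover have "f ` (C \<inter> ?V) \<subseteq> A \<inter> B" using CUA CUB by (auto simp: CA_def CB_def)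
    ultimately obtain h where h: "continuous_on ?V h" "h ` ?V \<subseteq> A \<inter> B" "\<And>x. x \<in> C \<inter> ?V \<Longrightarrow> h x = f x"
      by (rule absolute_extensorD[OF AB]) (rule that)
    \<comment> \<open>Prescribing \<open>f\<close> together with \<open>h\<close> on both sides
      makes the two separate extensions agree on the equidistant points.\<close>
    define k where "k x = (if x \<in> C then f x else h x)" for x
    have clV: "closedin (top_of_set U) ?V" using clUAB by blast
    have "continuous_on (C \<union> ?V) k"
    proof -
      have "continuous_on (C \<union> ?V) (\<lambda>x. if x \<in> C then f x else h x)"
      proof (rule continuous_on_cases_local)
        show "closedin (top_of_set (C \<union> ?V)) C" "closedin (top_of_set (C \<union> ?V)) ?V"
          using closedin_subset_trans[OF C, of "C \<union> ?V"] closedin_subset_trans[OF clV, of "C \<union> ?V"] CU U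
          by auto
      qed (use f h in auto)
      then show ?thesis by (simp add: k_def[abs_def])
    qed
    then have kc: "continuous_on (CA \<union> ?V) k" "continuous_on (CB \<union> ?V) k"
      by (rule continuous_on_subset; use Ceq in auto)+
    have "k ` (CA \<union> ?V) \<subseteq> A" "k ` (CB \<union> ?V) \<subseteq> B"
      using h CUA CUB by (auto simp: k_def CA_def CB_def)
    note kA = this(1) and kB = this(2)
    have clA': "closedin (top_of_set UA) (CA \<union> ?V)" and clB': "closedin (top_of_set UB) (CB \<union> ?V)"
      using closedin_subset_trans[OF closedin_Un[OF clU(1) clV], of UA]
        closedin_subset_trans[OF closedin_Un[OF clU(2) clV], of UB] sub U
      by auto
    obtain gA where
      gA: "continuous_on UA gA" "gA ` UA \<subseteq> A" "\<And>x. x \<in> CA \<union> ?V \<Longrightarrow> gA x = k x"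
      using absolute_extensorD[OF A clA' kc(1) kA] by blast
    obtain gB where
      gB: "continuous_on UB gB" "gB ` UB \<subseteq> B" "\<And>x. x \<in> CB \<union> ?V \<Longrightarrow> gB x = k x"
      using absolute_extensorD[OF B clB' kc(2) kB] by blast
    define g where "g x = (if x \<in> UA then gA x else gB x)" for x
    have "continuous_on (UA \<union> UB) (\<lambda>x. if x \<in> UA then gA x else gB x)"
      by (rule continuous_on_cases_local) (use clUAB U gA gB in auto)
    then have "continuous_on U g" by (simp add: g_def[abs_def] U)
    moreover have "g ` U \<subseteq> A \<union> B" using gA gB by (auto simp: g_def U)
    moreover have "\<forall>x\<in>C. g x = f x"
    proof
      fix x assume x: "x \<in> C"
      show "g x = f x"
      proof (cases "x \<in> UA")
        case True
        with x have "x \<in> CA" using CUA by auto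
        with True x gA show ?thesis by (auto simp: g_def k_def)
      next
        case False
        with x have "x \<in> CB" using CUA Ceq by auto
        with False x gB show ?thesis by (auto simp: g_def k_def)
      qed
    qed
    ultimately show ?thesis by blast
  qed
qed

lemma continuous_on_fun_upd:
  fixes f :: "'z::topological_space \<Rightarrow> 'i \<Rightarrow> 'b::topological_space"
  assumes "continuous_on S f" "continuous_on S g"
  shows "continuous_on S (\<lambda>z. (f z)(p := g z))"
proof (rule continuous_on_coordinatewise_then_product)
  fix i
  show "continuous_on S (\<lambda>z. ((f z)(p := g z)) i)"
    using assms continuous_on_product_then_coordinatewise[OF assms(1), of i] by (cases "i = p") auto
qed

text \<open>Filling the entry \<open>p\<close>, which is 0 throughout \<open>S\<close>, with a
  constant is a homeomorphism onto the new set; its inverse resets the entry to 0.\<close>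

lemma absolute_extensor_corner:
  fixes S :: "('i \<Rightarrow> real) set"
  assumes S: "absolute_extensor TYPE('z::{metric_space,second_countable_topology}) S"
    and zero: "\<And>w. w \<in> S \<Longrightarrow> w p = 0"
  shows "absolute_extensor TYPE('z) {w. w p = a \<and> w(p := 0) \<in> S}"
  using S
proof (rule absolute_extensor_retract[where r = "\<lambda>w. w(p := a)" and i = "\<lambda>w. w(p := 0)"])
  show "(\<lambda>w. w(p := a)) ` S \<subseteq> {w. w p = a \<and> w(p := 0) \<in> S}"
    using zero fun_upd_triv by (metis (mono_tags, lifting) fun_upd_same fun_upd_upd image_subsetI mem_Collect_eq)
qed (auto intro!: continuous_on_fun_upd continuous_on_id continuous_on_const)

text \<open>The set is a product of \<open>S\<close> with an interval: the entry at \<open>p\<close>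
  is extended by Tietze, the others by the extension property of \<open>S\<close>.\<close>

lemma absolute_extensor_cylinder:
  fixes S :: "('i \<Rightarrow> real) set"
  assumes S: "absolute_extensor TYPE('z::{metric_space,second_countable_topology}) S"
    and zero: "\<And>w. w \<in> S \<Longrightarrow> w p = 0" and a: "0 \<le> a"
  shows "absolute_extensor TYPE('z) {w. 0 \<le> w p \<and> w p \<le> a \<and> w(p := 0) \<in> S}"
  unfolding absolute_extensor_def
proof (intro allI impI)
  fix U C and f :: "'z \<Rightarrow> 'i \<Rightarrow> real"
  assume C: "closedin (top_of_set U) C" and f: "continuous_on C f"
    "f ` C \<subseteq> {w. 0 \<le> w p \<and> w p \<le> a \<and> w(p := 0) \<in> S}"
  have "continuous_on C (\<lambda>z. f z p)"
    by (rule continuous_on_product_then_coordinatewise[OF f(1)])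
  then obtain h where h: "continuous_on U h" "\<And>x. x \<in> C \<Longrightarrow> h x = f x p" "\<And>x. x \<in> U \<Longrightarrow> h x \<in> cbox 0 a"
    using Tietze_closed_interval_1[OF _ C a, of "\<lambda>z. f z p"] f(2) by auto
  have "continuous_on C (\<lambda>z. (f z)(p := 0))" "(\<lambda>z. (f z)(p := 0)) ` C \<subseteq> S"
    using f by (auto intro!: continuous_on_fun_upd continuous_on_const)
  then obtain g where g: "continuous_on U g" "g ` U \<subseteq> S" "\<And>x. x \<in> C \<Longrightarrow> g x = (f x)(p := 0)"
    using absolute_extensorD[OF S C] by metis
  have "(g x)(p := 0) = g x" if "x \<in> U" for x
    using zero[of "g x"] g(2) that fun_upd_triv by (metis image_subset_iff)
  then show "\<exists>g. continuous_on U g \<and> g ` U \<subseteq> {w. 0 \<le> w p \<and> w p \<le> a \<and> w(p := 0) \<in> S} \<and> (\<forall>x\<in>C. g x = f x)"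
    using g h by (intro exI[of _ "\<lambda>z. (g z)(p := h z)"])
      (auto intro!: continuous_on_fun_upd simp: image_subset_iff)
qed

section \<open>Couplings in the max-plus sense\<close>

text \<open>The gluing lemma with the pieces given by closed conditions on the whole space, which
  makes their relative closedness in \<open>S\<close> automatic at each use.\<close>

lemma absolute_extensor_closed_cover:
  fixes S :: "'a::topological_space set"
  assumes "closed {w. P w}" "closed {w. Q w}" "\<And>w. w \<in> S \<Longrightarrow> P w \<or> Q w"
    and "absolute_extensor TYPE('z::{metric_space,second_countable_topology}) {w \<in> S. P w}"
      "absolute_extensor TYPE('z) {w \<in> S. Q w}" "absolute_extensor TYPE('z) {w \<in> S. P w \<and> Q w}"
  shows "absolute_extensor TYPE('z) S"
proof -
  have S: "S = {w \<in> S. P w} \<union> {w \<in> S. Q w}" using assms(3) by auto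
  have "{w \<in> S. P w} = S \<inter> {w. P w}" "{w \<in> S. Q w} = S \<inter> {w. Q w}" by auto
  then have cl: "closedin (top_of_set S) {w \<in> S. P w}" "closedin (top_of_set S) {w \<in> S. Q w}"
    using assms(1,2) unfolding closedin_closed by blast+
  have "{w \<in> S. P w} \<inter> {w \<in> S. Q w} = {w \<in> S. P w \<and> Q w}" by auto
  with absolute_extensor_Un[OF assms(4,5)] assms(6) cl S show ?thesis by simp
qed

text \<open>Totally ordered supports in the product order arise from weights on the vertices of a
  simplex pushed along a pair of order-preserving maps.\<close>

definition chain_supported :: "(nat \<times> nat \<Rightarrow> real) \<Rightarrow> bool" where
  "chain_supported w \<longleftrightarrow>
    (\<forall>r c r' c'. w (r, c) \<noteq> 0 \<longrightarrow> w (r', c') \<noteq> 0 \<longrightarrow> r \<le> r' \<and> c \<le> c' \<or> r' \<le> r \<and> c' \<le> c)"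

text \<open>Couplings of \<open>u\<close> and \<open>v\<close> in the max-plus sense: rows in \<open>I\<close> have maximum exactly \<open>u\<close>, the other
  rows in \<open>I'\<close> at most \<open>u\<close>, and likewise for the columns.\<close>

definition tropical_couplings ::
  "nat set \<Rightarrow> nat set \<Rightarrow> nat set \<Rightarrow> nat set \<Rightarrow> (nat \<Rightarrow> real) \<Rightarrow> (nat \<Rightarrow> real) \<Rightarrow> (nat \<times> nat \<Rightarrow> real) set" where
  "tropical_couplings I I' J J' u v =
    {w. (\<forall>r c. 0 \<le> w (r, c)) \<and>
        (\<forall>r c. w (r, c) \<noteq> 0 \<longrightarrow> r \<in> I' \<and> c \<in> J' \<and> w (r, c) \<le> u r \<and> w (r, c) \<le> v c) \<and>
        chain_supported w \<and> (\<forall>r\<in>I. \<exists>c. w (r, c) = u r) \<and> (\<forall>c\<in>J. \<exists>r. w (r, c) = v c)}"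

lemma tropical_couplingsI:
  assumes "\<And>r c. 0 \<le> w (r, c)"
    and "\<And>r c. w (r, c) \<noteq> 0 \<Longrightarrow> r \<in> I' \<and> c \<in> J' \<and> w (r, c) \<le> u r \<and> w (r, c) \<le> v c"
    and "\<And>r c r' c'. w (r, c) \<noteq> 0 \<Longrightarrow> w (r', c') \<noteq> 0 \<Longrightarrow> r \<le> r' \<and> c \<le> c' \<or> r' \<le> r \<and> c' \<le> c"
    and "\<And>r. r \<in> I \<Longrightarrow> \<exists>c. w (r, c) = u r" "\<And>c. c \<in> J \<Longrightarrow> \<exists>r. w (r, c) = v c"
  shows "w \<in> tropical_couplings I I' J J' u v"
proof -
  have "\<forall>r c. 0 \<le> w (r, c)" using assms(1) by (intro allI)
  moreover have "\<forall>r c. w (r, c) \<noteq> 0 \<longrightarrow> r \<in> I' \<and> c \<in> J' \<and> w (r, c) \<le> u r \<and> w (r, c) \<le> v c"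
    using assms(2) by (intro allI impI)
  moreover have "chain_supported w"
    unfolding chain_supported_def using assms(3) by (intro allI impI)
  moreover have "\<forall>r\<in>I. \<exists>c. w (r, c) = u r" using assms(4) by (intro ballI)
  moreover have "\<forall>c\<in>J. \<exists>r. w (r, c) = v c" using assms(5) by (intro ballI)
  ultimately show ?thesis unfolding tropical_couplings_def by (intro CollectI conjI)
qed

lemma tropical_couplingsD:
  assumes "w \<in> tropical_couplings I I' J J' u v"
  shows "0 \<le> w (r, c)"
    and "w (r, c) \<noteq> 0 \<Longrightarrow> r \<in> I'" "w (r, c) \<noteq> 0 \<Longrightarrow> c \<in> J'"
    and "w (r, c) \<noteq> 0 \<Longrightarrow> w (r, c) \<le> u r" "w (r, c) \<noteq> 0 \<Longrightarrow> w (r, c) \<le> v c"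
    and "w (r, c) \<noteq> 0 \<Longrightarrow> w (r', c') \<noteq> 0 \<Longrightarrow> r \<le> r' \<and> c \<le> c' \<or> r' \<le> r \<and> c' \<le> c"
    and "r \<in> I \<Longrightarrow> \<exists>c. w (r, c) = u r" "c \<in> J \<Longrightarrow> \<exists>r. w (r, c) = v c"
proof -
  note C = assms[unfolded tropical_couplings_def mem_Collect_eq]
  note D = C[THEN conjunct1] C[THEN conjunct2, THEN conjunct1]
    C[THEN conjunct2, THEN conjunct2, THEN conjunct1]
    C[THEN conjunct2, THEN conjunct2, THEN conjunct2, THEN conjunct1]
    C[THEN conjunct2, THEN conjunct2, THEN conjunct2, THEN conjunct2]
  show "0 \<le> w (r, c)"
    and "w (r, c) \<noteq> 0 \<Longrightarrow> r \<in> I'" "w (r, c) \<noteq> 0 \<Longrightarrow> c \<in> J'"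
    and "w (r, c) \<noteq> 0 \<Longrightarrow> w (r, c) \<le> u r" "w (r, c) \<noteq> 0 \<Longrightarrow> w (r, c) \<le> v c"
    using D(1,2) by blast+
  show "w (r, c) \<noteq> 0 \<Longrightarrow> w (r', c') \<noteq> 0 \<Longrightarrow> r \<le> r' \<and> c \<le> c' \<or> r' \<le> r \<and> c' \<le> c"
    using D(3) unfolding chain_supported_def by blast
  show "r \<in> I \<Longrightarrow> \<exists>c. w (r, c) = u r" "c \<in> J \<Longrightarrow> \<exists>r. w (r, c) = v c"
    using D(4,5) by blast+
qed

lemma tropical_couplings_empty: "tropical_couplings {} {} {} J' u v = {\<lambda>p. 0}"
proof
  show "{\<lambda>p. 0} \<subseteq> tropical_couplings {} {} {} J' u v"
    by (auto intro!: tropical_couplingsI)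
  show "tropical_couplings {} {} {} J' u v \<subseteq> {\<lambda>p. 0}"
  proof
    fix w assume "w \<in> tropical_couplings {} {} {} J' u v"
    then have "w (r, c) = 0" for r c using tropical_couplingsD(2) by blast
    then show "w \<in> {\<lambda>p. 0}" by auto
  qed
qed

lemma tropical_couplings_swap:
  "(\<lambda>w. w \<circ> prod.swap) ` tropical_couplings I I' J J' u v \<subseteq> tropical_couplings J J' I I' v u"
proof clarify
  fix w assume w: "w \<in> tropical_couplings I I' J J' u v"
  show "w \<circ> prod.swap \<in> tropical_couplings J J' I I' v u"
  proof (rule tropical_couplingsI)
    note D = tropical_couplingsD[OF w]
    fix r c r' c'
    show "0 \<le> (w \<circ> prod.swap) (r, c)" using D(1) by simp
    show "r \<in> J' \<and> c \<in> I' \<and> (w \<circ> prod.swap) (r, c) \<le> v r \<and> (w \<circ> prod.swap) (r, c) \<le> u c"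
      if "(w \<circ> prod.swap) (r, c) \<noteq> 0" using that D(2-5)[of c r] by simp
    show "r \<le> r' \<and> c \<le> c' \<or> r' \<le> r \<and> c' \<le> c"
      if "(w \<circ> prod.swap) (r, c) \<noteq> 0" "(w \<circ> prod.swap) (r', c') \<noteq> 0"
      using that D(6)[of c r c' r'] by auto
    show "\<exists>c. (w \<circ> prod.swap) (r, c) = v r" if "r \<in> J" using that D(8) by simp
    show "\<exists>r. (w \<circ> prod.swap) (r, c) = u c" if "c \<in> I" using that D(7) by simp
  qed
qed

lemma absolute_extensor_tropical_couplings_swap:
  assumes "absolute_extensor TYPE('z::{metric_space,second_countable_topology}) (tropical_couplings J J' I I' v u)"
  shows "absolute_extensor TYPE('z) (tropical_couplings I I' J J' u v)"
  using assms
proof (rule absolute_extensor_retract)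
  have "continuous_on S (\<lambda>w. w \<circ> prod.swap)" for S :: "(nat \<times> nat \<Rightarrow> real) set"
    by (rule continuous_on_coordinatewise_then_product)
      (auto intro!: continuous_on_product_then_coordinatewise continuous_on_id)
  then show "continuous_on (tropical_couplings J J' I I' v u) (\<lambda>w. w \<circ> prod.swap)"
    "continuous_on (tropical_couplings I I' J J' u v) (\<lambda>w. w \<circ> prod.swap)" by auto
qed (use tropical_couplings_swap in \<open>auto simp: fun_eq_iff\<close>)

text \<open>The solvability condition: a positive row maximum that is attained is an entry, hence
  bounded by some \<open>v c\<close>. For finite nonempty sets it says that \<open>u\<close> and
  \<open>v\<close> have equal maxima; if one set is empty, so is the other.\<close>

definition balanced :: "nat set \<Rightarrow> nat set \<Rightarrow> (nat \<Rightarrow> real) \<Rightarrow> (nat \<Rightarrow> real) \<Rightarrow> bool" where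
  "balanced I J u v \<longleftrightarrow> (\<forall>r\<in>I. \<exists>c\<in>J. u r \<le> v c) \<and> (\<forall>c\<in>J. \<exists>r\<in>I. v c \<le> u r)"

text \<open>The first row \<open>i\<close> and the first column \<open>j\<close> meet in the least position \<open>(i, j)\<close>, and the support
  cannot leave this position both along the row and along the column.\<close>

locale coupling_corner =
  fixes I J :: "nat set" and u v :: "nat \<Rightarrow> real" and i j :: nat
  assumes i_notin: "i \<notin> I" and j_notin: "j \<notin> J"
    and i_less: "\<And>r. r \<in> I \<Longrightarrow> i < r" and j_less: "\<And>c. c \<in> J \<Longrightarrow> j < c"
    and u_pos: "\<And>r. r \<in> insert i I \<Longrightarrow> 0 < u r" and v_pos: "\<And>c. c \<in> insert j J \<Longrightarrow> 0 < v c"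
begin

lemma row_or_column:
  assumes w: "w \<in> tropical_couplings K (insert i I) L (insert j J) u v"
  shows "(\<forall>c. c \<noteq> j \<longrightarrow> w (i, c) = 0) \<or> (\<forall>r. r \<noteq> i \<longrightarrow> w (r, j) = 0)"
proof (rule ccontr)
  assume "\<not> ?thesis"
  then obtain r c where *: "c \<noteq> j" "w (i, c) \<noteq> 0" "r \<noteq> i" "w (r, j) \<noteq> 0" by blast
  then have "i < r" "j < c" using tropical_couplingsD(2,3)[OF w] i_less j_less by blast+
  with tropical_couplingsD(6)[OF w *(2,4)] show False by auto
qed

text \<open>The corner lies below every position, so filling it keeps the support a chain. Maxima
  demanded afterwards are attained by old entries or by the corner itself. The smaller bound
  \<open>v'\<close> covers the case in which the maximum of column \<open>j\<close> has been
  lowered.\<close>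

lemma corner_upd:
  assumes w: "w \<in> tropical_couplings K I' L J' u v'" "I' \<subseteq> insert i I" "J' \<subseteq> insert j J" "w (i, j) = 0"
    and a: "0 \<le> a" "a \<le> u i" "a \<le> v j"
    and v: "\<And>c. v' c \<le> v c"
    and K: "\<And>r. r \<in> K' \<Longrightarrow> r \<in> K \<or> r = i \<and> a = u i" 
    and L: "\<And>c. c \<in> L' \<Longrightarrow> c \<in> L \<and> v' c = v c \<or> c = j \<and> a = v j"
  shows "w((i, j) := a) \<in> tropical_couplings K' (insert i I) L' (insert j J) u v"
proof (rule tropical_couplingsI)
  note D = tropical_couplingsD[OF w(1)]
  fix r c
  show "0 \<le> (w((i, j) := a)) (r, c)" using D(1) a by auto
  show "r \<in> insert i I \<and> c \<in> insert j J \<and> (w((i, j) := a)) (r, c) \<le> u r \<and> (w((i, j) := a)) (r, c) \<le> v c"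
    if "(w((i, j) := a)) (r, c) \<noteq> 0"
  proof (cases "(r, c) = (i, j)")
    case False
    with that have "w (r, c) \<noteq> 0" by auto
    with D(2-5)[OF this] False w v[of c] show ?thesis by auto
  qed (use a in auto)
  have ge: "i \<le> r \<and> j \<le> c" if "w (r, c) \<noteq> 0" for r c
    using D(2,3)[OF that] w(2,3) i_less j_less by (metis insertE less_imp_le order_refl subsetD)
  show "r \<le> r' \<and> c \<le> c' \<or> r' \<le> r \<and> c' \<le> c"
    if "(w((i, j) := a)) (r, c) \<noteq> 0" "(w((i, j) := a)) (r', c') \<noteq> 0" for r' c'
    using that D(6)[of r c r' c'] ge[of r c] ge[of r' c'] by (auto split: if_splits)
next
  note D = tropical_couplingsD[OF w(1)]
  have ne: "w (r, c) \<noteq> 0 \<Longrightarrow> (r, c) \<noteq> (i, j)" for r c using w by auto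
  fix r assume r: "r \<in> K'"
  show "\<exists>c. (w((i, j) := a)) (r, c) = u r"
  proof (cases "r = i \<and> a = u i")
    case False
    then obtain c where "w (r, c) = u r" using K[OF r] D(7) by blast
    moreover have "0 < u r \<or> (r,c) \<noteq> (i,j)" using u_pos by auto
    ultimately show ?thesis using ne[of r c] by (metis fun_upd_other less_irrefl)
  qed auto
next
  note D = tropical_couplingsD[OF w(1)]
  have ne: "w (r, c) \<noteq> 0 \<Longrightarrow> (r, c) \<noteq> (i, j)" for r c using w by auto
  fix c assume c: "c \<in> L'"
  show "\<exists>r. (w((i, j) := a)) (r, c) = v c"
  proof (cases "c = j \<and> a = v j")
    case False
    then obtain r where "w (r, c) = v c" using L[OF c] D(8) by metis
    moreover have "0 < v c \<or> (r,c) \<noteq> (i,j)" using v_pos by auto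
    ultimately show ?thesis using ne[of r c] by (metis fun_upd_other less_irrefl)
  qed auto
qed

text \<open>The converse of filling the corner: chain support and bounds are inherited, and the
  demanded maxima must be attained away from the corner.\<close>

lemma corner_remove:
  assumes w: "w \<in> tropical_couplings K (insert i I) L (insert j J) u v"
    and I': "\<And>r c. w (r, c) \<noteq> 0 \<Longrightarrow> (r, c) \<noteq> (i, j) \<Longrightarrow> r \<in> I' \<and> c \<in> J' \<and> w (r, c) \<le> v' c"
    and K: "\<And>r. r \<in> K' \<Longrightarrow> \<exists>c. w (r, c) = u r \<and> (r, c) \<noteq> (i, j)"
    and L: "\<And>c. c \<in> L' \<Longrightarrow> \<exists>r. w (r, c) = v' c \<and> (r, c) \<noteq> (i, j)"
  shows "w((i, j) := 0) \<in> tropical_couplings K' I' L' J' u v'"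
proof (rule tropical_couplingsI)
  note D = tropical_couplingsD[OF w(1)]
  fix r c
  show "0 \<le> (w((i, j) := 0)) (r, c)" using D(1) by auto
  show "r \<in> I' \<and> c \<in> J' \<and> (w((i, j) := 0)) (r, c) \<le> u r \<and> (w((i, j) := 0)) (r, c) \<le> v' c"
    if "(w((i, j) := 0)) (r, c) \<noteq> 0"
    using that D(4)[of r c] I'[of r c] by (auto split: if_splits)
  show "r \<le> r' \<and> c \<le> c' \<or> r' \<le> r \<and> c' \<le> c"
    if "(w((i, j) := 0)) (r, c) \<noteq> 0" "(w((i, j) := 0)) (r', c') \<noteq> 0" for r' c'
    using that D(6)[of r c r' c'] by (auto split: if_splits)
next
  show "\<exists>c. (w((i, j) := 0)) (r, c) = u r" if "r \<in> K'" for r using K[OF that] by (metis fun_upd_other)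
  show "\<exists>r. (w((i, j) := 0)) (r, c) = v' c" if "c \<in> L'" for c using L[OF that] by (metis fun_upd_other)
qed

abbreviation "I' \<equiv> insert i I"
abbreviation "J' \<equiv> insert j J"

lemma zero_corner:
  assumes "w((i, j) := 0) \<in> tropical_couplings K R L C u' v'" "(r, c) \<noteq> (i, j)"
  shows "w (r, c) \<noteq> 0 \<Longrightarrow> r \<in> R \<and> c \<in> C"
  using assms tropical_couplingsD(2,3)[OF assms(1), of r c] by auto

text \<open>Positivity of \<open>u r\<close> excludes that the maximum is attained by a zero entry
  outside the allowed columns.\<close>

lemma attains_row:
  assumes "w \<in> tropical_couplings K R L C u v" "r \<in> K" "r \<in> I'"
  obtains c where "w (r, c) = u r" "w (r, c) \<noteq> 0" "c \<in> C"
  using tropical_couplingsD(7)[OF assms(1,2)] tropical_couplingsD(3)[OF assms(1)] u_pos[OF assms(3)]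
  by (metis less_irrefl)

lemma attains_column:
  assumes "w \<in> tropical_couplings K R L C u v" "c \<in> L" "c \<in> J'"
  obtains r where "w (r, c) = v c" "w (r, c) \<noteq> 0" "r \<in> R"
  using tropical_couplingsD(8)[OF assms(1,2)] tropical_couplingsD(2)[OF assms(1)] v_pos[OF assms(3)]
  by (metis less_irrefl)

lemma row_concentrated:
  assumes "w \<in> tropical_couplings K I' L J' u v" "i \<in> K" "\<And>c. c \<noteq> j \<Longrightarrow> w (i, c) = 0"
  shows "w (i, j) = u i"
  using attains_row[OF assms(1,2)] assms(3) by (metis insertI1)

lemma column_concentrated:
  assumes "w \<in> tropical_couplings K I' L J' u v" "j \<in> L" "\<And>r. r \<noteq> i \<Longrightarrow> w (r, j) = 0"
  shows "w (i, j) = v j"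
  using attains_column[OF assms(1,2)] assms(3) by (metis insertI1)

text \<open>Row \<open>i\<close> is bounded by \<open>u i\<close>, so the larger value
  \<open>v j\<close> is attained further down column \<open>j\<close>. Then row \<open>i\<close> has
  no entry besides the corner, which must equal \<open>u i\<close>.\<close>

lemma exact_less:
  assumes less: "u i < v j"
  shows "tropical_couplings I' I' J' J' u v = {w. w (i, j) = u i \<and> w((i, j) := 0) \<in> tropical_couplings I I J' J' u v}"
    (is "?E = ?R")
proof
  show "?E \<subseteq> ?R"
  proof
    fix w assume w: "w \<in> ?E"
    obtain r where r: "w (r, j) = v j" "w (r, j) \<noteq> 0" using attains_column[OF w, of j] by auto
    with tropical_couplingsD(4)[OF w r(2)] less have "r \<noteq> i" by auto
    with r row_or_column[OF w] have row: "w (i, c) = 0" if "c \<noteq> j" for c using that by blast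
    have "w((i, j) := 0) \<in> tropical_couplings I I J' J' u v"
    proof (rule corner_remove[OF w])
      fix r c assume "w (r, c) \<noteq> 0" "(r, c) \<noteq> (i, j)"
      then show "r \<in> I \<and> c \<in> J' \<and> w (r, c) \<le> v c"
        using tropical_couplingsD(2,3,5)[OF w, of r c] row by auto
    next
      fix r assume "r \<in> I"
      then show "\<exists>c. w (r, c) = u r \<and> (r, c) \<noteq> (i, j)" using tropical_couplingsD(7)[OF w, of r] i_notin by auto
    next
      fix c assume "c \<in> J'"
      then show "\<exists>r. w (r, c) = v c \<and> (r, c) \<noteq> (i, j)"
        using tropical_couplingsD(8)[OF w, of c] r \<open>r \<noteq> i\<close> j_notin by auto
    qed
    with row_concentrated[OF w] row show "w \<in> ?R" by simp
  qed
  show "?R \<subseteq> ?E"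
  proof clarify
    fix w assume w: "w (i, j) = u i" "w((i, j) := 0) \<in> tropical_couplings I I J' J' u v"
    have "(w((i, j) := 0))((i, j) := u i) \<in> ?E"
      by (rule corner_upd[OF w(2)]) (use u_pos less in \<open>auto simp: less_imp_le\<close>)
    moreover have "(w((i, j) := 0))((i, j) := u i) = w" using w by auto
    ultimately show "w \<in> ?E" by simp
  qed
qed

text \<open>\<open>R\<close> and \<open>C\<close> record whether the support may continue along row
  \<open>i\<close> or down column \<open>j\<close>. A corner equal to \<open>u i\<close> serves row
  \<open>i\<close>; column \<open>j\<close> is either only bounded (\<open>L = J\<close>) or served
  as well by a tie. So neither makes a demand on the rest.\<close>

lemma corner_concentrated:
  assumes le: "u i \<le> v j" and L: "L = J \<or> L = J' \<and> u i = v j"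
    and RC: "I \<subseteq> R" "R \<subseteq> I'" "J \<subseteq> C" "C \<subseteq> J'"
  shows "{w \<in> tropical_couplings I' I' L J' u v. w (i, j) = u i \<and>
      (i \<notin> R \<longrightarrow> (\<forall>c. c \<noteq> j \<longrightarrow> w (i, c) = 0)) \<and> (j \<notin> C \<longrightarrow> (\<forall>r. r \<noteq> i \<longrightarrow> w (r, j) = 0))}
    = {w. w (i, j) = u i \<and> w((i, j) := 0) \<in> tropical_couplings I R J C u v}" (is "?E = ?R")
proof
  show "?E \<subseteq> ?R"
  proof clarify
    fix w assume w: "w \<in> tropical_couplings I' I' L J' u v"
      and row: "i \<notin> R \<longrightarrow> (\<forall>c. c \<noteq> j \<longrightarrow> w (i, c) = 0)" and col: "j \<notin> C \<longrightarrow> (\<forall>r. r \<noteq> i \<longrightarrow> w (r, j) = 0)"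
    show "w((i, j) := 0) \<in> tropical_couplings I R J C u v"
    proof (rule corner_remove[OF w])
      fix r c assume *: "w (r, c) \<noteq> 0" "(r, c) \<noteq> (i, j)"
      have "r \<in> R" using tropical_couplingsD(2)[OF w *(1)] row * RC(1) by auto
      moreover have "c \<in> C" using tropical_couplingsD(3)[OF w *(1)] col * RC(3) by auto
      ultimately show "r \<in> R \<and> c \<in> C \<and> w (r, c) \<le> v c" using tropical_couplingsD(5)[OF w *(1)] by blast
    next
      fix r assume "r \<in> I"
      then show "\<exists>c. w (r, c) = u r \<and> (r, c) \<noteq> (i, j)" using tropical_couplingsD(7)[OF w, of r] i_notin by auto
    next
      fix c assume "c \<in> J"
      then show "\<exists>r. w (r, c) = v c \<and> (r, c) \<noteq> (i, j)" using tropical_couplingsD(8)[OF w, of c] j_notin L by auto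
    qed
  qed
  show "?R \<subseteq> ?E"
  proof clarify
    fix w assume w: "w (i, j) = u i" "w((i, j) := 0) \<in> tropical_couplings I R J C u v"
    have "(w((i, j) := 0))((i, j) := u i) \<in> tropical_couplings I' I' L J' u v"
      by (rule corner_upd[OF w(2) RC(2,4)]) (use u_pos le L in \<open>auto simp: less_imp_le\<close>)
    moreover have "(w((i, j) := 0))((i, j) := u i) = w" using w by auto
    ultimately show "w \<in> tropical_couplings I' I' L J' u v \<and> w (i, j) = u i \<and>
        (i \<notin> R \<longrightarrow> (\<forall>c. c \<noteq> j \<longrightarrow> w (i, c) = 0)) \<and> (j \<notin> C \<longrightarrow> (\<forall>r. r \<noteq> i \<longrightarrow> w (r, j) = 0))"
      using zero_corner[OF w(2), of i] zero_corner[OF w(2), of _ j] w(1) by auto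
  qed
qed

lemma concentrated_row:
  assumes "u i \<le> v j" "L = J \<or> L = J' \<and> u i = v j"
  shows "{w \<in> tropical_couplings I' I' L J' u v. \<forall>c. c \<noteq> j \<longrightarrow> w (i, c) = 0}
    = {w. w (i, j) = u i \<and> w((i, j) := 0) \<in> tropical_couplings I I J J' u v}"
  using corner_concentrated[OF assms, of I J'] row_concentrated[of _ I' L] i_notin by blast

lemma concentrated_column:
  assumes "u i \<le> v j" "L = J \<or> L = J' \<and> u i = v j"
  shows "{w \<in> tropical_couplings I' I' L J' u v. (\<forall>r. r \<noteq> i \<longrightarrow> w (r, j) = 0) \<and> w (i, j) = u i}
    = {w. w (i, j) = u i \<and> w((i, j) := 0) \<in> tropical_couplings I I' J J u v}"
  using corner_concentrated[OF assms, of I' J] j_notin by blast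

lemma concentrated_diagonal:
  assumes "u i \<le> v j" "L = J \<or> L = J' \<and> u i = v j"
  shows "{w \<in> tropical_couplings I' I' L J' u v. (\<forall>r. r \<noteq> i \<longrightarrow> w (r, j) = 0) \<and> (\<forall>c. c \<noteq> j \<longrightarrow> w (i, c) = 0)}
    = {w. w (i, j) = u i \<and> w((i, j) := 0) \<in> tropical_couplings I I J J u v}"
  using corner_concentrated[OF assms, of I J] row_concentrated[of _ I' L] i_notin j_notin by blast

text \<open>A row exceeding all columns of \<open>J\<close> can attain its maximum only in column
  \<open>j\<close>, so the support goes down this column and row \<open>i\<close> is just the
  corner. Without the corner, column \<open>j\<close> has as its maximum the largest remaining row
  value \<open>M\<close>.\<close>

lemma exact_unbalanced:
  assumes eq: "u i = v j" and fin: "finite I" and r0: "r0 \<in> I" "\<And>c. c \<in> J \<Longrightarrow> v c < u r0"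
    and bal: "balanced I' J' u v"
  defines "M \<equiv> Max (u ` I)"
  shows "tropical_couplings I' I' J' J' u v
    = {w. w (i, j) = u i \<and> w((i, j) := 0) \<in> tropical_couplings I I J' J' u (v(j := M))}" (is "?E = ?R")
proof
  have M: "u r \<le> M" if "r \<in> I" for r using that fin by (simp add: M_def)
  obtain rM where rM: "rM \<in> I" "u rM = M"
    using Max_in[of "u ` I"] fin r0(1) unfolding M_def by fastforce
  have big: "v c < M" if "c \<in> J" for c using r0 M that by (meson less_le_trans)
  \<comment> \<open>By balance some column bounds \<open>u rM = M\<close>, and only column
    \<open>j\<close> is left for that.\<close>
  have Mv: "M \<le> v j" using bal rM big unfolding balanced_def by force
  show "?E \<subseteq> ?R"
  proof
    fix w assume w: "w \<in> ?E"
    obtain c where c: "w (rM, c) = M" "w (rM, c) \<noteq> 0" "c \<in> J'"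
      using attains_row[OF w, of rM] rM by auto
    then have "c = j" using tropical_couplingsD(5)[OF w c(2)] big by force
    have "rM \<noteq> i" using rM i_notin by blast
    with c \<open>c = j\<close> row_or_column[OF w] have row: "\<forall>c. c \<noteq> j \<longrightarrow> w (i, c) = 0" by blast
    have "w((i, j) := 0) \<in> tropical_couplings I I J' J' u (v(j := M))"
    proof (rule corner_remove[OF w])
      fix r c assume *: "w (r, c) \<noteq> 0" "(r, c) \<noteq> (i, j)"
      then have "r \<in> I" using tropical_couplingsD(2)[OF w, of r c] row by auto
      then show "r \<in> I \<and> c \<in> J' \<and> w (r, c) \<le> (v(j := M)) c"
        using tropical_couplingsD(2-5)[OF w *(1)] M[of r] by auto
    next
      fix r assume "r \<in> I"
      then show "\<exists>c. w (r, c) = u r \<and> (r, c) \<noteq> (i, j)" using tropical_couplingsD(7)[OF w, of r] i_notin by auto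
    next
      fix c' assume "c' \<in> J'"
      then show "\<exists>r. w (r, c') = (v(j := M)) c' \<and> (r, c') \<noteq> (i, j)"
        using tropical_couplingsD(8)[OF w, of c'] c \<open>c = j\<close> rM i_notin j_notin by auto
    qed
    with row_concentrated[OF w] row show "w \<in> ?R" by simp
  qed
  show "?R \<subseteq> ?E"
  proof clarify
    fix w assume w: "w (i, j) = u i" "w((i, j) := 0) \<in> tropical_couplings I I J' J' u (v(j := M))"
    have "(w((i, j) := 0))((i, j) := u i) \<in> ?E"
      by (rule corner_upd[OF w(2)]) (use u_pos v_pos[of j] eq Mv in \<open>auto simp: less_imp_le\<close>)
    moreover have "(w((i, j) := 0))((i, j) := u i) = w" using w by auto
    ultimately show "w \<in> ?E" by simp
  qed
qed

text \<open>Row \<open>i\<close> is served within \<open>J\<close> and column \<open>j\<close> is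
  only bounded, so no demand falls on the corner entry: it varies in an interval independently of
  the rest.\<close>

lemma relaxed_cylinder:
  "{w \<in> tropical_couplings I' I' J J' u v. (\<forall>r. r \<noteq> i \<longrightarrow> w (r, j) = 0) \<and> (\<exists>c\<in>J. w (i, c) = u i)}
    = {w. 0 \<le> w (i, j) \<and> w (i, j) \<le> min (u i) (v j) \<and> w((i, j) := 0) \<in> tropical_couplings I' I' J J u v}"
  (is "?E = ?R")
proof
  show "?E \<subseteq> ?R"
  proof clarify
    fix w c0 assume w: "w \<in> tropical_couplings I' I' J J' u v" and col: "\<forall>r. r \<noteq> i \<longrightarrow> w (r, j) = 0"
      and c0: "c0 \<in> J" "w (i, c0) = u i"
    have "w((i, j) := 0) \<in> tropical_couplings I' I' J J u v"
    proof (rule corner_remove[OF w])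
      fix r c assume "w (r, c) \<noteq> 0" "(r, c) \<noteq> (i, j)"
      then show "r \<in> I' \<and> c \<in> J \<and> w (r, c) \<le> v c"
        using tropical_couplingsD(2,3,5)[OF w, of r c] col by auto
    next
      fix r assume "r \<in> I'"
      then show "\<exists>c. w (r, c) = u r \<and> (r, c) \<noteq> (i, j)"
        using tropical_couplingsD(7)[OF w, of r] i_notin j_notin c0 by auto
    next
      fix c assume "c \<in> J"
      then show "\<exists>r. w (r, c) = v c \<and> (r, c) \<noteq> (i, j)" using tropical_couplingsD(8)[OF w, of c] j_notin by auto
    qed
    moreover have "w (i, j) \<le> min (u i) (v j)"
      using tropical_couplingsD(4,5)[OF w, of i j] u_pos[of i] v_pos[of j] by fastforce
    ultimately show "0 \<le> w (i, j) \<and> w (i, j) \<le> min (u i) (v j) \<and> w((i, j) := 0) \<in> tropical_couplings I' I' J J u v"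
      using tropical_couplingsD(1)[OF w] by blast
  qed
  show "?R \<subseteq> ?E"
  proof clarify
    fix w assume w: "0 \<le> w (i, j)" "w (i, j) \<le> min (u i) (v j)" "w((i, j) := 0) \<in> tropical_couplings I' I' J J u v"
    have "(w((i, j) := 0))((i, j) := w (i, j)) \<in> tropical_couplings I' I' J J' u v"
      by (rule corner_upd[OF w(3)]) (use w in auto)
    moreover have "(w((i, j) := 0))((i, j) := w (i, j)) = w" by auto
    moreover obtain c where "(w((i, j) := 0)) (i, c) = u i" "c \<in> J"
      using attains_row[OF w(3), of i] by auto
    then have "\<exists>c\<in>J. w (i, c) = u i" using j_notin by (auto intro!: bexI[of _ c] split: if_splits)
    ultimately show "w \<in> tropical_couplings I' I' J J' u v \<and> (\<forall>r. r \<noteq> i \<longrightarrow> w (r, j) = 0) \<and> (\<exists>c\<in>J. w (i, c) = u i)"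
      using zero_corner[OF w(3), of _ j] j_notin by auto
  qed
qed

lemma closed_row: "closed {w :: nat \<times> nat \<Rightarrow> real. \<forall>c. c \<noteq> j \<longrightarrow> w (i, c) = 0}"
  by (intro closed_Collect_all closed_Collect_imp open_Collect_const closed_Collect_eq
      continuous_on_product_coordinates continuous_on_const)

lemma closed_column: "closed {w :: nat \<times> nat \<Rightarrow> real. \<forall>r. r \<noteq> i \<longrightarrow> w (r, j) = 0}"
  by (intro closed_Collect_all closed_Collect_imp open_Collect_const closed_Collect_eq
      continuous_on_product_coordinates continuous_on_const)

text \<open>The support avoids one arm at the corner. If it avoids the column, row \<open>i\<close>
  is served by the corner or by a column of \<open>J\<close>, and the latter part is a cylinder over
  the exact couplings. Unless \<open>u i \<le> v j\<close> and the problem without row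
  \<open>i\<close> is balanced, the cylinder is everything.\<close>

lemma relaxed_absolute_extensor:
  assumes fin: "finite J" and bal: "balanced I' J u v"
    and E: "absolute_extensor TYPE('z::{metric_space,second_countable_topology}) (tropical_couplings I' I' J J u v)"
    and less: "balanced I J u v \<Longrightarrow> absolute_extensor TYPE('z) (tropical_couplings I I' J J u v)"
      "balanced I J u v \<Longrightarrow> absolute_extensor TYPE('z) (tropical_couplings I I J J' u v)"
      "balanced I J u v \<Longrightarrow> absolute_extensor TYPE('z) (tropical_couplings I I J J u v)"
  shows "absolute_extensor TYPE('z) (tropical_couplings I' I' J J' u v)"
proof -
  let ?AE = "absolute_extensor TYPE('z)" and ?G = "tropical_couplings I' I' J J' u v"
  have cyl: "?AE {w \<in> ?G. (\<forall>r. r \<noteq> i \<longrightarrow> w (r, j) = 0) \<and> (\<exists>c\<in>J. w (i, c) = u i)}"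
    unfolding relaxed_cylinder
  proof (rule absolute_extensor_cylinder[OF E])
    show "w (i, j) = 0" if "w \<in> tropical_couplings I' I' J J u v" for w
      using tropical_couplingsD(3)[OF that] j_notin by blast
    show "0 \<le> min (u i) (v j)" using u_pos v_pos by (simp add: less_imp_le)
  qed
  show ?thesis
  proof (cases "u i \<le> v j \<and> balanced I J u v")
    case True
    then have le: "u i \<le> v j" and b: "balanced I J u v" by auto
    show ?thesis
    proof (rule absolute_extensor_closed_cover[OF closed_column closed_row])
      show "?AE {w \<in> ?G. \<forall>r. r \<noteq> i \<longrightarrow> w (r, j) = 0}"
      proof (rule absolute_extensor_closed_cover)
        show "closed {w :: nat \<times> nat \<Rightarrow> real. w (i, j) = u i}"
          by (intro closed_Collect_eq continuous_on_product_coordinates continuous_on_const)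
        have "{w :: nat \<times> nat \<Rightarrow> real. \<exists>c\<in>J. w (i, c) = u i} = (\<Union>c\<in>J. {w. w (i, c) = u i})" by auto
        then show "closed {w :: nat \<times> nat \<Rightarrow> real. \<exists>c\<in>J. w (i, c) = u i}"
          using fin by (auto intro!: closed_Collect_eq continuous_on_product_coordinates continuous_on_const)
        show "w (i, j) = u i \<or> (\<exists>c\<in>J. w (i, c) = u i)" if "w \<in> {w \<in> ?G. \<forall>r. r \<noteq> i \<longrightarrow> w (r, j) = 0}" for w
        proof -
          have "w \<in> ?G" using that by simp
          from attains_row[OF this, of i] show ?thesis by auto
        qed
        have "{w \<in> {w \<in> ?G. \<forall>r. r \<noteq> i \<longrightarrow> w (r, j) = 0}. w (i, j) = u i}
          = {w. w (i, j) = u i \<and> w((i, j) := 0) \<in> tropical_couplings I I' J J u v}"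
          using concentrated_column[OF le disjI1[OF refl]] by auto
        moreover have "?AE \<dots>"
          by (rule absolute_extensor_corner[OF less(1)[OF b]])
            (use tropical_couplingsD(3) j_notin in blast)
        ultimately show "?AE {w \<in> {w \<in> ?G. \<forall>r. r \<noteq> i \<longrightarrow> w (r, j) = 0}. w (i, j) = u i}" by simp
        have "{w \<in> {w \<in> ?G. \<forall>r. r \<noteq> i \<longrightarrow> w (r, j) = 0}. \<exists>c\<in>J. w (i, c) = u i}
          = {w \<in> ?G. (\<forall>r. r \<noteq> i \<longrightarrow> w (r, j) = 0) \<and> (\<exists>c\<in>J. w (i, c) = u i)}" by auto
        with cyl show "?AE {w \<in> {w \<in> ?G. \<forall>r. r \<noteq> i \<longrightarrow> w (r, j) = 0}. \<exists>c\<in>J. w (i, c) = u i}" by simp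
        \<comment> \<open>The intersection is the end of the cylinder at height \<open>u i\<close>,
          which respects the bound because \<open>u i \<le> v j\<close>.\<close>
        have "{w \<in> {w \<in> ?G. \<forall>r. r \<noteq> i \<longrightarrow> w (r, j) = 0}. w (i, j) = u i \<and> (\<exists>c\<in>J. w (i, c) = u i)}
          = {w \<in> {w \<in> ?G. (\<forall>r. r \<noteq> i \<longrightarrow> w (r, j) = 0) \<and> (\<exists>c\<in>J. w (i, c) = u i)}. w (i, j) = u i}" by auto
        also have "\<dots> = {w. w (i, j) = u i \<and> w((i, j) := 0) \<in> tropical_couplings I' I' J J u v}"
          unfolding relaxed_cylinder using le u_pos[of i] by auto
        finally show "?AE {w \<in> {w \<in> ?G. \<forall>r. r \<noteq> i \<longrightarrow> w (r, j) = 0}. w (i, j) = u i \<and> (\<exists>c\<in>J. w (i, c) = u i)}"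
          using absolute_extensor_corner[OF E, of "(i, j)" "u i"] tropical_couplingsD(3) j_notin
          by (metis (no_types, lifting))
      qed
      show "?AE {w \<in> ?G. \<forall>c. c \<noteq> j \<longrightarrow> w (i, c) = 0}"
        unfolding concentrated_row[OF le disjI1[OF refl]]
        by (rule absolute_extensor_corner[OF less(2)[OF b]])
            (use tropical_couplingsD(2) i_notin in blast)
      show "?AE {w \<in> ?G. (\<forall>r. r \<noteq> i \<longrightarrow> w (r, j) = 0) \<and> (\<forall>c. c \<noteq> j \<longrightarrow> w (i, c) = 0)}"
        unfolding concentrated_diagonal[OF le disjI1[OF refl]]
        by (rule absolute_extensor_corner[OF less(3)[OF b]])
            (use tropical_couplingsD(2) i_notin in blast)
    qed (use row_or_column in blast)
  next
    case False
    \<comment> \<open>If \<open>u i > v j\<close>, the corner is too small for the maximum of row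
      \<open>i\<close>. If \<open>I\<close> and \<open>J\<close> are unbalanced, some column of
      \<open>J\<close> exceeds all rows of \<open>I\<close>; a column \<open>c1\<close> of
      \<open>J\<close> with \<open>u i \<le> v c1\<close> can then be served by row \<open>i\<close>
      only, and with value \<open>u i\<close>.\<close>
    have "(\<forall>r. r \<noteq> i \<longrightarrow> w (r, j) = 0) \<and> (\<exists>c\<in>J. w (i, c) = u i)" if w: "w \<in> ?G" for w
    proof -
      have "\<exists>c\<in>J. w (i, c) = u i"
      proof (cases "u i \<le> v j")
        case False
        obtain c where "w (i, c) = u i" "w (i, c) \<noteq> 0" "c \<in> J'" using attains_row[OF w, of i] by auto
        with tropical_couplingsD(5)[OF w, of i c] False show ?thesis by auto
      next
        case True
        with \<open>\<not> (u i \<le> v j \<and> balanced I J u v)\<close> have "\<not> balanced I J u v" by simp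
        then obtain c0 where c0: "c0 \<in> J" "\<And>r. r \<in> I \<Longrightarrow> u r < v c0"
          using bal unfolding balanced_def by (metis insertI2 not_le)
        obtain r0 where "r0 \<in> I'" "v c0 \<le> u r0" using bal c0 unfolding balanced_def by blast
        then have ui: "v c0 \<le> u i" using c0(2)[of r0] by auto
        obtain c1 where c1: "c1 \<in> J" "u i \<le> v c1" using bal unfolding balanced_def by blast
        obtain r1 where r1: "w (r1, c1) = v c1" "w (r1, c1) \<noteq> 0" "r1 \<in> I'"
          using attains_column[OF w c1(1)] c1 by auto
        then have "v c1 \<le> u r1" using tropical_couplingsD(4)[OF w r1(2)] by simp
        then have "r1 = i" using c0(2)[of r1] r1(3) c1 ui by force
        with \<open>v c1 \<le> u r1\<close> r1 c1 show ?thesis by force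
      qed
      then obtain c where "c \<in> J" "w (i, c) = u i" by blast
      with u_pos[of i] j_notin row_or_column[OF w] show ?thesis by force
    qed
    then have "{w \<in> ?G. (\<forall>r. r \<noteq> i \<longrightarrow> w (r, j) = 0) \<and> (\<exists>c\<in>J. w (i, c) = u i)} = ?G" by blast
    with cyl show ?thesis by simp
  qed
qed

lemma exact_absolute_extensor_less:
  assumes "u i < v j" and "absolute_extensor TYPE('z::{metric_space,second_countable_topology}) (tropical_couplings I I J' J' u v)"
  shows "absolute_extensor TYPE('z) (tropical_couplings I' I' J' J' u v)"
  unfolding exact_less[OF assms(1)]
  by (rule absolute_extensor_corner[OF assms(2)]) (use tropical_couplingsD(2) i_notin in blast)

text \<open>In either branch of a tie the corner serves its row and its column at once, so the
  surviving arm is only bounded. This is where couplings with a bounded row or column come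
  from.\<close>

lemma exact_absolute_extensor_eq:
  assumes eq: "u i = v j" 
    and "absolute_extensor TYPE('z::{metric_space,second_countable_topology}) (tropical_couplings I I J J' u v)"
      "absolute_extensor TYPE('z) (tropical_couplings I I' J J u v)"
      "absolute_extensor TYPE('z) (tropical_couplings I I J J u v)"
  shows "absolute_extensor TYPE('z) (tropical_couplings I' I' J' J' u v)"
proof (rule absolute_extensor_closed_cover[OF closed_column closed_row])
  let ?AE = "absolute_extensor TYPE('z)" and ?E = "tropical_couplings I' I' J' J' u v"
  note conc = eq_refl[OF eq] disjI2[OF conjI[OF refl eq]]
  have "{w \<in> ?E. \<forall>r. r \<noteq> i \<longrightarrow> w (r, j) = 0} = {w \<in> ?E. (\<forall>r. r \<noteq> i \<longrightarrow> w (r, j) = 0) \<and> w (i, j) = u i}"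
    using column_concentrated[of _ I' J'] eq by force
  moreover have "?AE \<dots>"
    unfolding concentrated_column[OF conc]
    by (rule absolute_extensor_corner[OF assms(3)]) (use tropical_couplingsD(3) j_notin in blast)
  ultimately show "?AE {w \<in> ?E. \<forall>r. r \<noteq> i \<longrightarrow> w (r, j) = 0}" by simp
  show "?AE {w \<in> ?E. \<forall>c. c \<noteq> j \<longrightarrow> w (i, c) = 0}"
    unfolding concentrated_row[OF conc]
    by (rule absolute_extensor_corner[OF assms(2)]) (use tropical_couplingsD(2) i_notin in blast)
  show "?AE {w \<in> ?E. (\<forall>r. r \<noteq> i \<longrightarrow> w (r, j) = 0) \<and> (\<forall>c. c \<noteq> j \<longrightarrow> w (i, c) = 0)}"
    unfolding concentrated_diagonal[OF conc]
    by (rule absolute_extensor_corner[OF assms(4)]) (use tropical_couplingsD(2) i_notin in blast)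
qed (use row_or_column in blast)

lemma exact_absolute_extensor_unbalanced:
  assumes "u i = v j" "finite I" "r0 \<in> I" "\<And>c. c \<in> J \<Longrightarrow> v c < u r0" "balanced I' J' u v"
    and "absolute_extensor TYPE('z::{metric_space,second_countable_topology})
      (tropical_couplings I I J' J' u (v(j := Max (u ` I))))"
  shows "absolute_extensor TYPE('z) (tropical_couplings I' I' J' J' u v)"
proof -
  have "absolute_extensor TYPE('z) {w. w (i, j) = u i \<and>
      w((i, j) := 0) \<in> tropical_couplings I I J' J' u (v(j := Max (u ` I)))}"
    by (rule absolute_extensor_corner[OF assms(6)]) (use tropical_couplingsD(2) i_notin in blast)
  moreover have "tropical_couplings I' I' J' J' u v = {w. w (i, j) = u i \<and>
      w((i, j) := 0) \<in> tropical_couplings I I J' J' u (v(j := Max (u ` I)))}"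
    by (rule exact_unbalanced) (use assms in auto)
  ultimately show ?thesis by simp
qed

end

section \<open>The induction on rows and columns\<close>

lemma balanced_swap: "balanced J I v u \<longleftrightarrow> balanced I J u v"
  by (auto simp: balanced_def)

lemma coupling_corner_Min:
  assumes "finite I" "finite J" "I \<noteq> {}" "J \<noteq> {}"
    "\<And>r. r \<in> I \<Longrightarrow> 0 < u r" "\<And>c. c \<in> J \<Longrightarrow> 0 < v c"
  shows "coupling_corner (I - {Min I}) (J - {Min J}) u v (Min I) (Min J)"
proof unfold_locales
  show "Min I < r" if "r \<in> I - {Min I}" for r using that assms(1) by (simp add: less_le)
  show "Min J < c" if "c \<in> J - {Min J}" for c using that assms(2) by (simp add: less_le)
  show "0 < u r" if "r \<in> insert (Min I) (I - {Min I})" for r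
    using that assms(5)[of r] Min_in[OF assms(1,3)] by auto
  show "0 < v c" if "c \<in> insert (Min J) (J - {Min J})" for c
    using that assms(6)[of c] Min_in[OF assms(2,4)] by auto
qed auto

text \<open>Induction on the total number of rows and columns, simultaneously for the exact couplings and for
  those in which an additional first column is only bounded. Transposition covers a bounded first row.\<close>

lemma absolute_extensor_tropical_couplings_aux:
  fixes u v :: "nat \<Rightarrow> real"
  assumes "finite I" "finite J" "\<And>r. r \<in> I \<Longrightarrow> 0 < u r" "\<And>c. c \<in> J \<Longrightarrow> 0 < v c" "balanced I J u v"
  shows "absolute_extensor TYPE('z::{metric_space,second_countable_topology}) (tropical_couplings I I J J u v) \<and>
    (\<forall>j. (\<forall>c\<in>J. j < c) \<longrightarrow> 0 < v j \<longrightarrow>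
      absolute_extensor TYPE('z) (tropical_couplings I I J (insert j J) u v))"
  using assms
proof (induction "card I + card J" arbitrary: I J u v rule: less_induct)
  case less
  let ?AE = "absolute_extensor TYPE('z)"
  have exact_smaller: "?AE (tropical_couplings K K L L u' v')"
    if "card K + card L < card I + card J" "finite K" "finite L" 
      "\<And>r. r \<in> K \<Longrightarrow> 0 < u' r" "\<And>c. c \<in> L \<Longrightarrow> 0 < v' c" "balanced K L u' v'" for K L u' v'
    using less.hyps[OF that] by blast
  have column_smaller: "?AE (tropical_couplings K K L (insert j L) u' v')"
    if "card K + card L < card I + card J" "finite K" "finite L" 
      "\<And>r. r \<in> K \<Longrightarrow> 0 < u' r" "\<And>c. c \<in> insert j L \<Longrightarrow> 0 < v' c" "balanced K L u' v'" 
      "\<And>c. c \<in> L \<Longrightarrow> j < c" for K L u' v' j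
    using less.hyps[of K L u' v'] that by blast
  have row_smaller: "?AE (tropical_couplings K (insert i K) L L u' v')"
    if "card K + card L < card I + card J" "finite K" "finite L" 
      "\<And>r. r \<in> insert i K \<Longrightarrow> 0 < u' r" "\<And>c. c \<in> L \<Longrightarrow> 0 < v' c" "balanced K L u' v'" 
      "\<And>c. c \<in> K \<Longrightarrow> i < c" for K L u' v' i
    by (rule absolute_extensor_tropical_couplings_swap, rule column_smaller)
      (use that in \<open>auto simp: balanced_swap add.commute\<close>)
  show ?case
  proof (cases "I = {} \<or> J = {}")
    case True
    then have "I = {}" "J = {}" using less.prems(5) by (auto simp: balanced_def)
    then show ?thesis by (simp add: tropical_couplings_empty absolute_extensor_singleton)
  next
    case False
    define i j I1 J1 where defs: "i = Min I" "j = Min J" "I1 = I - {Min I}" "J1 = J - {Min J}"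
    have Min_mem: "Min I \<in> I" "Min J \<in> J" using False less.prems(1,2) by (simp_all add: Min_in)
    have I: "insert i I1 = I" and J: "insert j J1 = J"
      using insert_Diff[OF Min_mem(1)] insert_Diff[OF Min_mem(2)] by (simp_all add: defs)
    have cards: "card I1 < card I" "card J1 < card J"
      using False less.prems(1,2) Min_mem by (auto simp: defs card_gt_0_iff)
    interpret coupling_corner I1 J1 u v i j
      unfolding defs by (rule coupling_corner_Min) (use less.prems False in auto)
    interpret swap: coupling_corner J1 I1 v u j i
      unfolding defs by (rule coupling_corner_Min) (use less.prems False in auto)
    have fin: "finite I1" "finite J1" using less.prems by (auto simp: defs)
    have bal: "balanced (insert i I1) (insert j J1) u v" "balanced (insert j J1) (insert i I1) v u"
      using less.prems(5) by (simp_all add: I J balanced_swap)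
    have E: "?AE (tropical_couplings (insert i I1) (insert i I1) (insert j J1) (insert j J1) u v)"
    proof -
      \<comment> \<open>A tie leaves an unbalanced rest in exactly two ways: some remaining row
        exceeds every remaining column, or some column every row.\<close>
      consider "u i < v j" | "v j < u i" | "u i = v j" "balanced I1 J1 u v"
        | r where "u i = v j" "r \<in> I1" "\<And>c. c \<in> J1 \<Longrightarrow> v c < u r"
        | c where "u i = v j" "c \<in> J1" "\<And>r. r \<in> I1 \<Longrightarrow> u r < v c"
        unfolding balanced_def by (metis not_le linorder_cases)
      then show ?thesis
      proof cases
        case 1
        \<comment> \<open>A column bounded only by row \<open>i\<close> lies below
          \<open>v j\<close>, and \<open>v j\<close> itself is bounded by a row other than
          \<open>i\<close>.\<close>
        have "balanced I1 (insert j J1) u v"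
          using bal 1 unfolding balanced_def by (metis insert_iff less_le_not_le order_trans)
        with 1 show ?thesis
          by (intro exact_absolute_extensor_less exact_smaller)
            (use cards fin u_pos v_pos J in auto)
      next
        case 2
        have "balanced J1' (insert i I1) v u" if "J1' = J1" for J1'
          using bal 2 that unfolding balanced_def by (metis insert_iff less_le_not_le order_trans)
        with 2 show ?thesis
          by (intro absolute_extensor_tropical_couplings_swap[OF swap.exact_absolute_extensor_less] exact_smaller)
            (use cards fin u_pos v_pos I in auto)
      next
        case 3
        then show ?thesis
          by (intro exact_absolute_extensor_eq exact_smaller column_smaller row_smaller)
            (use cards fin u_pos v_pos i_less j_less in auto)
      next
        case (4 r0)
        let ?M = "Max (u ` I1)"
        have M: "u r \<le> ?M" if "r \<in> I1" for r using that fin by simp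
        have "?M \<in> u ` I1" using 4 fin by (intro Max_in) auto
        then have "balanced I1 (insert j J1) u (v(j := ?M))"
          using M 4 unfolding balanced_def by (auto simp: less_imp_le intro: bexI[of _ r0])
        moreover have "0 < ?M" using M[OF 4(2)] u_pos[of r0] 4(2) by auto
        ultimately show ?thesis
          by (intro exact_absolute_extensor_unbalanced[OF 4(1) fin(1) 4(2,3) bal(1)] exact_smaller)
            (use cards fin u_pos v_pos J in auto)
      next
        case (5 c0)
        let ?M = "Max (v ` J1)"
        have M: "v c \<le> ?M" if "c \<in> J1" for c using that fin by simp
        have "?M \<in> v ` J1" using 5 fin by (intro Max_in) auto
        then have "balanced J1 (insert i I1) v (u(i := ?M))"
          using M 5 unfolding balanced_def by (auto simp: less_imp_le intro: bexI[of _ c0])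
        moreover have "0 < ?M" using M[OF 5(2)] v_pos[of c0] 5(2) by auto
        ultimately show ?thesis
          by (intro absolute_extensor_tropical_couplings_swap
              [OF swap.exact_absolute_extensor_unbalanced[OF 5(1)[symmetric] fin(2) 5(2,3) bal(2)]] exact_smaller)
            (use cards fin u_pos v_pos I in auto)
      qed
    qed
    then have E': "?AE (tropical_couplings I I J J u v)" by (simp add: I J)
    moreover have "?AE (tropical_couplings I I J (insert j' J) u v)" if j': "\<And>c. c \<in> J \<Longrightarrow> j' < c" "0 < v j'" for j'
    proof -
      interpret G: coupling_corner I1 J u v i j'
        using i_notin i_less j' less.prems(3,4) by unfold_locales (auto simp: I)
      \<comment> \<open>The exact couplings of the present size, already settled, are the base of
        the cylinder. In the other pieces the first row is gone, which lowers the size, as the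
        bounded column \<open>j'\<close> does not count.\<close>
      have "?AE (tropical_couplings (insert i I1) (insert i I1) J (insert j' J) u v)"
      proof (rule G.relaxed_absolute_extensor)
        show "finite J" "balanced (insert i I1) J u v"
          "?AE (tropical_couplings (insert i I1) (insert i I1) J J u v)"
          using less.prems(2,5) E' by (simp_all add: I)
        have c: "card I1 + card J < card I + card J" using cards by simp
        have u: "\<And>r. r \<in> I1 \<Longrightarrow> 0 < u r" using u_pos by simp
        assume b: "balanced I1 J u v"
        show "?AE (tropical_couplings I1 (insert i I1) J J u v)"
          by (rule row_smaller[OF c fin(1) less.prems(2) u_pos less.prems(4) b i_less])
        show "?AE (tropical_couplings I1 I1 J (insert j' J) u v)"
          by (rule column_smaller[OF c fin(1) less.prems(2) u _ b j'(1)])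
            (use less.prems(4) j'(2) in auto)
        show "?AE (tropical_couplings I1 I1 J J u v)"
          by (rule exact_smaller[OF c fin(1) less.prems(2) u less.prems(4) b])
      qed
      then show ?thesis by (simp add: I)
    qed
    ultimately show ?thesis by blast
  qed
qed

lemma contractible_tropical_couplings:
  assumes "finite I" "finite J" "\<And>r. r \<in> I \<Longrightarrow> 0 < u r" "\<And>c. c \<in> J \<Longrightarrow> 0 < v c" "balanced I J u v"
  shows "contractible (tropical_couplings I I J J u v)" and "tropical_couplings I I J J u v \<noteq> {}"
proof -
  have "absolute_extensor TYPE(real \<times> (nat \<times> nat \<Rightarrow> real)) (tropical_couplings I I J J u v)"
    using absolute_extensor_tropical_couplings_aux[OF assms] by blast
  then show "contractible (tropical_couplings I I J J u v)" "tropical_couplings I I J J u v \<noteq> {}"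
    by (rule absolute_extensor_contractible, rule absolute_extensor_nonempty)
qed

section \<open>The Eilenberg-Zilber lemma\<close>

lemma action_simplices:
  "is_sset X \<Longrightarrow> \<alpha> \<in> operators m n \<Longrightarrow> x \<in> simplices X n \<Longrightarrow> action X m n \<alpha> x \<in> simplices X m"
  by (simp add: is_sset_def)

lemma action_compose:
  "is_sset X \<Longrightarrow> \<alpha> \<in> operators l m \<Longrightarrow> \<beta> \<in> operators m n \<Longrightarrow> x \<in> simplices X n \<Longrightarrow>
    action X l m \<alpha> (action X m n \<beta> x) = action X l n (compose {..l} \<beta> \<alpha>) x"
  by (simp add: is_sset_def)

lemma action_id: "is_sset X \<Longrightarrow> x \<in> simplices X n \<Longrightarrow> action X n n (\<lambda>i\<in>{..n}. i) x = x"
  by (simp add: is_sset_def)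

lemma operatorsI:
  assumes "\<And>i. i \<le> m \<Longrightarrow> \<alpha> i \<le> n" "\<And>i j. i \<le> j \<Longrightarrow> j \<le> m \<Longrightarrow> \<alpha> i \<le> \<alpha> j"
  shows "restrict \<alpha> {..m} \<in> operators m n"
  using assms by (auto simp: operators_def mono_on_def)

lemma operators_ext:
  assumes "\<alpha> \<in> operators m n" "\<beta> \<in> operators m n'" "\<And>i. i \<le> m \<Longrightarrow> \<alpha> i = \<beta> i"
  shows "\<alpha> = \<beta>"
proof
  fix i
  have undef: "\<gamma> i = undefined" if "\<gamma> \<in> operators m k" "\<not> i \<le> m" for \<gamma> k
    using that(1) PiE_arb[of \<gamma> "{..m}" "\<lambda>_. {..k}" i] that(2) by (simp add: operators_def)
  show "\<alpha> i = \<beta> i"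
    by (cases "i \<le> m") (simp_all add: assms(3) undef[OF assms(1)] undef[OF assms(2)])
qed

text \<open>An elementary degeneracy followed by a face, hence an endomorphism of [n]: degeneracy
  can be tested by invariance, without a change of dimension.\<close>

definition glue :: "nat \<Rightarrow> nat \<Rightarrow> nat \<Rightarrow> nat" where
  "glue n i = (\<lambda>l\<in>{..n}. if l = Suc i then i else l)"

lemma glue_operators: "glue n i \<in> operators n n"
  unfolding glue_def by (rule operatorsI) auto

text \<open>\<open>glue n i\<close> factors through a surjection onto [n-1], so invariance under it
  displays \<open>x\<close> as a degeneracy.\<close>

lemma degenerate_glue:
  assumes X: "is_sset X" and x: "x \<in> simplices X n" "i < n" "action X n n (glue n i) x = x"
  shows "degenerate X n x"
proof -
  define s where "s = (\<lambda>l\<in>{..n}. if l \<le> i then l else l - 1)"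
  define d where "d = (\<lambda>l\<in>{..n - 1}. if l \<le> i then l else Suc l)"
  have s: "s \<in> operators n (n - 1)" unfolding s_def using x(2) by (intro operatorsI) auto
  have d: "d \<in> operators (n - 1) n" unfolding d_def using x(2) by (intro operatorsI) auto
  have "compose {..n} d s = glue n i"
    using x(2) by (auto simp: compose_def d_def s_def glue_def fun_eq_iff)
  then have "x = action X n (n - 1) s (action X (n - 1) n d x)"
    using action_compose[OF X s d x(1)] x(3) by simp
  moreover have "s ` {..n} = {..n - 1}"
  proof
    show "{..n - 1} \<subseteq> s ` {..n}"
    proof
      fix l assume "l \<in> {..n - 1}"
      then have "l = s (if l \<le> i then l else Suc l)" "(if l \<le> i then l else Suc l) \<le> n"
        using x(2) by (auto simp: s_def)
      then show "l \<in> s ` {..n}" by blast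
    qed
  qed (use operators_app[OF s] in auto)
  ultimately show ?thesis
    unfolding degenerate_def using s x(2) action_simplices[OF X d x(1)]
    by (intro exI[of _ "n - 1"] exI[of _ s]) auto
qed

lemma operators_not_inj:
  assumes "\<alpha> \<in> operators m n" "\<not> inj_on \<alpha> {..m}"
  obtains i where "i < m" "\<alpha> i = \<alpha> (Suc i)"
proof -
  obtain a b where ab: "a < b" "b \<le> m" "\<alpha> a = \<alpha> b"
    using assms(2) unfolding inj_on_def by (metis atMost_iff linorder_neqE_nat)
  then have "\<alpha> a \<le> \<alpha> (Suc a)" "\<alpha> (Suc a) \<le> \<alpha> b"
    using operators_mono[OF assms(1), of a "Suc a"] operators_mono[OF assms(1), of "Suc a" b] by auto
  with ab that[of a] show ?thesis by auto
qed

lemma action_glue: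
  assumes X: "is_sset X" and a: "\<alpha> \<in> operators n m" "y \<in> simplices X m" "\<alpha> i = \<alpha> (Suc i)"
  shows "action X n n (glue n i) (action X n m \<alpha> y) = action X n m \<alpha> y"
proof -
  have "compose {..n} \<alpha> (glue n i) = \<alpha>"
    by (rule operators_ext[OF operators_compose[OF glue_operators a(1)] a(1)])
      (auto simp: compose_def glue_def a(3))
  then show ?thesis using action_compose[OF X glue_operators a(1,2)] by simp
qed

text \<open>A non-injective operator repeats a value at neighbours and is unchanged by
  precomposition with the corresponding \<open>glue\<close>, so it produces degenerate
  simplices.\<close>

lemma nondegenerate_inj:
  assumes X: "is_sset X" and x: "\<not> degenerate X m (action X m n \<gamma> y)"
    and g: "\<gamma> \<in> operators m n" "y \<in> simplices X n"
  shows "inj_on \<gamma> {..m}"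
  using operators_not_inj[OF g(1)] action_glue[OF X g]
    degenerate_glue[OF X action_simplices[OF X g]] x by metis

lemma operators_inj_add:
  assumes "\<gamma> \<in> operators m n" "inj_on \<gamma> {..m}" "i + d \<le> m"
  shows "\<gamma> i + d \<le> \<gamma> (i + d)"
  using assms(3)
proof (induction d)
  case (Suc d)
  have "\<gamma> (i + d) \<le> \<gamma> (Suc (i + d))" using operators_mono[OF assms(1)] Suc.prems by simp
  moreover have "\<gamma> (i + d) \<noteq> \<gamma> (Suc (i + d))" using inj_onD[OF assms(2), of "i + d" "Suc (i + d)"] Suc.prems by auto
  ultimately show ?case using Suc by auto
qed simp

lemma operators_inj_le:
  assumes "\<gamma> \<in> operators m n" "inj_on \<gamma> {..m}" shows "m \<le> n"
  using operators_inj_add[OF assms, of 0 m] operators_app[OF assms(1), of m] by simp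

lemma operators_inj_endo:
  assumes "\<gamma> \<in> operators m m" "inj_on \<gamma> {..m}" "i \<le> m" shows "\<gamma> i = i"
  using operators_inj_add[OF assms(1,2), of 0 i] operators_inj_add[OF assms(1,2), of i "m - i"]
    operators_app[OF assms(1), of m] assms(3) by simp

lemma Eilenberg_Zilber_exists:
  assumes X: "is_sset X" and x: "x \<in> simplices X n"
  obtains m \<sigma> y where "\<sigma> \<in> operators n m" "\<sigma> ` {..n} = {..m}" "y \<in> simplices X m" "\<not> degenerate X m y"
    "x = action X n m \<sigma> y"
  using x
proof (induction n arbitrary: x thesis rule: less_induct)
  case (less n)
  show ?case
  proof (cases "degenerate X n x")
    case True
    then obtain m \<sigma> y where s: "m < n" "\<sigma> \<in> operators n m" "\<sigma> ` {..n} = {..m}" "y \<in> simplices X m"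
      "x = action X n m \<sigma> y" unfolding degenerate_def by blast
    obtain k \<tau> z where t: "\<tau> \<in> operators m k" "\<tau> ` {..m} = {..k}" "z \<in> simplices X k"
      "\<not> degenerate X k z" "y = action X m k \<tau> z" using less.IH[OF s(1) _ s(4)] by blast
    have "(compose {..n} \<tau> \<sigma>) ` {..n} = {..k}"
      using s(3) t(2) by (simp add: compose_def image_image[symmetric] cong: image_cong_simp)
    moreover have "x = action X n k (compose {..n} \<tau> \<sigma>) z"
      using action_compose[OF X s(2) t(1,3)] s(5) t(5) by simp
    ultimately show ?thesis using less.prems(1) operators_compose[OF s(2) t(1)] t(3,4) by blast
  next
    case False
    have "(\<lambda>i\<in>{..n}. i) ` {..n} = {..n}" by auto
    from less.prems(1)[OF operators_id this less.prems(2) False action_id[OF X less.prems(2), symmetric]]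
    show ?thesis .
  qed
qed

text \<open>Any choice of preimages under a monotone surjection is order-preserving, so the section
  can be routed through a given \<open>l\<close>. This freedom later tells surjections apart
  pointwise.\<close>

lemma operators_section:
  assumes s: "\<sigma> \<in> operators k m" "\<sigma> ` {..k} = {..m}" and l: "l \<le> k"
  obtains \<iota> where "\<iota> \<in> operators m k" "compose {..m} \<sigma> \<iota> = (\<lambda>i\<in>{..m}. i)" "\<iota> (\<sigma> l) = l"
proof -
  have "\<forall>j\<in>{..m}. \<exists>i. i \<le> k \<and> \<sigma> i = j" using s(2) by (metis atMost_iff imageE)
  then obtain h where h: "\<And>j. j \<le> m \<Longrightarrow> h j \<le> k \<and> \<sigma> (h j) = j" by (metis atMost_iff)
  define h' where "h' j = (if j = \<sigma> l then l else h j)" for j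
  have h': "h' j \<le> k \<and> \<sigma> (h' j) = j" if "j \<le> m" for j using h[OF that] l by (auto simp: h'_def)
  show thesis
  proof (rule that[of "restrict h' {..m}"])
    show "restrict h' {..m} \<in> operators m k"
    proof (rule operatorsI)
      fix i j assume ij: "i \<le> j" "j \<le> m"
      show "h' i \<le> h' j"
      proof (rule ccontr)
        assume "\<not> ?thesis"
        then have "\<sigma> (h' j) \<le> \<sigma> (h' i)" using operators_mono[OF s(1), of "h' j" "h' i"] h' ij by simp
        then have "i = j" using h' ij by simp
        with \<open>\<not> ?thesis\<close> show False by simp
      qed
    qed (use h' in auto)
    show "compose {..m} \<sigma> (restrict h' {..m}) = (\<lambda>i\<in>{..m}. i)"
      using h' by (auto simp: compose_def fun_eq_iff)
    show "restrict h' {..m} (\<sigma> l) = l" using operators_app[OF s(1) l] by (simp add: h'_def)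
  qed
qed

text \<open>For a section \<iota> of \<sigma>, \<open>x\<close> arises from \<open>y\<close> by the
  operator \<tau>\<iota>, which is injective because \<open>x\<close> is nondegenerate. By symmetry
  the dimensions agree, so \<tau>\<iota> is the identity for every section, and sections through
  each \<open>l\<close> give \<sigma> = \<tau>.\<close>

lemma Eilenberg_Zilber_unique:
  assumes X: "is_sset X"
    and s: "\<sigma> \<in> operators k m" "\<sigma> ` {..k} = {..m}" "x \<in> simplices X m" "\<not> degenerate X m x"
    and t: "\<tau> \<in> operators k n" "\<tau> ` {..k} = {..n}" "y \<in> simplices X n" "\<not> degenerate X n y"
    and eq: "action X k m \<sigma> x = action X k n \<tau> y"
  shows "m = n" "x = y" "\<sigma> = \<tau>"
proof -
  have one: "inj_on (compose {..m} \<tau> \<iota>) {..m} \<and> x = action X m n (compose {..m} \<tau> \<iota>) y"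
    if s: "\<sigma> \<in> operators k m" "x \<in> simplices X m" "\<not> degenerate X m x"
    and t: "\<tau> \<in> operators k n" "y \<in> simplices X n"
    and eq: "action X k m \<sigma> x = action X k n \<tau> y"
    and i: "\<iota> \<in> operators m k" "compose {..m} \<sigma> \<iota> = (\<lambda>i\<in>{..m}. i)" for \<sigma> m x \<tau> n y \<iota>
  proof -
    have "x = action X m k \<iota> (action X k m \<sigma> x)"
      using action_compose[OF X i(1) s(1,2)] i(2) action_id[OF X s(2)] by simp
    also have "\<dots> = action X m n (compose {..m} \<tau> \<iota>) y"
      unfolding eq by (rule action_compose[OF X i(1) t])
    finally have x: "x = action X m n (compose {..m} \<tau> \<iota>) y" .
    with s(3) have "inj_on (compose {..m} \<tau> \<iota>) {..m}"
      using nondegenerate_inj[OF X _ operators_compose[OF i(1) t(1)] t(2)] by simp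
    with x show ?thesis by simp
  qed
  obtain \<iota> where i: "\<iota> \<in> operators m k" "compose {..m} \<sigma> \<iota> = (\<lambda>i\<in>{..m}. i)"
    using operators_section[OF s(1,2), of 0] by auto
  obtain \<iota>' where i': "\<iota>' \<in> operators n k" "compose {..n} \<tau> \<iota>' = (\<lambda>i\<in>{..n}. i)"
    using operators_section[OF t(1,2), of 0] by auto
  have "m \<le> n"
    using one[OF s(1,3,4) t(1,3) eq i] operators_inj_le[OF operators_compose[OF i(1) t(1)]] by blast
  moreover have "n \<le> m"
    using one[OF t(1,3,4) s(1,3) eq[symmetric] i'] operators_inj_le[OF operators_compose[OF i'(1) s(1)]] by blast
  ultimately show mn: "m = n" by simp
  have id: "compose {..m} \<tau> \<iota> j = j"
    if "\<iota> \<in> operators m k" "compose {..m} \<sigma> \<iota> = (\<lambda>i\<in>{..m}. i)" "j \<le> m" for \<iota> j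
    using one[OF s(1,3,4) t(1,3) eq that(1,2)] that(3) operators_inj_endo
      operators_compose[OF that(1) t(1)] mn by blast
  have "compose {..m} \<tau> \<iota> = (\<lambda>i\<in>{..m}. i)"
    using id[OF i] by (auto simp: fun_eq_iff compose_def)
  then show "x = y" using one[OF s(1,3,4) t(1,3) eq i] action_id[OF X t(3)] mn by simp
  show "\<sigma> = \<tau>"
  proof (rule operators_ext[OF s(1) t(1)])
    fix l assume l: "l \<le> k"
    obtain \<iota> where i: "\<iota> \<in> operators m k" "compose {..m} \<sigma> \<iota> = (\<lambda>i\<in>{..m}. i)" "\<iota> (\<sigma> l) = l"
      using operators_section[OF s(1,2) l] by auto
    from id[OF i(1,2), of "\<sigma> l"] i(3) operators_app[OF s(1) l] show "\<sigma> l = \<tau> l"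
      by (simp add: compose_def)
  qed
qed

text \<open>An order-preserving idempotent of [n] with image \<open>A\<close>: passing to the face
  spanned by \<open>A\<close> becomes the action of an endomorphism of [n].\<close>

definition retract_onto :: "nat \<Rightarrow> nat set \<Rightarrow> nat \<Rightarrow> nat" where
  "retract_onto n A = (\<lambda>i\<in>{..n}. if \<exists>a\<in>A. a \<le> i then Max {a \<in> A. a \<le> i} else Min A)"

lemma retract_onto:
  assumes A: "A \<subseteq> {..n}" "A \<noteq> {}"
  shows "retract_onto n A \<in> operators n n" "\<And>i. i \<le> n \<Longrightarrow> retract_onto n A i \<in> A"
    "\<And>a. a \<in> A \<Longrightarrow> retract_onto n A a = a"
proof -
  have fin: "finite A" using A finite_subset by blast
  have mem: "retract_onto n A i \<in> A" if "i \<le> n" for i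
  proof (cases "\<exists>a\<in>A. a \<le> i")
    case True
    then have "Max {a \<in> A. a \<le> i} \<in> {a \<in> A. a \<le> i}" using fin by (intro Max_in) auto
    with True that show ?thesis by (simp add: retract_onto_def)
  qed (use that Min_in[OF fin A(2)] in \<open>simp add: retract_onto_def\<close>)
  then show "\<And>i. i \<le> n \<Longrightarrow> retract_onto n A i \<in> A" .
  show "retract_onto n A a = a" if "a \<in> A" for a
  proof -
    have "Max {b \<in> A. b \<le> a} = a" using that fin by (intro Max_eqI) auto
    with that A show ?thesis by (auto simp: retract_onto_def)
  qed
  show "retract_onto n A \<in> operators n n"
    unfolding retract_onto_def
  proof (rule operatorsI)
    fix i assume "i \<le> n"
    with mem[OF this] A show "(if \<exists>a\<in>A. a \<le> i then Max {a \<in> A. a \<le> i} else Min A) \<le> n"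
      by (auto simp: retract_onto_def subset_iff)
  next
    fix i j assume ij: "i \<le> j" "j \<le> n"
    show "(if \<exists>a\<in>A. a \<le> i then Max {a \<in> A. a \<le> i} else Min A)
        \<le> (if \<exists>a\<in>A. a \<le> j then Max {a \<in> A. a \<le> j} else Min A)"
    proof (cases "\<exists>a\<in>A. a \<le> i")
      case True
      then have "Max {a \<in> A. a \<le> i} \<le> Max {a \<in> A. a \<le> j}" using ij fin by (intro Max_mono) auto
      with True ij show ?thesis by (auto intro: order_trans)
    next
      case False
      have "Min A \<le> retract_onto n A j" using mem[OF ij(2)] fin by simp
      with False ij show ?thesis by (simp add: retract_onto_def)
    qed
  qed
qed

text \<open>The face of \<open>x\<close> spanned by the vertices in \<open>A\<close> is the degeneracy of \<open>y\<close> along \<open>f\<close>. Quantifying over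
  all operators into \<open>A\<close> avoids the operator that enumerates \<open>A\<close>.\<close>

definition face_factors :: "'a sset \<Rightarrow> nat \<Rightarrow> 'a \<Rightarrow> nat set \<Rightarrow> nat \<Rightarrow> 'a \<Rightarrow> (nat \<Rightarrow> nat) \<Rightarrow> bool" where
  "face_factors X n x A m y f \<longleftrightarrow> y \<in> simplices X m \<and> \<not> degenerate X m y \<and> mono_on A f \<and> f ` A = {..m} \<and>
    (\<forall>k. \<forall>\<beta>\<in>operators k n. \<beta> ` {..k} \<subseteq> A \<longrightarrow>
      action X k n \<beta> x = action X k m (compose {..k} f \<beta>) y)"

lemma face_factors_cong:
  assumes f: "face_factors X n x A m y f" and eq: "\<And>a. a \<in> A \<Longrightarrow> f a = g a"
  shows "face_factors X n x A m y g"
  unfolding face_factors_def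
proof (intro conjI allI ballI impI)
  have D: "y \<in> simplices X m" "\<not> degenerate X m y" "mono_on A f" "f ` A = {..m}"
    using f unfolding face_factors_def by blast+
  then show "y \<in> simplices X m" "\<not> degenerate X m y" by blast+
  show "mono_on A g" using D(3) eq by (simp add: mono_on_def)
  show "g ` A = {..m}" using D(4) eq by auto
  fix k \<beta> assume b: "\<beta> \<in> operators k n" "\<beta> ` {..k} \<subseteq> A"
  then have "compose {..k} g \<beta> = compose {..k} f \<beta>"
    using eq by (auto simp: compose_def fun_eq_iff)
  with f b show "action X k n \<beta> x = action X k m (compose {..k} g \<beta>) y"
    unfolding face_factors_def by metis
qed

lemma face_factors_compose:
  assumes "face_factors X n x A m y f" "\<beta> \<in> operators k n" "\<beta> ` {..k} \<subseteq> A"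
  shows "compose {..k} f \<beta> \<in> operators k m" "action X k n \<beta> x = action X k m (compose {..k} f \<beta>) y"
proof -
  show "action X k n \<beta> x = action X k m (compose {..k} f \<beta>) y"
    using assms unfolding face_factors_def by blast
  have f: "mono_on A f" "f ` A = {..m}" using assms unfolding face_factors_def by blast+
  show "compose {..k} f \<beta> \<in> operators k m"
    unfolding compose_def
  proof (rule operatorsI)
    fix i j assume ij: "i \<le> j" "j \<le> k"
    then show "f (\<beta> i) \<le> f (\<beta> j)"
      using f(1) assms(3) operators_mono[OF assms(2) ij] by (intro mono_onD[OF f(1)]) auto
  qed (use f(2) assms(3) in auto)
qed

text \<open>Evaluated at the retraction onto \<open>A\<close>, both factorizations are
  Eilenberg-Zilber decompositions of one simplex, and the retraction fixes the points of
  \<open>A\<close>.\<close>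

lemma face_factors_unique:
  assumes X: "is_sset X" and A: "A \<subseteq> {..n}" "A \<noteq> {}"
    and f: "face_factors X n x A m y f" and g: "face_factors X n x A m' y' g"
  shows "m = m'" "y = y'" "\<And>a. a \<in> A \<Longrightarrow> f a = g a"
proof -
  note r = retract_onto[OF A]
  have rA: "retract_onto n A ` {..n} = A"
    using r(2,3) A by (auto simp: image_iff) (metis atMost_iff subsetD)
  note f' = face_factors_compose[OF f r(1) equalityD1[OF rA]]
  note g' = face_factors_compose[OF g r(1) equalityD1[OF rA]]
  have img: "compose {..n} h (retract_onto n A) ` {..n} = h ` A" for h :: "nat \<Rightarrow> nat"
  proof -
    have "compose {..n} h (retract_onto n A) ` {..n} = h ` retract_onto n A ` {..n}"
      unfolding image_image by (rule image_cong) (auto simp: compose_def)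
    then show ?thesis using rA by simp
  qed
  have ff: "y \<in> simplices X m" "\<not> degenerate X m y" "f ` A = {..m}"
    and gg: "y' \<in> simplices X m'" "\<not> degenerate X m' y'" "g ` A = {..m'}"
    using f g unfolding face_factors_def by blast+
  have "action X n m (compose {..n} f (retract_onto n A)) y = action X n m' (compose {..n} g (retract_onto n A)) y'"
    using f'(2) g'(2) by simp
  from Eilenberg_Zilber_unique[OF X f'(1) _ ff(1,2) g'(1) _ gg(1,2) this] img ff(3) gg(3)
  show "m = m'" "y = y'" and eq: "\<And>a. a \<in> A \<Longrightarrow> f a = g a"
  proof -
    assume *: "compose {..n} f (retract_onto n A) ` {..n} = {..m} \<Longrightarrow>
       compose {..n} g (retract_onto n A) ` {..n} = {..m'} \<Longrightarrow> m = m'"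
      "compose {..n} f (retract_onto n A) ` {..n} = {..m} \<Longrightarrow>
       compose {..n} g (retract_onto n A) ` {..n} = {..m'} \<Longrightarrow> y = y'"
      "compose {..n} f (retract_onto n A) ` {..n} = {..m} \<Longrightarrow>
       compose {..n} g (retract_onto n A) ` {..n} = {..m'} \<Longrightarrow>
       compose {..n} f (retract_onto n A) = compose {..n} g (retract_onto n A)"
    show "m = m'" "y = y'" using * img ff(3) gg(3) by auto
    fix a assume a: "a \<in> A"
    have "compose {..n} f (retract_onto n A) a = compose {..n} g (retract_onto n A) a"
      using * img ff(3) gg(3) by auto
    with a A r(3)[OF a] show "f a = g a" by (auto simp: compose_def)
  qed
qed

text \<open>The Eilenberg-Zilber surjection of the retracted simplex serves as \<open>f\<close>;
  only its surjectivity on \<open>A\<close> takes an argument.\<close>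

lemma face_factors_exists:
  assumes X: "is_sset X" and A: "A \<subseteq> {..n}" "A \<noteq> {}" and x: "x \<in> simplices X n"
  obtains m y f where "face_factors X n x A m y f"
proof -
  note r = retract_onto[OF A]
  obtain m \<sigma> y where s: "\<sigma> \<in> operators n m" "\<sigma> ` {..n} = {..m}" "y \<in> simplices X m" "\<not> degenerate X m y"
    "action X n n (retract_onto n A) x = action X n m \<sigma> y"
    using Eilenberg_Zilber_exists[OF X action_simplices[OF X r(1) x]] by metis
  have fac: "action X k n \<beta> x = action X k m (compose {..k} \<sigma> \<beta>) y"
    if b: "\<beta> \<in> operators k n" "\<beta> ` {..k} \<subseteq> A" for k \<beta>
  proof -
    have "compose {..k} (retract_onto n A) \<beta> = \<beta>"
      by (rule operators_ext[OF operators_compose[OF b(1) r(1)] b(1)])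
        (use b(2) r(3) in \<open>auto simp: compose_def\<close>)
    then have "action X k n \<beta> x = action X k n \<beta> (action X n n (retract_onto n A) x)"
      using action_compose[OF X b(1) r(1) x] by simp
    also have "\<dots> = action X k m (compose {..k} \<sigma> \<beta>) y"
      unfolding s(5) by (rule action_compose[OF X b(1) s(1,3)])
    finally show ?thesis .
  qed
  have "\<sigma> ` A = {..m}"
  proof
    show "\<sigma> ` A \<subseteq> {..m}" using operators_app[OF s(1)] A by auto
    obtain \<iota> where i: "\<iota> \<in> operators m n" "compose {..m} \<sigma> \<iota> = (\<lambda>i\<in>{..m}. i)"
      using operators_section[OF s(1,2), of 0] by auto
    \<comment> \<open>A section of \<sigma> pushed into \<open>A\<close> by the retraction. As
      \<open>y\<close> is nondegenerate and reproduced by \<sigma>\<rho>, this endomorphism is the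
      identity, so each \<open>j\<close> is the value of \<sigma> at a point of
      \<open>A\<close>.\<close>
    define \<rho> where "\<rho> = compose {..m} (retract_onto n A) \<iota>"
    have rho: "\<rho> \<in> operators m n" "\<rho> ` {..m} \<subseteq> A"
      using operators_compose[OF i(1) r(1)] r(2) operators_app[OF i(1)] by (auto simp: \<rho>_def compose_def)
    have "y = action X m n \<iota> (action X n n (retract_onto n A) x)"
      using action_compose[OF X i(1) s(1,3)] i(2) action_id[OF X s(3)] s(5) by simp
    also have "\<dots> = action X m n \<rho> x" unfolding \<rho>_def by (rule action_compose[OF X i(1) r(1) x])
    also have "\<dots> = action X m m (compose {..m} \<sigma> \<rho>) y" by (rule fac[OF rho])
    finally have y: "y = action X m m (compose {..m} \<sigma> \<rho>) y" .
    have op: "compose {..m} \<sigma> \<rho> \<in> operators m m" by (rule operators_compose[OF rho(1) s(1)])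
    have "inj_on (compose {..m} \<sigma> \<rho>) {..m}"
      by (rule nondegenerate_inj[OF X _ op s(3)]) (use y s(4) in simp)
    then have "\<sigma> (\<rho> j) = j" if "j \<le> m" for j
      using operators_inj_endo[OF op _ that] that by (simp add: compose_def)
    moreover have "\<rho> j \<in> A" if "j \<le> m" for j using rho(2) that by blast
    ultimately show "{..m} \<subseteq> \<sigma> ` A" by (metis atMost_iff image_eqI subsetI)
  qed
  moreover have "mono_on A \<sigma>" using operators_mono[OF s(1)] A by (auto intro!: mono_onI)
  ultimately have "face_factors X n x A m y \<sigma>"
    unfolding face_factors_def by (intro conjI allI ballI impI fac s(3,4))
  then show thesis by (rule that)
qed

lemma face_factors_action:
  assumes X: "is_sset X" and a: "\<alpha> \<in> operators p n" and x: "x \<in> simplices X n" and A: "A \<subseteq> {..p}"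
    and f: "face_factors X n x (\<alpha> ` A) m y f"
  shows "face_factors X p (action X p n \<alpha> x) A m y (f \<circ> \<alpha>)"
  unfolding face_factors_def
proof (intro conjI allI ballI impI)
  show "y \<in> simplices X m" "\<not> degenerate X m y" "(f \<circ> \<alpha>) ` A = {..m}"
    using f unfolding face_factors_def by (auto simp: image_comp)
  have "mono_on (\<alpha> ` A) f" using f unfolding face_factors_def by blast
  then show "mono_on A (f \<circ> \<alpha>)"
    using operators_mono[OF a] A by (auto simp: mono_on_def subset_iff)
  fix k \<beta> assume b: "\<beta> \<in> operators k p" "\<beta> ` {..k} \<subseteq> A"
  have "action X k p \<beta> (action X p n \<alpha> x) = action X k n (compose {..k} \<alpha> \<beta>) x"
    by (rule action_compose[OF X b(1) a x])
  also have "\<dots> = action X k m (compose {..k} f (compose {..k} \<alpha> \<beta>)) y"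
    by (rule face_factors_compose(2)[OF f operators_compose[OF b(1) a]]) (use b in \<open>auto simp: compose_def\<close>)
  also have "compose {..k} f (compose {..k} \<alpha> \<beta>) = compose {..k} (f \<circ> \<alpha>) \<beta>"
    by (auto simp: compose_def fun_eq_iff)
  finally show "action X k p \<beta> (action X p n \<alpha> x) = action X k m (compose {..k} (f \<circ> \<alpha>) \<beta>) y" .
qed

text \<open>One direction is composition with \<alpha>; the other combines existence over the image
  with uniqueness over \<open>A\<close>. This is what makes data attached to supports compatible
  with operators.\<close>

lemma face_factors_action_iff:
  assumes X: "is_sset X" and a: "\<alpha> \<in> operators p n" and x: "x \<in> simplices X n" and A: "A \<subseteq> {..p}" "A \<noteq> {}"
  shows "face_factors X p (action X p n \<alpha> x) A m y g \<longleftrightarrow>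
    (\<exists>f. face_factors X n x (\<alpha> ` A) m y f \<and> (\<forall>a\<in>A. g a = f (\<alpha> a)))" (is "?L = ?R")
proof
  assume L: ?L
  have A': "\<alpha> ` A \<subseteq> {..n}" "\<alpha> ` A \<noteq> {}" using A operators_app[OF a] by auto
  obtain m' y' f where f: "face_factors X n x (\<alpha> ` A) m' y' f"
    using face_factors_exists[OF X A' x] by metis
  from face_factors_unique[OF X A L face_factors_action[OF X a x A(1) f]] f show ?R by auto
next
  assume ?R
  then obtain f where f: "face_factors X n x (\<alpha> ` A) m y f" and eq: "\<forall>a\<in>A. g a = f (\<alpha> a)" by blast
  have "face_factors X p (action X p n \<alpha> x) A m y (f \<circ> \<alpha>)" by (rule face_factors_action[OF X a x A(1) f])
  then show ?L by (rule face_factors_cong) (use eq in auto)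
qed

text \<open>Serves for limits of weights, in which some vertices of the support may be lost.\<close>

lemma face_factors_mono:
  assumes "face_factors X n x A m y f" "B \<subseteq> A" "f ` B = {..m}"
  shows "face_factors X n x B m y f"
  using assms mono_on_subset[of A f B] subset_trans[OF _ assms(2)] unfolding face_factors_def by simp

section \<open>Normal forms\<close>

lemma coend_rel_sym: "(p, q) \<in> coend_rel X T F \<Longrightarrow> (q, p) \<in> coend_rel X T F"
  using equiv_coend_rel[of X T F] by (auto simp: equiv_def dest: symD)

lemma coend_rel_trans:
  "(p, q) \<in> coend_rel X T F \<Longrightarrow> (q, r) \<in> coend_rel X T F \<Longrightarrow> (p, r) \<in> coend_rel X T F"
  using equiv_coend_rel[of X T F] by (auto simp: equiv_def dest: transD)

lemma coend_rel_sset_map: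
  assumes f: "sset_map X Y f" and r: "((n, x, t), (n', x', t')) \<in> coend_rel X T F"
  shows "((n, f n x, t), (n', f n' x', t')) \<in> coend_rel Y T F"
proof -
  have "(case (n, x, t) of (n, x, t) \<Rightarrow> (n, f n x, t), case (n', x', t') of (n, x, t) \<Rightarrow> (n, f n x, t)) \<in> coend_rel Y T F"
    using r equiv_coend_rel
  proof (rule coend_rel_induct)
    fix p p' assume "(p, p') \<in> coend_step X T F"
    then show "(case p of (n, x, t) \<Rightarrow> (n, f n x, t), case p' of (n, x, t) \<Rightarrow> (n, f n x, t)) \<in> coend_rel Y T F"
      using f by (intro coend_step_rel) (fastforce simp: coend_step_def sset_map_def)
  qed
  then show ?thesis by simp
qed

text \<open>Pushforward of weights with the maximum in place of the sum. The inserted 0 is the value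
  over an empty fibre and does not affect nonnegative weights.\<close>

definition max_push :: "'i set \<Rightarrow> ('i \<Rightarrow> 'j) \<Rightarrow> ('i \<Rightarrow> real) \<Rightarrow> 'j \<Rightarrow> real" where
  "max_push S f w j = Max (insert 0 (w ` {a \<in> S. f a = j}))"

text \<open>The universal property of the maximum: identities between pushforwards are proved by
  comparing upper bounds, through \<open>max_push_eqI\<close>.\<close>

lemma max_push_le:
  "finite S \<Longrightarrow> max_push S f w j \<le> c \<longleftrightarrow> 0 \<le> c \<and> (\<forall>a\<in>S. f a = j \<longrightarrow> w a \<le> c)"
  by (auto simp: max_push_def)

lemma max_push_eqI:
  assumes "\<And>c. max_push S f w j \<le> c \<longleftrightarrow> max_push S' f' w' j' \<le> c"
  shows "max_push S f w j = max_push S' f' w' j'"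
  using assms by (metis order_antisym order_refl)

lemma max_push_nonneg: "finite S \<Longrightarrow> 0 \<le> max_push S f w j"
  by (simp add: max_push_def)

lemma max_push_ge: "finite S \<Longrightarrow> a \<in> S \<Longrightarrow> w a \<le> max_push S f w (f a)"
  using max_push_le[of S f w "f a" "max_push S f w (f a)"] by auto

lemma max_push_attained:
  assumes "finite S" "max_push S f w j \<noteq> 0"
  obtains a where "a \<in> S" "f a = j" "w a = max_push S f w j"
proof -
  have "max_push S f w j \<in> insert 0 (w ` {a \<in> S. f a = j})"
    unfolding max_push_def using assms(1) by (intro Max_in) auto
  with assms(2) that show thesis by auto
qed

lemma max_push_compose:
  assumes "finite S" "finite S'" "f ` S \<subseteq> S'"
  shows "max_push S' g (max_push S f w) = max_push S (g \<circ> f) w"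
proof
  fix j
  show "max_push S' g (max_push S f w) j = max_push S (g \<circ> f) w j"
    by (rule max_push_eqI) (use assms in \<open>auto simp: max_push_le image_subset_iff\<close>)
qed

lemma max_push_cong:
  assumes "\<And>a. a \<in> S \<Longrightarrow> f a = g a" "\<And>a. a \<in> S \<Longrightarrow> w a = w' a"
  shows "max_push S f w = max_push S g w'"
proof
  fix j
  have "w ` {a \<in> S. f a = j} = w' ` {a \<in> S. g a = j}"
    using assms by (intro image_cong) auto
  then show "max_push S f w j = max_push S g w' j" by (simp add: max_push_def)
qed

lemma max_push_subset:
  assumes "finite S" "B \<subseteq> S" "\<And>a. a \<in> S - B \<Longrightarrow> w a = 0"
  shows "max_push S f w = max_push B f w"
proof
  fix j
  have "finite B" using assms finite_subset by blast
  then show "max_push S f w j = max_push B f w j"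
    by (intro max_push_eqI) (use assms in \<open>auto simp: max_push_le; metis DiffI\<close>)
qed

lemma max_push_support:
  assumes "finite S" "\<And>a. a \<in> S \<Longrightarrow> 0 \<le> w a"
  shows "max_push S f w j \<noteq> 0 \<longleftrightarrow> (\<exists>a\<in>S. f a = j \<and> w a \<noteq> 0)"
proof
  assume "max_push S f w j \<noteq> 0"
  with max_push_attained[OF assms(1) this] show "\<exists>a\<in>S. f a = j \<and> w a \<noteq> 0" by metis
next
  assume "\<exists>a\<in>S. f a = j \<and> w a \<noteq> 0"
  then obtain a where a: "a \<in> S" "f a = j" "w a \<noteq> 0" by blast
  with assms(2)[OF a(1)] max_push_ge[OF assms(1) a(1), of w f] show "max_push S f w j \<noteq> 0" by force
qed

lemma max_push_id:
  assumes "finite S" "\<And>a. a \<in> S \<Longrightarrow> 0 \<le> w a" "\<And>a. a \<notin> S \<Longrightarrow> w a = 0" "\<And>a. a \<in> S \<Longrightarrow> f a = a"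
  shows "max_push S f w = w"
proof
  fix j
  show "max_push S f w j = w j"
  proof (rule order_antisym)
    show "max_push S f w j \<le> w j"
      using assms by (cases "j \<in> S") (auto simp: max_push_le)
    show "w j \<le> max_push S f w j"
      using max_push_ge[OF assms(1), of j w f] assms max_push_nonneg[OF assms(1), of f w j] by (cases "j \<in> S") auto
  qed
qed

section \<open>Max-plus simplices and their coend\<close>

definition max_simplex :: "nat \<Rightarrow> (nat \<Rightarrow> real) set" where
  "max_simplex n = {w. (\<forall>i. 0 \<le> w i \<and> w i \<le> 1) \<and> (\<forall>i>n. w i = 0) \<and> (\<exists>i. w i = 1)}"

definition max_simplex_push :: "nat \<Rightarrow> nat \<Rightarrow> (nat \<Rightarrow> nat) \<Rightarrow> (nat \<Rightarrow> real) \<Rightarrow> nat \<Rightarrow> real" where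
  "max_simplex_push m n \<alpha> = max_push {..m} \<alpha>"

abbreviation max_rel :: "'a sset \<Rightarrow> (nat \<times> 'a \<times> (nat \<Rightarrow> real)) rel" where
  "max_rel X \<equiv> coend_rel X max_simplex max_simplex_push"

abbreviation max_points :: "'a sset \<Rightarrow> (nat \<times> 'a \<times> (nat \<Rightarrow> real)) set" where
  "max_points X \<equiv> coend_points X max_simplex"

abbreviation supp :: "('i \<Rightarrow> real) \<Rightarrow> 'i set" where
  "supp w \<equiv> {i. w i \<noteq> 0}"

lemma max_simplexD:
  assumes "w \<in> max_simplex n"
  shows "0 \<le> w i" "w i \<le> 1" "supp w \<subseteq> {..n}" "supp w \<noteq> {}" "finite (supp w)"
proof -
  show 1: "supp w \<subseteq> {..n}"
    using assms unfolding max_simplex_def by (auto intro: leI)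
  then show "finite (supp w)" using finite_subset by blast
  obtain j where "w j = 1" using assms unfolding max_simplex_def by blast
  then have "j \<in> supp w" by simp
  then show "supp w \<noteq> {}" by blast
  show "0 \<le> w i" "w i \<le> 1" using assms unfolding max_simplex_def by auto
qed

lemma max_push_max_simplex:
  assumes w: "\<And>a. a \<in> S \<Longrightarrow> 0 \<le> w a \<and> w a \<le> 1" "a \<in> S" "w a = 1" and S: "finite S" "f ` S \<subseteq> {..n}"
  shows "max_push S f w \<in> max_simplex n"
proof -
  have le: "max_push S f w j \<le> 1" for j using w(1) S(1) by (auto simp: max_push_le)
  have one: "max_push S f w (f a) = 1"
    using max_push_ge[OF S(1) w(2), of w f] w(3) le[of "f a"] by simp
  have zero: "max_push S f w j = 0" if "j > n" for j
  proof (rule ccontr)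
    assume "max_push S f w j \<noteq> 0"
    then obtain b where "b \<in> S" "f b = j" using max_push_attained[OF S(1)] by metis
    with S(2) that show False by auto
  qed
  show ?thesis
    unfolding max_simplex_def mem_Collect_eq
    by (intro conjI allI impI exI[of _ "f a"] max_push_nonneg S(1) le one zero)
qed

lemma supp_max_simplex_push:
  assumes "w \<in> max_simplex p"
  shows "supp (max_simplex_push p n \<alpha> w) = \<alpha> ` supp w"
  using max_push_support[of "{..p}" w \<alpha>] max_simplexD(1,3)[OF assms]
  by (auto simp: max_simplex_push_def image_iff)

lemma max_push_supp:
  assumes "w \<in> max_simplex p"
  shows "max_push {..p} h w = max_push (supp w) h w"
  by (rule max_push_subset) (use max_simplexD(3)[OF assms] in auto)

lemma max_push_max_simplex_push:
  assumes "w \<in> max_simplex p"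
  shows "max_push (\<alpha> ` supp w) h (max_simplex_push p n \<alpha> w) = max_push (supp w) (h \<circ> \<alpha>) w"
proof -
  have "max_simplex_push p n \<alpha> w = max_push (supp w) \<alpha> w"
    unfolding max_simplex_push_def by (rule max_push_supp[OF assms])
  then show ?thesis
    using max_push_compose[OF _ _ order_refl, of "supp w"] max_simplexD(5)[OF assms] by simp
qed

text \<open>The simplex is restricted to the face spanned by the support, reduced by
  Eilenberg-Zilber, and the weights are pushed along. A relation is used since \<open>f\<close> is
  determined on the support only.\<close>

definition normal_form :: "'a sset \<Rightarrow> nat \<Rightarrow> 'a \<Rightarrow> (nat \<Rightarrow> real) \<Rightarrow> nat \<times> 'a \<times> (nat \<Rightarrow> real) \<Rightarrow> bool" where
  "normal_form X m y u = (\<lambda>(n, x, w). \<exists>f. face_factors X n x (supp w) m y f \<and> max_push (supp w) f w = u)"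

text \<open>The joint weight \<omega> lives on pairs of vertices and has \<open>u\<close> and
  \<open>v\<close> as its max-plus marginals. With both normal forms fixed, it is the remaining
  invariant of a point.\<close>

definition coupled ::
  "'a sset \<Rightarrow> 'b sset \<Rightarrow> nat \<Rightarrow> 'a \<Rightarrow> (nat \<Rightarrow> real) \<Rightarrow> nat \<Rightarrow> 'b \<Rightarrow> (nat \<Rightarrow> real) \<Rightarrow>
    nat \<times> ('a \<times> 'b) \<times> (nat \<Rightarrow> real) \<Rightarrow> (nat \<times> nat \<Rightarrow> real) \<Rightarrow> bool" where
  "coupled X Y m x0 u m' y0 v = (\<lambda>(n, (x, y), w) \<omega>. \<exists>f g.
    face_factors X n x (supp w) m x0 f \<and> face_factors Y n y (supp w) m' y0 g \<and>
    max_push (supp w) f w = u \<and> max_push (supp w) g w = v \<and> max_push (supp w) (\<lambda>a. (f a, g a)) w = \<omega>)"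

lemma normal_form_iff:
  "normal_form X m y u (n, x, w) \<longleftrightarrow> (\<exists>f. face_factors X n x (supp w) m y f \<and> max_push (supp w) f w = u)"
  by (simp add: normal_form_def)

lemma coupled_iff:
  "coupled X Y m x0 u m' y0 v (n, (x, y), w) \<omega> \<longleftrightarrow> (\<exists>f g.
    face_factors X n x (supp w) m x0 f \<and> face_factors Y n y (supp w) m' y0 g \<and>
    max_push (supp w) f w = u \<and> max_push (supp w) g w = v \<and> max_push (supp w) (\<lambda>a. (f a, g a)) w = \<omega>)"
  by (simp add: coupled_def)

lemma equiv_kernel: "equiv UNIV {(p, p'). h p = h p'}"
  by (auto simp: equiv_def refl_on_def sym_def trans_def)

text \<open>An operator carries the support to its image, and factorizations over the image pull
  back along it, so both ends of a generating step have the same pushforwards.\<close>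

lemma coupled_invariant:
  assumes X: "is_sset X" and Y: "is_sset Y" and r: "(p, p') \<in> max_rel (sset_prod X Y)"
  shows "coupled X Y m x0 u m' y0 v p = coupled X Y m x0 u m' y0 v p'"
proof -
  let ?C = "coupled X Y m x0 u m' y0 v"
  have "(p, p') \<in> {(p, p'). ?C p = ?C p'}"
  proof (rule coend_rel_induct[OF r equiv_kernel, where h = "\<lambda>p. p"])
    fix p p' assume "(p, p') \<in> coend_step (sset_prod X Y) max_simplex max_simplex_push"
    then obtain k n \<alpha> x y w
      where p: "p = (k, (action X k n \<alpha> x, action Y k n \<alpha> y), w)" "p' = (n, (x, y), max_simplex_push k n \<alpha> w)"
      and a: "\<alpha> \<in> operators k n" and x: "x \<in> simplices X n" and y: "y \<in> simplices Y n" and w: "w \<in> max_simplex k"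
      unfolding coend_step_def sset_prod_def by auto
    have "?C p \<omega> \<longleftrightarrow> ?C p' \<omega>" for \<omega>
    proof
      assume "?C p \<omega>"
      then obtain f' g' where
        f': "face_factors X k (action X k n \<alpha> x) (supp w) m x0 f'" "max_push (supp w) f' w = u" and
        g': "face_factors Y k (action Y k n \<alpha> y) (supp w) m' y0 g'" "max_push (supp w) g' w = v" and
        fg': "max_push (supp w) (\<lambda>a. (f' a, g' a)) w = \<omega>"
        unfolding p coupled_iff by blast
      obtain f where f: "face_factors X n x (\<alpha> ` supp w) m x0 f" "\<forall>a\<in>supp w. f' a = f (\<alpha> a)"
        using f' face_factors_action_iff[OF X a x max_simplexD(3,4)[OF w]] by blast
      obtain g where g: "face_factors Y n y (\<alpha> ` supp w) m' y0 g" "\<forall>a\<in>supp w. g' a = g (\<alpha> a)"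
        using g' face_factors_action_iff[OF Y a y max_simplexD(3,4)[OF w]] by blast
      have "max_push (supp w) (f \<circ> \<alpha>) w = u" "max_push (supp w) (g \<circ> \<alpha>) w = v"
        "max_push (supp w) ((\<lambda>a. (f a, g a)) \<circ> \<alpha>) w = \<omega>"
        unfolding f'(2)[symmetric] g'(2)[symmetric] fg'[symmetric]
        by (rule max_push_cong; use f g in simp)+
      with f g show "?C p' \<omega>"
        unfolding p coupled_iff
        by (auto simp: max_push_max_simplex_push[OF w] supp_max_simplex_push[OF w])
    next
      assume "?C p' \<omega>"
      then obtain f g where
        f: "face_factors X n x (\<alpha> ` supp w) m x0 f" "max_push (supp w) (f \<circ> \<alpha>) w = u" and
        g: "face_factors Y n y (\<alpha> ` supp w) m' y0 g" "max_push (supp w) (g \<circ> \<alpha>) w = v" and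
        fg: "max_push (supp w) ((\<lambda>a. (f a, g a)) \<circ> \<alpha>) w = \<omega>"
        unfolding p coupled_iff
        by (auto simp: max_push_max_simplex_push[OF w] supp_max_simplex_push[OF w])
      have "(\<lambda>a. (f a, g a)) \<circ> \<alpha> = (\<lambda>a. ((f \<circ> \<alpha>) a, (g \<circ> \<alpha>) a))" by auto
      with fg have "max_push (supp w) (\<lambda>a. ((f \<circ> \<alpha>) a, (g \<circ> \<alpha>) a)) w = \<omega>" by simp
      with f(2) g(2) face_factors_action[OF X a x max_simplexD(3)[OF w] f(1)]
        face_factors_action[OF Y a y max_simplexD(3)[OF w] g(1)]
      show "?C p \<omega>" unfolding p coupled_iff by blast
    qed
    then show "(p, p') \<in> {(p, p'). ?C p = ?C p'}" by (auto simp: fun_eq_iff)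
  qed
  then show ?thesis by simp
qed

text \<open>A normal form of \<open>x\<close> is a coupling of the diagonal simplex
  \<open>(x, x)\<close>, so invariance for pairs applies.\<close>

lemma normal_form_invariant:
  assumes X: "is_sset X" and r: "((n, x, w), (n', x', w')) \<in> max_rel X"
  shows "normal_form X m y u (n, x, w) \<longleftrightarrow> normal_form X m y u (n', x', w')"
proof -
  have diag: "normal_form X m y u (n, x, w) \<longleftrightarrow> (\<exists>\<omega>. coupled X X m y u m y u (n, (x, x), w) \<omega>)" for n x w
    unfolding normal_form_iff coupled_iff by blast
  have "sset_map X (sset_prod X X) (\<lambda>n x. (x, x))" by (simp add: sset_map_def sset_prod_def)
  from coupled_invariant[OF X X coend_rel_sset_map[OF this r]] show ?thesis
    unfolding diag by simp
qed

lemma max_push_retract_onto: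
  assumes "w \<in> max_simplex n"
  shows "max_simplex_push n n (retract_onto n (supp w)) w = w"
proof -
  have "max_simplex_push n n (retract_onto n (supp w)) w = max_push (supp w) (retract_onto n (supp w)) w"
    unfolding max_simplex_push_def by (rule max_push_supp[OF assms])
  also have "\<dots> = w"
    by (rule max_push_id) (use max_simplexD[OF assms] retract_onto(3)[OF max_simplexD(3,4)[OF assms]] in auto)
  finally show ?thesis .
qed

text \<open>The retraction onto the support fixes the weights, so vertices of weight 0 can be
  collapsed away.\<close>

lemma max_rel_retract_onto:
  assumes x: "x \<in> simplices X n" and w: "w \<in> max_simplex n"
  shows "((n, x, w), (n, action X n n (retract_onto n (supp w)) x, w)) \<in> max_rel X"
proof -
  have "((n, action X n n (retract_onto n (supp w)) x, w), (n, x, max_simplex_push n n (retract_onto n (supp w)) w))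
      \<in> coend_step X max_simplex max_simplex_push"
    unfolding coend_step_def using x w retract_onto(1)[OF max_simplexD(3,4)[OF w]] by blast
  from coend_step_rel[OF this] show ?thesis
    unfolding max_push_retract_onto[OF w] by (rule coend_rel_sym)
qed

lemma retract_onto_image:
  assumes "A \<subseteq> {..n}" "A \<noteq> {}" shows "retract_onto n A ` {..n} \<subseteq> A"
  using retract_onto(2)[OF assms] by auto

lemma normal_form_rel:
  assumes X: "is_sset X" and x: "x \<in> simplices X n" and w: "w \<in> max_simplex n"
    and nf: "normal_form X m y u (n, x, w)"
  shows "((n, x, w), (m, y, u)) \<in> max_rel X"
proof -
  obtain f where f: "face_factors X n x (supp w) m y f" "max_push (supp w) f w = u"
    using nf unfolding normal_form_iff by blast
  note A = max_simplexD(3,4)[OF w]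
  let ?r = "retract_onto n (supp w)"
  note fr = face_factors_compose[OF f(1) retract_onto(1)[OF A] retract_onto_image[OF A]]
  have "((n, action X n m (compose {..n} f ?r) y, w), (m, y, max_simplex_push n m (compose {..n} f ?r) w))
      \<in> coend_step X max_simplex max_simplex_push"
    unfolding coend_step_def using w fr(1) f(1) unfolding face_factors_def by blast
  moreover have "max_simplex_push n m (compose {..n} f ?r) w = u"
    unfolding max_simplex_push_def max_push_supp[OF w] f(2)[symmetric]
    by (rule max_push_cong) (use A retract_onto(3)[OF A] in \<open>auto simp: compose_def\<close>)
  ultimately have "((n, action X n n ?r x, w), (m, y, u)) \<in> max_rel X"
    using coend_step_rel fr(2) by metis
  with max_rel_retract_onto[OF x w] show ?thesis by (rule coend_rel_trans)
qed

lemma normal_form_exists: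
  assumes X: "is_sset X" and x: "x \<in> simplices X n" and w: "w \<in> max_simplex n"
  obtains m y u where "normal_form X m y u (n, x, w)" "y \<in> simplices X m" "\<not> degenerate X m y"
    "u \<in> max_simplex m" "\<And>i. i \<le> m \<Longrightarrow> 0 < u i"
proof -
  note A = max_simplexD(3,4)[OF w]
  obtain m y f where f: "face_factors X n x (supp w) m y f"
    using face_factors_exists[OF X A x] by metis
  then have fA: "f ` supp w = {..m}" and y: "y \<in> simplices X m" "\<not> degenerate X m y"
    unfolding face_factors_def by blast+
  obtain a where a: "w a = 1" using w unfolding max_simplex_def by blast
  let ?u = "max_push (supp w) f w"
  have "?u \<in> max_simplex m"
    by (rule max_push_max_simplex) (use max_simplexD[OF w] a fA in auto)
  moreover have "0 < ?u i" if "i \<le> m" for i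
  proof -
    have "i \<in> f ` supp w" using fA that by simp
    then obtain b where b: "f b = i" "w b \<noteq> 0" by blast
    with max_push_ge[OF max_simplexD(5)[OF w], of b w f] max_simplexD(1)[OF w, of b] show ?thesis by force
  qed
  ultimately show thesis using that f y unfolding normal_form_iff by blast
qed

lemma coupled_exists:
  assumes "normal_form X m x0 u (n, x, w)" "normal_form Y m' y0 v (n, y, w)"
  obtains \<omega> where "coupled X Y m x0 u m' y0 v (n, (x, y), w) \<omega>"
  using assms unfolding normal_form_iff coupled_iff by blast

lemma coupled_normal_form:
  assumes "coupled X Y m x0 u m' y0 v (n, (x, y), w) \<omega>"
  shows "normal_form X m x0 u (n, x, w)" "normal_form Y m' y0 v (n, y, w)"
  using assms unfolding normal_form_iff coupled_iff by blast+

lemma coupled_unique: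
  assumes X: "is_sset X" and Y: "is_sset Y" and w: "w \<in> max_simplex n"
    and 1: "coupled X Y m x0 u m' y0 v (n, (x, y), w) \<omega>" and 2: "coupled X Y m x0 u m' y0 v (n, (x, y), w) \<omega>'"
  shows "\<omega> = \<omega>'"
proof -
  note A = max_simplexD(3,4)[OF w]
  obtain f g where fg: "face_factors X n x (supp w) m x0 f" "face_factors Y n y (supp w) m' y0 g"
    "max_push (supp w) (\<lambda>a. (f a, g a)) w = \<omega>" using 1 unfolding coupled_iff by blast
  obtain f' g' where fg': "face_factors X n x (supp w) m x0 f'" "face_factors Y n y (supp w) m' y0 g'"
    "max_push (supp w) (\<lambda>a. (f' a, g' a)) w = \<omega>'" using 2 unfolding coupled_iff by blast
  have "max_push (supp w) (\<lambda>a. (f a, g a)) w = max_push (supp w) (\<lambda>a. (f' a, g' a)) w"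
    by (rule max_push_cong)
      (use face_factors_unique(3)[OF X A fg(1) fg'(1)] face_factors_unique(3)[OF Y A fg(2) fg'(2)] in auto)
  with fg fg' show ?thesis by simp
qed

text \<open>The support of \<open>w\<close> is totally ordered and \<open>f\<close>,
  \<open>g\<close> are monotone, hence the chain. Row and column maxima are attained because pushing
  \<omega> to one factor returns \<open>u\<close> or \<open>v\<close>.\<close>

lemma coupled_tropical_coupling:
  assumes w: "w \<in> max_simplex n" and c: "coupled X Y m x0 u m' y0 v (n, (x, y), w) \<omega>"
    and u: "\<And>i. i \<le> m \<Longrightarrow> 0 < u i" and v: "\<And>i. i \<le> m' \<Longrightarrow> 0 < v i"
  shows "\<omega> \<in> tropical_couplings {..m} {..m} {..m'} {..m'} u v"
proof -
  obtain f g where f: "face_factors X n x (supp w) m x0 f" and g: "face_factors Y n y (supp w) m' y0 g"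
    and ueq: "u = max_push (supp w) f w" and veq: "v = max_push (supp w) g w"
    and \<omega>: "\<omega> = max_push (supp w) (\<lambda>a. (f a, g a)) w" using c unfolding coupled_iff by blast
  have fm: "mono_on (supp w) f" "f ` supp w = {..m}" and gm: "mono_on (supp w) g" "g ` supp w = {..m'}"
    using f g unfolding face_factors_def by blast+
  note fin = max_simplexD(5)[OF w]
  have fst_eq: "max_push ({..m} \<times> {..m'}) fst \<omega> = u" and snd_eq: "max_push ({..m} \<times> {..m'}) snd \<omega> = v"
    unfolding \<omega> ueq veq by (subst max_push_compose; use fin fm gm in \<open>auto simp: comp_def\<close>)+
  have at: "\<exists>a\<in>supp w. f a = r \<and> g a = c \<and> w a = \<omega> (r, c)" if "\<omega> (r, c) \<noteq> 0" for r c
  proof -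
    note nz = that[unfolded \<omega>]
    obtain a where "a \<in> supp w" "(f a, g a) = (r, c)"
      "w a = max_push (supp w) (\<lambda>a. (f a, g a)) w (r, c)"
      by (rule max_push_attained[OF fin nz])
    then show ?thesis unfolding \<omega> by blast
  qed
  show ?thesis
  proof (rule tropical_couplingsI)
    show "0 \<le> \<omega> (r, c)" for r c unfolding \<omega> by (rule max_push_nonneg[OF fin])
    show "r \<in> {..m} \<and> c \<in> {..m'} \<and> \<omega> (r, c) \<le> u r \<and> \<omega> (r, c) \<le> v c" if nz: "\<omega> (r, c) \<noteq> 0" for r c
    proof -
      obtain a where "a \<in> supp w" "f a = r" "g a = c" "w a = \<omega> (r, c)" using at[OF nz] by blast
      then show ?thesis
        using max_push_ge[OF fin, of a w f] max_push_ge[OF fin, of a w g] fm(2) gm(2) unfolding ueq veq by auto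
    qed
    show "r \<le> r' \<and> c \<le> c' \<or> r' \<le> r \<and> c' \<le> c" if nz: "\<omega> (r, c) \<noteq> 0" "\<omega> (r', c') \<noteq> 0" for r c r' c'
    proof -
      obtain a b where "a \<in> supp w" "f a = r" "g a = c" "b \<in> supp w" "f b = r'" "g b = c'"
        using at[OF nz(1)] at[OF nz(2)] by blast
      then show ?thesis using mono_onD[OF fm(1)] mono_onD[OF gm(1)] by (metis linorder_le_cases)
    qed
    show "\<exists>c. \<omega> (r, c) = u r" if r: "r \<in> {..m}" for r
    proof -
      have "max_push ({..m} \<times> {..m'}) fst \<omega> r \<noteq> 0" using u[of r] r fst_eq by simp
      then obtain p where "fst p = r" "\<omega> p = max_push ({..m} \<times> {..m'}) fst \<omega> r"
        using max_push_attained[of "{..m} \<times> {..m'}"] by (metis finite_SigmaI finite_atMost)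
      then have "\<omega> (r, snd p) = u r" unfolding fst_eq by (cases p) simp
      then show ?thesis by blast
    qed
    show "\<exists>r. \<omega> (r, c) = v c" if c: "c \<in> {..m'}" for c
    proof -
      have "max_push ({..m} \<times> {..m'}) snd \<omega> c \<noteq> 0" using v[of c] c snd_eq by simp
      then obtain p where "snd p = c" "\<omega> p = max_push ({..m} \<times> {..m'}) snd \<omega> c"
        using max_push_attained[of "{..m} \<times> {..m'}"] by (metis finite_SigmaI finite_atMost)
      then have "\<omega> (fst p, c) = v c" unfolding snd_eq by (cases p) simp
      then show ?thesis by blast
    qed
  qed
qed

text \<open>A chain of positions is recovered from the values of \<open>i + j\<close> on it.\<close>

definition chain_index :: "(nat \<times> nat \<Rightarrow> nat) \<Rightarrow> (nat \<times> nat \<Rightarrow> real) \<Rightarrow> nat \<Rightarrow> nat" where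
  "chain_index h \<omega> s = Max (insert 0 (h ` {p \<in> supp \<omega>. fst p + snd p \<le> s}))"

lemma chain_index_mono: "finite (supp \<omega>) \<Longrightarrow> s \<le> s' \<Longrightarrow> chain_index h \<omega> s \<le> chain_index h \<omega> s'"
  unfolding chain_index_def by (intro Max_mono) auto

lemma chain_index_le:
  assumes "finite (supp \<omega>)" "\<And>p. p \<in> supp \<omega> \<Longrightarrow> h p \<le> m"
  shows "chain_index h \<omega> s \<le> m"
  unfolding chain_index_def using assms by (subst Max_le_iff) auto

lemma chain_index:
  assumes "finite (supp \<omega>)" "chain_supported \<omega>" "p \<in> supp \<omega>" "h = fst \<or> h = snd"
  shows "chain_index h \<omega> (fst p + snd p) = h p"
  unfolding chain_index_def
proof (rule Max_eqI)
  fix a assume "a \<in> insert 0 (h ` {q \<in> supp \<omega>. fst q + snd q \<le> fst p + snd p})"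
  then consider "a = 0" | q where "\<omega> q \<noteq> 0" "fst q + snd q \<le> fst p + snd p" "a = h q" by auto
  then show "a \<le> h p"
  proof cases
    case (2 q)
    then have "fst q \<le> fst p \<and> snd q \<le> snd p \<or> fst p \<le> fst q \<and> snd p \<le> snd q"
      using assms(2)[unfolded chain_supported_def, rule_format, of "fst q" "snd q" "fst p" "snd p"] assms(3) by auto
    with 2 assms(4) show ?thesis by auto
  qed simp
qed (use assms in auto)

text \<open>The inverse construction. The sum i + j is injective on a chain, so positions become
  vertices of a simplex of the uniform dimension \<open>m + m'\<close>, whatever the length of the
  chain.\<close>

definition canonical_point ::
  "'a sset \<Rightarrow> 'b sset \<Rightarrow> nat \<Rightarrow> 'a \<Rightarrow> nat \<Rightarrow> 'b \<Rightarrow> (nat \<times> nat \<Rightarrow> real) \<Rightarrow> nat \<times> ('a \<times> 'b) \<times> (nat \<Rightarrow> real)" where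
  "canonical_point X Y m x0 m' y0 \<omega> =
    (m + m',
     (action X (m + m') m (restrict (chain_index fst \<omega>) {..m + m'}) x0,
      action Y (m + m') m' (restrict (chain_index snd \<omega>) {..m + m'}) y0),
     max_push (supp \<omega>) (\<lambda>p. fst p + snd p) \<omega>)"

lemma tropical_couplings_supp:
  assumes "\<omega> \<in> tropical_couplings {..m} {..m} {..m'} {..m'} u v"
  shows "supp \<omega> \<subseteq> {..m} \<times> {..m'}" "finite (supp \<omega>)" "chain_supported \<omega>"
proof -
  show "supp \<omega> \<subseteq> {..m} \<times> {..m'}"
  proof
    fix p assume "p \<in> supp \<omega>"
    then have "\<omega> (fst p, snd p) \<noteq> 0" by simp
    from tropical_couplingsD(2,3)[OF assms this] show "p \<in> {..m} \<times> {..m'}" by (cases p) auto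
  qed
  then show "finite (supp \<omega>)" using finite_subset by blast
  show "chain_supported \<omega>" using assms unfolding tropical_couplings_def by blast
qed

lemma chain_index_operators:
  assumes "\<omega> \<in> tropical_couplings {..m} {..m} {..m'} {..m'} u v"
  shows "restrict (chain_index fst \<omega>) {..m + m'} \<in> operators (m + m') m"
    "restrict (chain_index snd \<omega>) {..m + m'} \<in> operators (m + m') m'"
  using tropical_couplings_supp[OF assms]
  by (auto intro!: operatorsI chain_index_le chain_index_mono)

text \<open>The coupling determines the point: the operator \<theta>, adding the two coordinates of
  a vertex after retraction to the support, induces the retracted simplex from the canonical one and
  pushes \<open>w\<close> to the canonical weights.\<close>

lemma coupled_canonical_point:
  assumes X: "is_sset X" and Y: "is_sset Y"
    and p: "(n, (x, y), w) \<in> max_points (sset_prod X Y)" and c: "coupled X Y m x0 u m' y0 v (n, (x, y), w) \<omega>"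
    and u: "\<And>i. i \<le> m \<Longrightarrow> 0 < u i" and v: "\<And>i. i \<le> m' \<Longrightarrow> 0 < v i"
  shows "((n, (x, y), w), canonical_point X Y m x0 m' y0 \<omega>) \<in> max_rel (sset_prod X Y)"
proof -
  let ?Z = "sset_prod X Y" and ?N = "m + m'"
  have w: "w \<in> max_simplex n" and xy: "(x, y) \<in> simplices ?Z n"
    using p unfolding coend_points_def by auto
  note A = max_simplexD(3,4)[OF w]
  note fin = max_simplexD(5)[OF w]
  have \<omega>T: "\<omega> \<in> tropical_couplings {..m} {..m} {..m'} {..m'} u v"
    by (rule coupled_tropical_coupling[OF w c u v])
  note S = tropical_couplings_supp[OF \<omega>T]
  obtain f g where f: "face_factors X n x (supp w) m x0 f" and g: "face_factors Y n y (supp w) m' y0 g"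
    and \<omega>: "\<omega> = max_push (supp w) (\<lambda>a. (f a, g a)) w" using c unfolding coupled_iff by blast
  have x0: "x0 \<in> simplices X m" and y0: "y0 \<in> simplices Y m'"
    and fm: "mono_on (supp w) f" "f ` supp w = {..m}" and gm: "mono_on (supp w) g" "g ` supp w = {..m'}"
    using f g unfolding face_factors_def by blast+
  let ?r = "retract_onto n (supp w)" and ?F = "restrict (chain_index fst \<omega>) {..?N}"
    and ?G = "restrict (chain_index snd \<omega>) {..?N}"
  note r = retract_onto[OF A]
  have mem: "(f a, g a) \<in> supp \<omega>" if "a \<in> supp w" for a
    using that max_push_support[OF fin, of w "\<lambda>a. (f a, g a)" "(f a, g a)"] max_simplexD(1)[OF w]
    unfolding \<omega> by blast
  have ci: "chain_index fst \<omega> (f a + g a) = f a" "chain_index snd \<omega> (f a + g a) = g a" if "a \<in> supp w" for a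
    using chain_index[OF S(2,3) mem[OF that]] by auto
  have le: "f a \<le> m" "g a \<le> m'" if "a \<in> supp w" for a using fm gm that by auto
  define \<theta> where "\<theta> = (\<lambda>i\<in>{..n}. f (?r i) + g (?r i))"
  have th: "\<theta> \<in> operators n ?N"
    unfolding \<theta>_def
  proof (rule operatorsI)
    fix i j assume ij: "i \<le> j" "j \<le> n"
    have "?r i \<le> ?r j" by (rule operators_mono[OF r(1) ij])
    then show "f (?r i) + g (?r i) \<le> f (?r j) + g (?r j)"
      using mono_onD[OF fm(1)] mono_onD[OF gm(1)] r(2) ij by (meson add_mono le_trans)
  next
    fix i assume "i \<le> n"
    then show "f (?r i) + g (?r i) \<le> m + m'" using le r(2) by (intro add_mono) auto
  qed
  have cF: "compose {..n} ?F \<theta> = compose {..n} f ?r"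
    using ci(1)[OF r(2)] le(1)[OF r(2)] le(2)[OF r(2)] by (auto simp: compose_def \<theta>_def fun_eq_iff add_mono)
  have cG: "compose {..n} ?G \<theta> = compose {..n} g ?r"
    using ci(2)[OF r(2)] le(1)[OF r(2)] le(2)[OF r(2)] by (auto simp: compose_def \<theta>_def fun_eq_iff add_mono)
  note FG = chain_index_operators[OF \<omega>T]
  have "action X n n ?r x = action X n ?N \<theta> (action X ?N m ?F x0)"
    using face_factors_compose(2)[OF f r(1) retract_onto_image[OF A]]
      action_compose[OF X th FG(1) x0] cF by simp
  moreover have "action Y n n ?r y = action Y n ?N \<theta> (action Y ?N m' ?G y0)"
    using face_factors_compose(2)[OF g r(1) retract_onto_image[OF A]]
      action_compose[OF Y th FG(2) y0] cG by simp
  ultimately have act: "action ?Z n n ?r (x, y)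
      = action ?Z n ?N \<theta> (action X ?N m ?F x0, action Y ?N m' ?G y0)"
    by (simp add: sset_prod_def)
  have "(action X ?N m ?F x0, action Y ?N m' ?G y0) \<in> simplices ?Z ?N"
    using action_simplices[OF X FG(1) x0] action_simplices[OF Y FG(2) y0] by (simp add: sset_prod_def)
  then have step: "((n, action ?Z n n ?r (x, y), w),
      (?N, (action X ?N m ?F x0, action Y ?N m' ?G y0), max_simplex_push n ?N \<theta> w)) \<in> max_rel ?Z"
    unfolding act by (intro coend_step_rel) (use th w in \<open>auto simp: coend_step_def\<close>)
  have "max_simplex_push n ?N \<theta> w = max_push (supp w) \<theta> w"
    unfolding max_simplex_push_def by (rule max_push_supp[OF w])
  also have "\<dots> = max_push (supp w) ((\<lambda>p. fst p + snd p) \<circ> (\<lambda>a. (f a, g a))) w"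
    by (rule max_push_cong) (use r(3) A in \<open>auto simp: \<theta>_def\<close>)
  also have "\<dots> = max_push (supp \<omega>) (\<lambda>p. fst p + snd p) \<omega>"
    using max_push_compose[where f = "\<lambda>a. (f a, g a)" and g = "\<lambda>p. fst p + snd p" and w = w,
        OF fin S(2) image_subsetI[OF mem], folded \<omega>]
    by (rule sym)
  finally have "((n, action ?Z n n ?r (x, y), w), canonical_point X Y m x0 m' y0 \<omega>) \<in> max_rel ?Z"
    using step unfolding canonical_point_def by simp
  with max_rel_retract_onto[OF xy w] show ?thesis by (rule coend_rel_trans)
qed

text \<open>Every coupling occurs. On the support of the canonical weights the index functions
  recover both coordinates of a position, so pushing along them amounts to pushing \<omega> along
  the projections.\<close>

lemma canonical_point_coupled:
  assumes X: "is_sset X" and Y: "is_sset Y"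
    and x0: "x0 \<in> simplices X m" "\<not> degenerate X m x0" and y0: "y0 \<in> simplices Y m'" "\<not> degenerate Y m' y0"
    and um: "u \<in> max_simplex m" and u: "\<And>i. i \<le> m \<Longrightarrow> 0 < u i"
    and vm: "v \<in> max_simplex m'" and v: "\<And>i. i \<le> m' \<Longrightarrow> 0 < v i"
    and \<omega>: "\<omega> \<in> tropical_couplings {..m} {..m} {..m'} {..m'} u v"
  shows "canonical_point X Y m x0 m' y0 \<omega> \<in> max_points (sset_prod X Y)"
    and "coupled X Y m x0 u m' y0 v (canonical_point X Y m x0 m' y0 \<omega>) \<omega>"
proof -
  let ?N = "m + m'" and ?plus = "\<lambda>p. fst p + snd p :: nat"
  note S = tropical_couplings_supp[OF \<omega>] and D = tropical_couplingsD[OF \<omega>]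
  have pos: "0 \<le> \<omega> p" for p using D(1)[of "fst p" "snd p"] by simp
  let ?F = "chain_index fst \<omega>" and ?G = "chain_index snd \<omega>"
  note FG = chain_index_operators[OF \<omega>]
  define w where "w = max_push (supp \<omega>) ?plus \<omega>"
  obtain i where i: "u i = 1" using um unfolding max_simplex_def by blast
  have "i \<le> m" using i max_simplexD(3)[OF um] by force
  then obtain j where j: "\<omega> (i, j) = 1" using D(7)[of i] i by auto
  have le1: "\<omega> p \<le> 1" for p
  proof (cases "\<omega> p = 0")
    case False
    then have "\<omega> (fst p, snd p) \<noteq> 0" by simp
    from D(4)[OF this] max_simplexD(2)[OF um, of "fst p"] show ?thesis by simp
  qed simp
  have w: "w \<in> max_simplex ?N" unfolding w_def
  proof (rule max_push_max_simplex)
    show "(i, j) \<in> supp \<omega>" "\<omega> (i, j) = 1" using j by auto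
    show "?plus ` supp \<omega> \<subseteq> {..?N}" using S(1) by (force intro: add_mono)
  qed (use le1 pos S in auto)
  have supp_w: "supp w = ?plus ` supp \<omega>"
  proof -
    have "w j \<noteq> 0 \<longleftrightarrow> j \<in> ?plus ` supp \<omega>" for j
      unfolding w_def max_push_support[OF S(2) pos] image_iff eq_commute[of j] by blast
    then show ?thesis by blast
  qed
  have "(action X ?N m (restrict ?F {..?N}) x0, action Y ?N m' (restrict ?G {..?N}) y0) \<in> simplices (sset_prod X Y) ?N"
    using action_simplices[OF X FG(1) x0(1)] action_simplices[OF Y FG(2) y0(1)] by (simp add: sset_prod_def)
  with w show "canonical_point X Y m x0 m' y0 \<omega> \<in> max_points (sset_prod X Y)"
    unfolding canonical_point_def coend_points_def w_def by simp
  have ci: "?F (?plus p) = fst p" "?G (?plus p) = snd p" if "p \<in> supp \<omega>" for p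
    using chain_index[OF S(2,3) that] by auto
  have u_at: "\<exists>p. \<omega> p = u r \<and> fst p = r" if "r \<le> m" for r using D(7)[of r] that by auto
  have v_at: "\<exists>p. \<omega> p = v c \<and> snd p = c" if "c \<le> m'" for c using D(8)[of c] that by auto
  have img: "h ` supp \<omega> = {..k}"
    if h: "h ` supp \<omega> \<subseteq> {..k}" and at: "\<And>i. i \<le> k \<Longrightarrow> \<exists>p. \<omega> p = r i \<and> h p = i" and r: "\<And>i. i \<le> k \<Longrightarrow> 0 < r i"
    for h :: "nat \<times> nat \<Rightarrow> nat" and k and r :: "nat \<Rightarrow> real"
  proof (rule equalityI[OF h], rule subsetI)
    fix i assume i: "i \<in> {..k}"
    then obtain p where "\<omega> p = r i" "h p = i" using at by blast
    with r[of i] i show "i \<in> h ` supp \<omega>" by force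
  qed
  have fstS: "fst ` supp \<omega> = {..m}" by (rule img[OF _ u_at u]) (use S(1) in auto)
  have sndS: "snd ` supp \<omega> = {..m'}" by (rule img[OF _ v_at v]) (use S(1) in auto)
  have marginal: "max_push (supp \<omega>) h \<omega> = r"
    if r: "r \<in> max_simplex k" and le: "\<And>p. \<omega> p \<noteq> 0 \<Longrightarrow> \<omega> p \<le> r (h p)"
      and at: "\<And>i. i \<le> k \<Longrightarrow> \<exists>p. \<omega> p = r i \<and> h p = i"
    for h :: "nat \<times> nat \<Rightarrow> nat" and k and r :: "nat \<Rightarrow> real"
  proof
    fix i
    show "max_push (supp \<omega>) h \<omega> i = r i"
    proof (rule order_antisym)
      show "max_push (supp \<omega>) h \<omega> i \<le> r i"
        unfolding max_push_le[OF S(2)] using le max_simplexD(1)[OF r] by auto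
      show "r i \<le> max_push (supp \<omega>) h \<omega> i"
      proof (cases "r i = 0")
        case False
        then have "i \<le> k" using max_simplexD(3)[OF r] by blast
        then obtain p where "\<omega> p = r i" "h p = i" using at by blast
        with max_push_ge[OF S(2), of p \<omega> h] False show ?thesis by simp
      qed (simp add: max_push_nonneg[OF S(2)])
    qed
  qed
  have sw: "supp w \<subseteq> {..?N}" by (rule max_simplexD(3)[OF w])
  have ff: "face_factors Z ?N (action Z ?N k (restrict h {..?N}) z) (supp w) k z h"
    if Z: "is_sset Z" and h: "restrict h {..?N} \<in> operators ?N k" "h ` supp w = {..k}" "\<And>s s'. s \<le> s' \<Longrightarrow> h s \<le> h s'"
      and z: "z \<in> simplices Z k" "\<not> degenerate Z k z" for h k z and Z :: "'c sset"
    unfolding face_factors_def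
  proof (intro conjI allI ballI impI)
    show "mono_on (supp w) h" using h(3) by (auto simp: mono_on_def)
    fix l \<beta> assume b: "\<beta> \<in> operators l ?N" "\<beta> ` {..l} \<subseteq> supp w"
    have "compose {..l} (restrict h {..?N}) \<beta> = compose {..l} h \<beta>"
      using operators_app[OF b(1)] by (auto simp: compose_def fun_eq_iff)
    then show "action Z l ?N \<beta> (action Z ?N k (restrict h {..?N}) z) = action Z l k (compose {..l} h \<beta>) z"
      using action_compose[OF Z b(1) h(1) z(1)] by simp
  qed (use h z in auto)
  have imF: "?F ` supp w = {..m}" and imG: "?G ` supp w = {..m'}"
    unfolding supp_w image_image fstS[symmetric] sndS[symmetric] by (rule image_cong; use ci in simp)+
  have push: "max_push (supp w) h w = max_push (supp \<omega>) (h \<circ> ?plus) \<omega>" for h :: "nat \<Rightarrow> 'c"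
    unfolding w_def supp_w[unfolded w_def] by (rule max_push_compose) (use S in auto)
  have "face_factors X ?N (action X ?N m (restrict ?F {..?N}) x0) (supp w) m x0 ?F"
    by (rule ff[OF X FG(1) imF chain_index_mono[OF S(2)] x0])
  moreover have "face_factors Y ?N (action Y ?N m' (restrict ?G {..?N}) y0) (supp w) m' y0 ?G"
    by (rule ff[OF Y FG(2) imG chain_index_mono[OF S(2)] y0])
  moreover have "max_push (supp w) ?F w = u"
  proof -
    have "max_push (supp w) ?F w = max_push (supp \<omega>) fst \<omega>"
      unfolding push by (rule max_push_cong) (use ci in auto)
    also have "\<dots> = u" by (rule marginal[OF um _ u_at]) (use D(4) in auto)
    finally show ?thesis .
  qed
  moreover have "max_push (supp w) ?G w = v"
  proof -
    have "max_push (supp w) ?G w = max_push (supp \<omega>) snd \<omega>"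
      unfolding push by (rule max_push_cong) (use ci in auto)
    also have "\<dots> = v" by (rule marginal[OF vm _ v_at]) (use D(5) in auto)
    finally show ?thesis .
  qed
  moreover have "max_push (supp w) (\<lambda>a. (?F a, ?G a)) w = \<omega>"
  proof -
    have "max_push (supp w) (\<lambda>a. (?F a, ?G a)) w = max_push (supp \<omega>) (\<lambda>p. p) \<omega>"
      unfolding push by (rule max_push_cong) (use ci in auto)
    also have "\<dots> = \<omega>" by (rule max_push_id) (use S pos in auto)
    finally show ?thesis .
  qed
  ultimately show "coupled X Y m x0 u m' y0 v (canonical_point X Y m x0 m' y0 \<omega>) \<omega>"
    unfolding canonical_point_def coupled_iff w_def by blast
qed

section \<open>The realization of the subdivision\<close>

definition chain_weight :: "nat \<Rightarrow> (nat \<Rightarrow> 'i set) \<Rightarrow> (nat \<Rightarrow> real) \<Rightarrow> 'i \<Rightarrow> real" where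
  "chain_weight q s t i = (\<Sum>l | l \<le> q \<and> i \<in> s l. t l)"

abbreviation chains :: "'i set set \<Rightarrow> nat \<Rightarrow> (nat \<Rightarrow> 'i set) set" where
  "chains P q \<equiv> simplices (nerve P (\<subseteq>)) q"

lemma chainsD:
  assumes "s \<in> chains P q"
  shows "l \<le> q \<Longrightarrow> s l \<in> P" "l \<le> k \<Longrightarrow> k \<le> q \<Longrightarrow> s l \<subseteq> s k"
  using assms by (auto simp: nerve_def PiE_iff)

lemma chainsI:
  assumes "\<And>l. l \<le> q \<Longrightarrow> s l \<in> P" "\<And>l k. l \<le> k \<Longrightarrow> k \<le> q \<Longrightarrow> s l \<subseteq> s k"
  shows "restrict s {..q} \<in> chains P q"
  using assms by (auto simp: nerve_def)

lemma standard_simplexD: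
  assumes "t \<in> standard_simplex q"
  shows "0 \<le> t l" "(\<Sum>l\<le>q. t l) = 1" "l > q \<Longrightarrow> t l = 0"
  using assms by (auto simp: standard_simplex_def)

lemma chain_weight_nonneg: "t \<in> standard_simplex q \<Longrightarrow> 0 \<le> chain_weight q s t i"
  unfolding chain_weight_def by (intro sum_nonneg) (simp add: standard_simplexD)

lemma chain_weight_mono:
  assumes "t \<in> standard_simplex q" "\<And>l. l \<le> q \<Longrightarrow> i \<in> s l \<Longrightarrow> j \<in> s' l"
  shows "chain_weight q s t i \<le> chain_weight q s' t j"
  unfolding chain_weight_def by (intro sum_mono2) (use assms standard_simplexD(1) in auto)

lemma chain_weight_le_1: "t \<in> standard_simplex q \<Longrightarrow> chain_weight q s t i \<le> 1"
  using chain_weight_mono[of t q i s i "\<lambda>_. UNIV"] standard_simplexD(2)[of t q]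
  by (simp add: chain_weight_def atMost_def)

lemma chain_weight_eq_1:
  assumes "t \<in> standard_simplex q" "\<And>l. l \<le> q \<Longrightarrow> i \<in> s l"
  shows "chain_weight q s t i = 1"
proof -
  have "{l. l \<le> q \<and> i \<in> s l} = {..q}" using assms(2) by auto
  then show ?thesis unfolding chain_weight_def using standard_simplexD(2)[OF assms(1)] by simp
qed

lemma chain_weight_max_simplex:
  assumes s: "s \<in> simplices (subdivided_simplex n) q" and t: "t \<in> standard_simplex q"
  shows "chain_weight q s t \<in> max_simplex n"
proof -
  have s': "s \<in> chains (nonempty_subsets n) q" using s by (simp add: subdivided_simplex_def)
  have sub: "s l \<subseteq> {..n}" "s l \<noteq> {}" if "l \<le> q" for l
    using chainsD(1)[OF s' that] by (auto simp: nonempty_subsets_def)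
  obtain i where i: "i \<in> s 0" using sub[of 0] by auto
  then have "i \<in> s l" if "l \<le> q" for l using chainsD(2)[OF s', of 0 l] that by auto
  then have one: "chain_weight q s t i = 1" by (rule chain_weight_eq_1[OF t])
  have zero: "chain_weight q s t i = 0" if "i > n" for i
  proof -
    have "{l. l \<le> q \<and> i \<in> s l} = {}" using sub that by force
    then show ?thesis by (simp only: chain_weight_def sum.empty)
  qed
  show ?thesis
    unfolding max_simplex_def mem_Collect_eq
    by (intro conjI allI impI exI[of _ i] chain_weight_nonneg[OF t] chain_weight_le_1[OF t] one zero)
qed

text \<open>Here the sum becomes a maximum. If \<open>l\<close> is least with \<open>j\<close> in
  the image of \<open>s l\<close>, a preimage \<open>i\<close> of \<open>j\<close> in
  \<open>s l\<close> lies in all later sets, so its weight is already the whole weight of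
  \<open>j\<close>.\<close>

lemma chain_weight_image:
  assumes s: "s \<in> simplices (subdivided_simplex m) q" and t: "t \<in> standard_simplex q"
  shows "chain_weight q (subdivided_push q m n \<alpha> s) t = max_simplex_push m n \<alpha> (chain_weight q s t)"
proof
  fix j
  have s': "s \<in> chains (nonempty_subsets m) q" using s by (simp add: subdivided_simplex_def)
  have push: "subdivided_push q m n \<alpha> s l = \<alpha> ` s l" if "l \<le> q" for l
    using that by (simp add: subdivided_push_def nerve_map_def compose_def)
  show "chain_weight q (subdivided_push q m n \<alpha> s) t j = max_simplex_push m n \<alpha> (chain_weight q s t) j"
    (is "?L = ?R")
  proof (rule order_antisym)
    show "?R \<le> ?L"
      unfolding max_simplex_push_def
      by (subst max_push_le) (auto intro!: chain_weight_mono chain_weight_nonneg t simp: push)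
    show "?L \<le> ?R"
    proof (cases "\<exists>l\<le>q. j \<in> \<alpha> ` s l")
      case False
      then have "{l. l \<le> q \<and> j \<in> subdivided_push q m n \<alpha> s l} = {}" by (auto simp: push)
      then have "?L = 0" by (simp only: chain_weight_def sum.empty)
      then show ?thesis unfolding max_simplex_push_def by (simp add: max_push_nonneg)
    next
      case True
      define l where "l = (LEAST l. l \<le> q \<and> j \<in> \<alpha> ` s l)"
      have l: "l \<le> q" "j \<in> \<alpha> ` s l" using LeastI_ex[OF True] by (auto simp: l_def)
      then obtain i where i: "i \<in> s l" "\<alpha> i = j" by auto
      have "i \<le> m" using chainsD(1)[OF s' l(1)] i(1) by (auto simp: nonempty_subsets_def)
      have "?L \<le> chain_weight q s t i"
      proof (rule chain_weight_mono[OF t])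
        fix k assume k: "k \<le> q" "j \<in> subdivided_push q m n \<alpha> s k"
        then have "l \<le> k" unfolding l_def by (intro Least_le) (simp add: push)
        then show "i \<in> s k" using chainsD(2)[OF s' _ k(1)] i(1) by blast
      qed
      also have "\<dots> \<le> ?R"
        using max_push_ge[of "{..m}" i "chain_weight q s t" \<alpha>] \<open>i \<le> m\<close> i(2) by (simp add: max_simplex_push_def)
      finally show ?thesis .
    qed
  qed
qed

text \<open>The sum is grouped by the fibres of \<beta>. Hence the function depends only on the
  point of the realization, not on the chain presenting it.\<close>

lemma chain_weight_reindex:
  assumes b: "\<beta> \<in> operators p q"
  shows "chain_weight p (compose {..p} s \<beta>) t = chain_weight q s (simplex_push p q \<beta> t)"
proof
  fix i
  have "{l. l \<le> p \<and> i \<in> compose {..p} s \<beta> l} = {l. l \<le> p \<and> i \<in> s (\<beta> l)}" by (auto simp: compose_def)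
  then have "chain_weight p (compose {..p} s \<beta>) t i = (\<Sum>l | l \<le> p \<and> i \<in> s (\<beta> l). t l)"
    unfolding chain_weight_def by (simp only:)
  also have "\<dots> = (\<Sum>k | k \<le> q \<and> i \<in> s k. \<Sum>l | (l \<le> p \<and> i \<in> s (\<beta> l)) \<and> \<beta> l = k. t l)"
    by (subst sum.group[symmetric, where T = "{k. k \<le> q \<and> i \<in> s k}" and g = \<beta>])
      (use operators_app[OF b] in auto)
  also have "\<dots> = chain_weight q s (simplex_push p q \<beta> t) i"
    unfolding chain_weight_def simplex_push_def by (intro sum.cong refl arg_cong2[where f = sum]) auto
  finally show "chain_weight p (compose {..p} s \<beta>) t i = chain_weight q s (simplex_push p q \<beta> t) i" .
qed

abbreviation Sd_rel :: "'a sset \<Rightarrow> nat \<Rightarrow> (nat \<times> 'a \<times> (nat \<Rightarrow> nat set)) rel" where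
  "Sd_rel X q \<equiv> coend_rel X (\<lambda>n. simplices (subdivided_simplex n) q) (subdivided_push q)"

abbreviation realization_rel :: "'a sset \<Rightarrow> (nat \<times> 'a \<times> (nat \<Rightarrow> real)) rel" where
  "realization_rel X \<equiv> coend_rel X standard_simplex simplex_push"

text \<open>The realization of \<open>Sd X\<close> is the coend of \<open>X\<close> with the max-plus simplices: a point of a simplex
  \<open>s\<^sub>0 \<subseteq> \<dots> \<subseteq> s\<^sub>q\<close> of the subdivision with barycentric coordinates \<open>t\<close> is the function
  \<open>\<Sum>\<^sub>l t\<^sub>l 1\<^bsub>s\<^sub>l\<^esub>\<close>, whose superlevel sets recover the chain.\<close>

definition max_coordinates ::
  "'a sset \<Rightarrow> nat \<times> (nat \<times> 'a \<times> (nat \<Rightarrow> nat set)) set \<times> (nat \<Rightarrow> real) \<Rightarrow> (nat \<times> 'a \<times> (nat \<Rightarrow> real)) set" where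
  "max_coordinates X = (\<lambda>(q, c, t).
    coend_map X max_simplex max_simplex_push (\<lambda>n x. x) (\<lambda>n s. chain_weight q s t) c)"

lemma max_coordinates:
  assumes t: "t \<in> standard_simplex q"
  shows "max_coordinates X (q, Sd_rel X q `` {(n, x, s)}, t) = max_rel X `` {(n, x, chain_weight q s t)}"
  unfolding max_coordinates_def prod.case
proof (intro coend_map_class coend_step_rel)
  fix n x s n' x' s'
  assume "((n, x, s), (n', x', s')) \<in> coend_step X (\<lambda>n. simplices (subdivided_simplex n) q) (subdivided_push q)"
  then show "((n, x, chain_weight q s t), (n', x', chain_weight q s' t)) \<in> coend_step X max_simplex max_simplex_push"
    using chain_weight_image[OF _ t] chain_weight_max_simplex[OF _ t] by (force simp: coend_step_def)
qed

lemma max_coordinates_invariant: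
  assumes "(p, p') \<in> realization_rel (Sd X)"
  shows "max_coordinates X p = max_coordinates X p'"
proof -
  have "(max_coordinates X p, max_coordinates X p') \<in> Id"
    using assms
  proof (rule coend_rel_induct)
    show "equiv UNIV (Id :: (nat \<times> 'a \<times> (nat \<Rightarrow> real)) set rel)"
      by (auto simp: equiv_def refl_Id sym_Id trans_Id)
    fix p p' assume "(p, p') \<in> coend_step (Sd X) standard_simplex simplex_push"
    then obtain k q \<beta> c t where p: "p = (k, action (Sd X) k q \<beta> c, t)" "p' = (q, c, simplex_push k q \<beta> t)"
      and b: "\<beta> \<in> operators k q" and c: "c \<in> simplices (Sd X) q" and t: "t \<in> standard_simplex k"
      unfolding coend_step_def by blast
    obtain n x s where c': "c = Sd_rel X q `` {(n, x, s)}"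
      using c unfolding Sd_simplices_iff by blast
    have "action (subdivided_simplex n) k q \<beta> s = compose {..k} s \<beta>"
      by (simp add: subdivided_simplex_def nerve_def)
    then have "max_coordinates X p = max_coordinates X p'"
      unfolding p c' Sd_action_class[OF b] max_coordinates[OF t]
        max_coordinates[OF simplex_push_standard_simplex[OF b t]] chain_weight_reindex[OF b, symmetric] by simp
    then show "(max_coordinates X p, max_coordinates X p') \<in> Id" by simp
  qed
  then show ?thesis by simp
qed

section \<open>Recovering a chain from its weight function\<close>

lemma le_chain_weight:
  assumes s: "s \<in> chains P q" and t: "t \<in> standard_simplex q" and "l \<le> q" "i \<in> s l"
  shows "(\<Sum>k=l..q. t k) \<le> chain_weight q s t i"
  unfolding chain_weight_def
  by (intro sum_mono2) (use assms chainsD(2)[OF s] standard_simplexD(1)[OF t] in fastforce)+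

lemma chain_weight_le:
  assumes s: "s \<in> chains P q" and t: "t \<in> standard_simplex q" and "l \<le> q" "i \<notin> s l"
  shows "chain_weight q s t i \<le> (\<Sum>k=Suc l..q. t k)"
  unfolding chain_weight_def
proof (intro sum_mono2)
  show "{k. k \<le> q \<and> i \<in> s k} \<subseteq> {Suc l..q}"
  proof clarify
    fix k assume k: "k \<le> q" "i \<in> s k"
    have "\<not> k \<le> l" using chainsD(2)[OF s, of k l] assms(3,4) k(2) by blast
    with k(1) show "k \<in> {Suc l..q}" by simp
  qed
qed (use standard_simplexD(1)[OF t] in auto)

text \<open>A member of positive weight is the superlevel set of the function at its tail sum
  \<open>T l\<close>. Its partner \<open>l'\<close> in the other chain is the last index whose tail
  sum still reaches \<open>T l\<close>.\<close>

lemma chain_members_determined: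
  assumes s: "s \<in> chains P q" and t: "t \<in> standard_simplex q"
    and s': "s' \<in> chains P q'" and t': "t' \<in> standard_simplex q'"
    and eq: "chain_weight q s t = chain_weight q' s' t'" and l: "l \<le> q" "t l \<noteq> 0"
  shows "\<exists>l'\<le>q'. t' l' \<noteq> 0 \<and> s' l' = s l"
proof -
  define T where "T k = (\<Sum>j=k..q. t j)" for k
  define T' where "T' k = (\<Sum>j=k..q'. t' j)" for k
  have T_Suc: "T l = t l + T (Suc l)" using l(1) by (simp add: T_def sum.atLeast_Suc_atMost)
  have tl: "0 < t l" using l(2) standard_simplexD(1)[OF t, of l] by simp
  have TS: "0 \<le> T (Suc l)" unfolding T_def using standard_simplexD(1)[OF t] by (intro sum_nonneg) auto
  have pos: "0 < t l" "0 \<le> T (Suc l)" "0 < T l" using tl TS T_Suc by auto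
  have le1: "T l \<le> 1"
    unfolding T_def standard_simplexD(2)[OF t, symmetric]
    by (intro sum_mono2) (use standard_simplexD(1)[OF t] in auto)
  have T'0: "T' 0 = 1" using standard_simplexD(2)[OF t'] by (simp add: T'_def atMost_atLeast0)
  define L where "L = {k. k \<le> q' \<and> T l \<le> T' k}"
  have L: "finite L" "0 \<in> L" using T'0 le1 by (auto simp: L_def)
  define l' where "l' = Max L"
  have l': "l' \<le> q'" "T l \<le> T' l'" using Max_in[OF L(1)] L(2) unfolding l'_def[symmetric] by (auto simp: L_def)
  have less: "T' (Suc l') < T l"
  proof (cases "l' = q'")
    case True
    then show ?thesis using pos by (simp add: T'_def)
  next
    case False
    have "Suc l' \<notin> L" using Max_ge[OF L(1), of "Suc l'"] by (auto simp: l'_def)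
    with False l'(1) show ?thesis by (auto simp: L_def)
  qed
  have "T' l' = t' l' + T' (Suc l')" using l'(1) by (simp add: T'_def sum.atLeast_Suc_atMost)
  then have "t' l' \<noteq> 0" using less l'(2) by auto
  moreover have "s' l' = s l"
  proof (intro equalityI subsetI)
    fix i assume i: "i \<in> s' l'"
    show "i \<in> s l"
    proof (rule ccontr)
      assume "i \<notin> s l"
      have "T' l' \<le> chain_weight q s t i" using le_chain_weight[OF s' t' l'(1) i] by (simp add: T'_def eq)
      also have "\<dots> \<le> T (Suc l)" using chain_weight_le[OF s t l(1) \<open>i \<notin> s l\<close>] by (simp add: T_def)
      finally show False using l'(2) T_Suc pos by simp
    qed
  next
    fix i assume i: "i \<in> s l"
    show "i \<in> s' l'"
    proof (rule ccontr)
      assume "i \<notin> s' l'"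
      have "T l \<le> chain_weight q s t i" using le_chain_weight[OF s t l(1) i] by (simp add: T_def)
      also have "\<dots> \<le> T' (Suc l')" using chain_weight_le[OF s' t' l'(1) \<open>i \<notin> s' l'\<close>] by (simp add: T'_def eq)
      finally show False using less by simp
    qed
  qed
  ultimately show ?thesis using l'(1) by blast
qed

text \<open>Chains may repeat a set; this selects one index for each set that carries positive
  weight.\<close>

definition first_occurrences :: "nat \<Rightarrow> (nat \<Rightarrow> 'i set) \<Rightarrow> (nat \<Rightarrow> real) \<Rightarrow> nat set" where
  "first_occurrences q s t = {l. l \<le> q \<and> t l \<noteq> 0 \<and> (\<forall>k<l. t k \<noteq> 0 \<longrightarrow> s k \<noteq> s l)}"

text \<open>Members of weight 0 are retracted away, and \<theta> sends each remaining member of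
  \<open>s\<close> to an equal member of \<open>s'\<close>. Both moves are operators in the nerve,
  so \<Theta> transports the resulting equivalence to \<open>W\<close>.\<close>

lemma chain_weight_normalize:
  assumes W: "is_sset W" and \<Theta>: "sset_map (nerve P (\<subseteq>)) W \<Theta>"
    and s: "s \<in> chains P q" and t: "t \<in> standard_simplex q"
    and s': "s' \<in> chains P q'" and t': "t' \<in> standard_simplex q'"
    and eq: "chain_weight q s t = chain_weight q' s' t'"
  obtains a where "a \<in> standard_simplex q'" "supp a \<subseteq> first_occurrences q' s' t'"
    "chain_weight q' s' a = chain_weight q' s' t'"
    "((q, \<Theta> q s, t), (q', \<Theta> q' s', a)) \<in> realization_rel W"
proof -
  define A where "A = {l. l \<le> q \<and> t l \<noteq> 0}"
  have "A \<noteq> {}"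
  proof
    assume "A = {}"
    then have "(\<Sum>l\<le>q. t l) = 0" by (intro sum.neutral) (auto simp: A_def)
    then show False using standard_simplexD(2)[OF t] by simp
  qed
  then have A: "A \<subseteq> {..q}" "A \<noteq> {}" by (auto simp: A_def)
  note r = retract_onto[OF A]
  let ?r = "retract_onto q A"
  have push_r: "simplex_push q q ?r t = t"
  proof
    fix i
    have "simplex_push q q ?r t i = (\<Sum>j | j \<le> q \<and> ?r j = i. if j = i then t i else 0)"
      unfolding simplex_push_def
    proof (rule sum.cong)
      fix j assume j: "j \<in> {j. j \<le> q \<and> ?r j = i}"
      show "t j = (if j = i then t i else 0)"
      proof (cases "t j = 0")
        case False
        then have "?r j = j" using j r(3)[of j] by (auto simp: A_def)
        with j show ?thesis by auto
      qed (use j in auto)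
    qed simp
    also have "\<dots> = t i"
    proof (cases "t i = 0")
      case False
      then have "i \<le> q" using standard_simplexD(3)[OF t] leI by blast
      with False have "?r i = i" using r(3)[of i] by (auto simp: A_def)
      with \<open>i \<le> q\<close> show ?thesis by simp
    qed simp
    finally show "simplex_push q q ?r t i = t i" .
  qed
  define good where "good l k \<longleftrightarrow> k \<le> q' \<and> t' k \<noteq> 0 \<and> s' k = s (?r l)" for l k
  \<comment> \<open>The least index hits first occurrences and also makes \<theta> monotone: if two
    indices were reversed, the inclusions in both chains would make the members equal.\<close>
  define \<theta> where "\<theta> = (\<lambda>l\<in>{..q}. LEAST k. good l k)"
  have ex: "\<exists>k. good l k" if "l \<le> q" for l
    using chain_members_determined[OF s t s' t' eq, of "?r l"] r(2)[OF that] by (auto simp: good_def A_def)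
  have th: "good l (\<theta> l)" if "l \<le> q" for l
    using LeastI_ex[OF ex[OF that]] that by (simp add: \<theta>_def)
  have th_least: "\<theta> l \<le> k" if "l \<le> q" "good l k" for l k
    using that by (simp add: \<theta>_def Least_le)
  have th_op: "\<theta> \<in> operators q q'"
    unfolding \<theta>_def
  proof (rule operatorsI)
    fix l assume "l \<le> q" with th[OF this] show "(LEAST k. good l k) \<le> q'" by (simp add: \<theta>_def good_def)
  next
    fix l k assume lk: "l \<le> k" "k \<le> q"
    have "\<theta> l \<le> \<theta> k"
    proof (rule ccontr)
      assume "\<not> ?thesis"
      then have less: "\<theta> k < \<theta> l" by simp
      have "?r l \<le> ?r k" "?r k \<le> q" using operators_mono[OF r(1) lk] operators_app[OF r(1) lk(2)] by auto
      then have "s (?r l) \<subseteq> s (?r k)" using chainsD(2)[OF s] by blast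
      moreover have "s' (\<theta> k) \<subseteq> s' (\<theta> l)"
        using chainsD(2)[OF s', of "\<theta> k" "\<theta> l"] less th[of l] lk by (auto simp: good_def)
      ultimately have "good l (\<theta> k)" using th[of l] th[of k] lk by (auto simp: good_def)
      with th_least[of l "\<theta> k"] less lk show False by simp
    qed
    with lk show "(LEAST k. good l k) \<le> (LEAST l. good k l)" by (simp add: \<theta>_def)
  qed
  have comp: "compose {..q} s ?r = compose {..q} s' \<theta>"
    using th by (auto simp: compose_def fun_eq_iff good_def)
  have act: "action (nerve P (\<subseteq>)) q k \<beta> z = compose {..q} z \<beta>" for k \<beta> and z :: "nat \<Rightarrow> 'b set"
    by (simp add: nerve_def)
  have "\<Theta> q (compose {..q} s ?r) = action W q q ?r (\<Theta> q s)"
    using \<Theta> r(1) s unfolding sset_map_def by (metis act)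
  then have 1: "((q, \<Theta> q (compose {..q} s ?r), t), (q, \<Theta> q s, t)) \<in> realization_rel W"
    using coend_step_rel[of "(q, action W q q ?r (\<Theta> q s), t)" "(q, \<Theta> q s, simplex_push q q ?r t)"] r(1) \<Theta> s t
    unfolding push_r by (auto simp: coend_step_def sset_map_def) (metis push_r)
  have "\<Theta> q (compose {..q} s' \<theta>) = action W q q' \<theta> (\<Theta> q' s')"
    using \<Theta> th_op s' unfolding sset_map_def by (metis act)
  then have 2: "((q, \<Theta> q (compose {..q} s ?r), t), (q', \<Theta> q' s', simplex_push q q' \<theta> t)) \<in> realization_rel W"
    unfolding comp
    by (intro coend_step_rel) (use th_op \<Theta> s' t in \<open>auto simp: coend_step_def sset_map_def\<close>)
  show thesis
  proof (rule that)
    show "simplex_push q q' \<theta> t \<in> standard_simplex q'" by (rule simplex_push_standard_simplex[OF th_op t])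
    show "((q, \<Theta> q s, t), (q', \<Theta> q' s', simplex_push q q' \<theta> t)) \<in> realization_rel W"
      by (rule coend_rel_trans[OF coend_rel_sym[OF 1] 2])
    show "chain_weight q' s' (simplex_push q q' \<theta> t) = chain_weight q' s' t'"
      unfolding chain_weight_reindex[OF th_op, symmetric] comp[symmetric] chain_weight_reindex[OF r(1)] push_r
      by (rule eq)
    show "supp (simplex_push q q' \<theta> t) \<subseteq> first_occurrences q' s' t'"
    proof
      fix k assume "k \<in> supp (simplex_push q q' \<theta> t)"
      then have "simplex_push q q' \<theta> t k \<noteq> 0" by simp
      then obtain l where l: "l \<le> q" "\<theta> l = k"
        unfolding simplex_push_def using sum.neutral by (metis (mono_tags, lifting) mem_Collect_eq)
      have "s' j \<noteq> s' k" if "j < k" "t' j \<noteq> 0" for j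
        using th_least[OF l(1), of j] th[OF l(1)] that l(2) by (auto simp: good_def)
      with th[OF l(1)] l(2) show "k \<in> first_occurrences q' s' t'"
        by (auto simp: first_occurrences_def good_def)
    qed
  qed
qed

text \<open>At the largest index \<open>l\<close> of disagreement some vertex of \<open>s l\<close>
  lies in no earlier selected set, and there the functions differ by \<open>a l - b l\<close>.
  Excluding the empty set provides such a vertex when no selected set precedes
  \<open>s l\<close>.\<close>

lemma chain_weight_inject:
  assumes s: "s \<in> chains P q" and P: "{} \<notin> P"
    and a: "supp a \<subseteq> first_occurrences q s t" and b: "supp b \<subseteq> first_occurrences q s t"
    and eq: "chain_weight q s a = chain_weight q s b"
  shows "a = b"
proof (rule ccontr)
  assume "a \<noteq> b"
  let ?L = "first_occurrences q s t"
  define D where "D = {l. a l \<noteq> b l}"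
  have DL: "D \<subseteq> ?L"
  proof
    fix l assume "l \<in> D"
    then have "a l \<noteq> 0 \<or> b l \<noteq> 0" by (auto simp: D_def)
    with a b show "l \<in> ?L" by auto
  qed
  have Lq: "?L \<subseteq> {..q}" by (auto simp: first_occurrences_def)
  have finL: "finite ?L" by (rule finite_subset[OF Lq]) simp
  have fin: "finite D" "finite ?L" using finite_subset[OF DL finL] finL by auto
  have "D \<noteq> {}" using \<open>a \<noteq> b\<close> by (auto simp: D_def)
  define l where "l = Max D"
  have lD: "l \<in> D" using Max_in[OF fin(1) \<open>D \<noteq> {}\<close>] by (simp add: l_def)
  have lq: "l \<le> q" using lD DL Lq by auto
  have "\<exists>i\<in>s l. \<forall>k\<in>?L. k < l \<longrightarrow> i \<notin> s k"
  proof (cases "{k \<in> ?L. k < l} = {}")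
    case True
    have "s l \<noteq> {}" using chainsD(1)[OF s lq] P by auto
    with True show ?thesis by blast
  next
    case False
    define k0 where "k0 = Max {k \<in> ?L. k < l}"
    have k0: "k0 \<in> ?L" "k0 < l" using Max_in[OF _ False] fin(2) by (auto simp: k0_def)
    have "s k0 \<noteq> s l" using lD DL k0 by (auto simp: first_occurrences_def)
    moreover have "s k0 \<subseteq> s l" using chainsD(2)[OF s] k0(2) lq by simp
    ultimately obtain i where i: "i \<in> s l" "i \<notin> s k0" by blast
    have "i \<notin> s k" if "k \<in> ?L" "k < l" for k
    proof -
      have "k \<le> k0" unfolding k0_def using that fin(2) by (intro Max_ge) auto
      then have "s k \<subseteq> s k0" using chainsD(2)[OF s] k0(2) lq by simp
      with i show ?thesis by blast
    qed
    with i show ?thesis by blast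
  qed
  then obtain i where i: "i \<in> s l" "\<And>k. k \<in> ?L \<Longrightarrow> k < l \<Longrightarrow> i \<notin> s k" by blast
  have "(\<Sum>k | k \<le> q \<and> i \<in> s k. a k - b k) = (\<Sum>k | k \<le> q \<and> i \<in> s k. if k = l then a l - b l else 0)"
  proof (rule sum.cong)
    fix k assume k: "k \<in> {k. k \<le> q \<and> i \<in> s k}"
    show "a k - b k = (if k = l then a l - b l else 0)"
    proof (cases "k \<in> D")
      case True
      then have "k \<le> l" using Max_ge[OF fin(1)] by (simp add: l_def)
      with True i(2)[of k] k DL show ?thesis by (auto simp: le_less)
    qed (use lD in \<open>auto simp: D_def\<close>)
  qed simp
  also have "\<dots> = a l - b l" using i(1) lq by simp
  finally have "chain_weight q s a i - chain_weight q s b i = a l - b l"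
    by (simp add: chain_weight_def sum_subtractf)
  then show False using lD eq by (simp add: D_def)
qed

text \<open>Both points are moved to first occurrences of the same chain \<open>s'\<close>, where
  the weights are determined by the function.\<close>

lemma realization_nerve_inject:
  assumes W: "is_sset W" and \<Theta>: "sset_map (nerve P (\<subseteq>)) W \<Theta>" and P: "{} \<notin> P"
    and s: "s \<in> chains P q" and t: "t \<in> standard_simplex q"
    and s': "s' \<in> chains P q'" and t': "t' \<in> standard_simplex q'"
    and eq: "chain_weight q s t = chain_weight q' s' t'"
  shows "((q, \<Theta> q s, t), (q', \<Theta> q' s', t')) \<in> realization_rel W"
proof -
  obtain a where a: "supp a \<subseteq> first_occurrences q' s' t'" "chain_weight q' s' a = chain_weight q' s' t'"
    "((q, \<Theta> q s, t), (q', \<Theta> q' s', a)) \<in> realization_rel W"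
    using chain_weight_normalize[OF W \<Theta> s t s' t' eq] by metis
  obtain b where b: "supp b \<subseteq> first_occurrences q' s' t'" "chain_weight q' s' b = chain_weight q' s' t'"
    "((q', \<Theta> q' s', t'), (q', \<Theta> q' s', b)) \<in> realization_rel W"
    using chain_weight_normalize[OF W \<Theta> s' t' s' t' refl] by metis
  have "a = b" by (rule chain_weight_inject[OF s' P a(1) b(1)]) (simp add: a b)
  with a(3) b(3) show ?thesis using coend_rel_sym coend_rel_trans by metis
qed

text \<open>The levels \<open>v\<close> are the nonzero values of \<open>w\<close> in decreasing
  order, the chain consists of the superlevel sets, and the weights are the successive differences
  of levels.\<close>

lemma chain_weight_exists:
  fixes w :: "'i \<Rightarrow> real"
  assumes w: "finite (range w)" "\<And>i. 0 \<le> w i" "\<And>i. w i \<le> 1" "w i0 = 1"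
  obtains q v t where "t \<in> standard_simplex q" "\<And>l. l \<le> q \<Longrightarrow> 0 < v l \<and> v l \<le> 1"
    "\<And>l k. l \<le> k \<Longrightarrow> k \<le> q \<Longrightarrow> v k \<le> v l" "\<forall>s. (\<forall>l\<le>q. s l = {i. v l \<le> w i}) \<longrightarrow> chain_weight q s t = w"
proof -
  define V where "V = range w - {0}"
  have V: "finite V" "1 \<in> V" "\<And>x. x \<in> V \<Longrightarrow> 0 < x \<and> x \<le> 1"
    using w by (auto simp: V_def less_le image_iff intro: exI[of _ i0])
  define xs where "xs = sorted_list_of_set V"
  have xs: "set xs = V" "sorted_wrt (<) xs" using V(1) by (simp_all add: xs_def)
  have "xs \<noteq> []" using xs(1) V(2) by auto
  define q where "q = length xs - 1"
  have len: "length xs = Suc q" using \<open>xs \<noteq> []\<close> by (simp add: q_def)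
  \<comment> \<open>The increasing list is read backwards; the value 0 at \<open>Suc q\<close> ends
    the telescoping sum and makes \<open>v q\<close> the last weight.\<close>
  define v where "v l = (if l \<le> q then xs ! (q - l) else 0)" for l
  have v_strict: "v k < v l" if "l < k" "k \<le> q" for l k
    using sorted_wrt_nth_less[OF xs(2), of "q - k" "q - l"] that len by (simp add: v_def)
  have v_V: "v l \<in> V" if "l \<le> q" for l
    using nth_mem[of "q - l" xs] xs(1) len that by (simp add: v_def)
  have v_surj: "\<exists>l\<le>q. v l = x" if x: "x \<in> V" for x
  proof -
    obtain j where "j < length xs" "xs ! j = x" using x xs(1) by (metis in_set_conv_nth)
    then show ?thesis using len by (intro exI[of _ "q - j"]) (auto simp: v_def)
  qed
  have v_anti: "v k \<le> v l" if "l \<le> k" "k \<le> q" for l k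
    using v_strict[of l k] that by (cases "l = k") auto
  have v_last: "v (Suc q) = 0" by (simp add: v_def)
  define t where "t l = (if l \<le> q then v l - v (Suc l) else 0)" for l
  have tele: "(\<Sum>l=k..q. t l) = v k" if "k \<le> q" for k
  proof -
    have "(\<Sum>l=k..q. t l) = - (\<Sum>l=k..q. v (Suc l) - v l)"
      unfolding sum_negf[symmetric] by (rule sum.cong) (auto simp: t_def)
    also have "\<dots> = v k" using sum_Suc_diff[of k q v] that v_last by simp
    finally show ?thesis .
  qed
  have t_nonneg: "0 \<le> t l" for l
  proof (cases "l < q")
    case True
    then show ?thesis using v_anti[of l "Suc l"] by (simp add: t_def)
  next
    case False
    then show ?thesis using v_V[of l] V(3) v_last by (cases "l = q") (force simp: t_def)+
  qed
  obtain l1 where "l1 \<le> q" "v l1 = 1" using v_surj[OF V(2)] by blast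
  then have v0: "v 0 = 1" using v_anti[of 0 l1] V(3)[OF v_V[of 0]] by simp
  have sum1: "(\<Sum>l\<le>q. t l) = 1" using tele[of 0] v0 by (simp add: atMost_atLeast0)
  have "t l \<le> 1" for l
  proof (cases "l \<le> q")
    case True
    have "t l \<le> (\<Sum>l\<le>q. t l)" by (rule member_le_sum) (use True t_nonneg in auto)
    then show ?thesis using sum1 by simp
  qed (simp add: t_def)
  then have t: "t \<in> standard_simplex q" using t_nonneg sum1 by (auto simp: standard_simplex_def t_def)
  show thesis
  proof (rule that[OF t _ v_anti])
    show "0 < v l \<and> v l \<le> 1" if "l \<le> q" for l using V(3)[OF v_V[OF that]] .
    show "\<forall>s. (\<forall>l\<le>q. s l = {i. v l \<le> w i}) \<longrightarrow> chain_weight q s t = w"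
    proof (intro allI impI ext)
      fix s :: "nat \<Rightarrow> 'i set" and i assume s: "\<forall>l\<le>q. s l = {i. v l \<le> w i}"
      have set: "{l. l \<le> q \<and> i \<in> s l} = {l. l \<le> q \<and> v l \<le> w i}" using s by auto
      show "chain_weight q s t i = w i"
      proof (cases "w i = 0")
        case True
        have "{l. l \<le> q \<and> v l \<le> w i} = {}" using True V(3)[OF v_V] by force
        then show ?thesis unfolding chain_weight_def set True by (simp only: sum.empty)
      next
        case False
        then have "w i \<in> V" by (auto simp: V_def)
        then obtain k where k: "k \<le> q" "v k = w i" using v_surj by blast
        have "v l \<le> w i \<longleftrightarrow> k \<le> l" if "l \<le> q" for l
          using v_strict[of l k] v_anti[of k l] k that by (cases "k \<le> l") auto
        then have "{l. l \<le> q \<and> v l \<le> w i} = {k..q}" by auto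
        then show ?thesis unfolding chain_weight_def set using tele[OF k(1)] k(2) by simp
      qed
    qed
  qed auto
qed

lemma max_simplex_range: "w \<in> max_simplex n \<Longrightarrow> finite (range w)"
  using max_simplexD(5)[of w n] finite_subset[of "range w" "insert 0 (w ` supp w)"] by auto

text \<open>Two functions are realized on a common chain, since the superlevel sets of both together form a
  chain in the disjoint union of the vertex sets.\<close>

lemma joint_chain_exists:
  assumes w1: "w1 \<in> max_simplex n1" and w2: "w2 \<in> max_simplex n2"
  obtains q s1 s2 t where "s1 \<in> simplices (subdivided_simplex n1) q" "s2 \<in> simplices (subdivided_simplex n2) q"
    "t \<in> standard_simplex q" "chain_weight q s1 t = w1" "chain_weight q s2 t = w2"
proof -
  define ww where "ww = case_sum w1 w2"
  have ww: "ww (Inl i) = w1 i" "ww (Inr i) = w2 i" for i by (simp_all add: ww_def)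
  obtain i1 i2 where i: "w1 i1 = 1" "w2 i2 = 1" using w1 w2 unfolding max_simplex_def by blast
  have "range ww \<subseteq> range w1 \<union> range w2" by (auto simp: ww_def split: sum.splits)
  then have fin: "finite (range ww)" using max_simplex_range[OF w1] max_simplex_range[OF w2] finite_subset by blast
  have b: "0 \<le> ww x" "ww x \<le> 1" for x
    using max_simplexD(1,2)[OF w1] max_simplexD(1,2)[OF w2] by (auto simp: ww_def split: sum.splits)
  obtain q v t where t: "t \<in> standard_simplex q" and v: "\<And>l. l \<le> q \<Longrightarrow> 0 < v l \<and> v l \<le> 1"
    "\<And>l k. l \<le> k \<Longrightarrow> k \<le> q \<Longrightarrow> v k \<le> v l"
    and cw: "\<forall>s. (\<forall>l\<le>q. s l = {i. v l \<le> ww i}) \<longrightarrow> chain_weight q s t = ww"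
  proof -
    have one: "ww (Inl i1) = 1" using i by (simp add: ww)
    show thesis by (rule chain_weight_exists[OF fin b one]) (rule that)
  qed
  define s where "s h l = {i. v l \<le> ww (h i)}" for h :: "nat \<Rightarrow> nat + nat" and l
  have s: "restrict (s h) {..q} \<in> simplices (subdivided_simplex n) q"
    if wh: "\<And>i. ww (h i) = w i" and wn: "w \<in> max_simplex n" for h n w
    unfolding subdivided_simplex_def
  proof (rule chainsI)
    fix l assume l: "l \<le> q"
    obtain i where "w i = 1" using wn unfolding max_simplex_def by blast
    then have "i \<in> s h l" using v(1)[OF l] wh by (simp add: s_def)
    moreover have "s h l \<subseteq> supp w" using v(1)[OF l] wh by (auto simp: s_def)
    ultimately show "s h l \<in> nonempty_subsets n"
      using max_simplexD(3)[OF wn] by (auto simp: nonempty_subsets_def)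
  next
    fix l k assume "l \<le> k" "k \<le> q"
    from v(2)[OF this] show "s h l \<subseteq> s h k" by (auto simp: s_def)
  qed
  have "chain_weight q (restrict (s h) {..q}) t i = ww (h i)" for h i
  proof -
    have "{l. l \<le> q \<and> i \<in> restrict (s h) {..q} l} = {l. l \<le> q \<and> h i \<in> {i. v l \<le> ww i}}"
      by (auto simp: s_def)
    then have "chain_weight q (restrict (s h) {..q}) t i = chain_weight q (\<lambda>l. {i. v l \<le> ww i}) t (h i)"
      by (simp add: chain_weight_def)
    then show ?thesis using cw[rule_format, of "\<lambda>l. {i. v l \<le> ww i}"] by simp
  qed
  then have "chain_weight q (restrict (s Inl) {..q}) t = w1" "chain_weight q (restrict (s Inr) {..q}) t = w2"
    using ww by (simp_all add: fun_eq_iff)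
  then show thesis
    by (rule that[OF s[OF ww(1) w1] s[OF ww(2) w2] t])
qed

section \<open>Pairs of points of the two subdivisions\<close>

lemma sset_map_comp:
  "sset_map X Y f \<Longrightarrow> sset_map Y Z g \<Longrightarrow> sset_map X Z (\<lambda>n x. g n (f n x))"
  by (auto simp: sset_map_def)

lemma sset_map_nerve_map:
  assumes "\<And>S. S \<in> P \<Longrightarrow> h S \<in> Q" "\<And>S T. S \<subseteq> T \<Longrightarrow> h S \<subseteq> h T"
  shows "sset_map (nerve P (\<subseteq>)) (nerve Q (\<subseteq>)) (nerve_map h)"
proof -
  have "nerve_map h q s \<in> chains Q q" if "s \<in> chains P q" for q s
    unfolding nerve_map_def compose_def
    by (rule chainsI) (use chainsD[OF that] assms in auto)
  moreover have "nerve_map h p (action (nerve P (\<subseteq>)) p q \<beta> s) = action (nerve Q (\<subseteq>)) p q \<beta> (nerve_map h q s)"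
    if "\<beta> \<in> operators p q" for p q \<beta> s
    using operators_app[OF that] by (auto simp: nerve_def nerve_map_def compose_def fun_eq_iff)
  ultimately show ?thesis by (simp add: sset_map_def)
qed

text \<open>A pair of chains of nonempty sets is a chain in \<open>P\<close>, the subsets of the
  disjoint union with nonempty traces on both summands, and \<Theta> takes the traces. So
  injectivity for a single nerve settles pairs.\<close>

lemma joint_realization_inject:
  assumes x: "x \<in> simplices X n1" and y: "y \<in> simplices Y n2"
    and s: "s1 \<in> simplices (subdivided_simplex n1) q" "s2 \<in> simplices (subdivided_simplex n2) q" "t \<in> standard_simplex q"
    and s': "s1' \<in> simplices (subdivided_simplex n1) q'" "s2' \<in> simplices (subdivided_simplex n2) q'" "t' \<in> standard_simplex q'"
    and eq: "chain_weight q s1 t = chain_weight q' s1' t'" "chain_weight q s2 t = chain_weight q' s2' t'"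
  shows "((q, (Sd_rel X q `` {(n1, x, s1)}, Sd_rel Y q `` {(n2, y, s2)}), t),
    (q', (Sd_rel X q' `` {(n1, x, s1')}, Sd_rel Y q' `` {(n2, y, s2')}), t')) \<in> realization_rel (sset_prod (Sd X) (Sd Y))"
proof -
  define P :: "(nat + nat) set set" where
    "P = {S. Inl -` S \<in> nonempty_subsets n1 \<and> Inr -` S \<in> nonempty_subsets n2}"
  define \<Theta> where "\<Theta> q S = (Sd_rel X q `` {(n1, x, nerve_map (vimage Inl) q S)},
    Sd_rel Y q `` {(n2, y, nerve_map (vimage Inr) q S)})" for q and S :: "nat \<Rightarrow> (nat + nat) set"
  have "sset_map (nerve P (\<subseteq>)) (subdivided_simplex n1) (nerve_map (vimage Inl))"
    "sset_map (nerve P (\<subseteq>)) (subdivided_simplex n2) (nerve_map (vimage Inr))"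
    unfolding subdivided_simplex_def by (rule sset_map_nerve_map; auto simp: P_def)+
  from sset_map_pair[OF sset_map_comp[OF this(1) Sd_cocone[OF x]] sset_map_comp[OF this(2) Sd_cocone[OF y]]]
  have \<Theta>: "sset_map (nerve P (\<subseteq>)) (sset_prod (Sd X) (Sd Y)) \<Theta>"
    by (simp add: \<Theta>_def[abs_def])
  have W: "is_sset (sset_prod (Sd X) (Sd Y))" by (intro is_sset_prod is_sset_Sd)
  have P: "{} \<notin> P" by (auto simp: P_def nonempty_subsets_def)
  define J where "J q s1 s2 = (\<lambda>l\<in>{..q}. Inl ` s1 l \<union> Inr ` s2 l)" for q :: nat and s1 s2 :: "nat \<Rightarrow> nat set"
  have JP: "J q s1 s2 \<in> chains P q"
    and J1: "nerve_map (vimage Inl) q (J q s1 s2) = s1" and J2: "nerve_map (vimage Inr) q (J q s1 s2) = s2"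
    if s: "s1 \<in> simplices (subdivided_simplex n1) q" "s2 \<in> simplices (subdivided_simplex n2) q" for q s1 s2
  proof -
    have c: "s1 \<in> chains (nonempty_subsets n1) q" "s2 \<in> chains (nonempty_subsets n2) q"
      using s by (simp_all add: subdivided_simplex_def)
    have v: "Inl -` (Inl ` A \<union> Inr ` B) = A" "Inr -` (Inl ` A \<union> Inr ` B) = B" for A B :: "nat set" by auto
    show "J q s1 s2 \<in> chains P q"
      unfolding J_def
    proof (rule chainsI)
      show "Inl ` s1 l \<union> Inr ` s2 l \<in> P" if "l \<le> q" for l
        using chainsD(1)[OF c(1) that] chainsD(1)[OF c(2) that] by (simp only: P_def mem_Collect_eq v)
      show "Inl ` s1 l \<union> Inr ` s2 l \<subseteq> Inl ` s1 k \<union> Inr ` s2 k" if "l \<le> k" "k \<le> q" for l k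
        using chainsD(2)[OF c(1) that] chainsD(2)[OF c(2) that] by blast
    qed
    have ext: "s1 \<in> extensional {..q}" "s2 \<in> extensional {..q}" using c by (auto simp: nerve_def PiE_iff)
    show "nerve_map (vimage Inl) q (J q s1 s2) = s1" "nerve_map (vimage Inr) q (J q s1 s2) = s2"
      by (rule extensionalityI[OF _ ext(1)] extensionalityI[OF _ ext(2)];
          simp only: nerve_map_def compose_def J_def restrict_extensional restrict_apply v if_True atMost_iff)+
  qed
  have cw: "chain_weight q (J q s1 s2) t = case_sum (chain_weight q s1 t) (chain_weight q s2 t)" for q s1 s2 t
  proof
    fix z
    show "chain_weight q (J q s1 s2) t z = case_sum (chain_weight q s1 t) (chain_weight q s2 t) z"
      by (cases z) (auto simp: chain_weight_def J_def intro!: sum.cong)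
  qed
  have "((q, \<Theta> q (J q s1 s2), t), (q', \<Theta> q' (J q' s1' s2'), t')) \<in> realization_rel (sset_prod (Sd X) (Sd Y))"
    by (rule realization_nerve_inject[OF W \<Theta> P JP[OF s(1,2)] s(3) JP[OF s'(1,2)] s'(3)]) (simp add: cw eq)
  then show ?thesis
    unfolding \<Theta>_def J1[OF s(1,2)] J2[OF s(1,2)] J1[OF s'(1,2)] J2[OF s'(1,2)] .
qed

text \<open>The points of the realization represented by a pair; by the injectivity above they form one class.\<close>

definition realize_pair where
  "realize_pair X Y = (\<lambda>(n1, x, w1) (n2, y, w2). {z. \<exists>q s1 s2 t. s1 \<in> simplices (subdivided_simplex n1) q \<and>
    s2 \<in> simplices (subdivided_simplex n2) q \<and> t \<in> standard_simplex q \<and>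
    chain_weight q s1 t = w1 \<and> chain_weight q s2 t = w2 \<and>
    ((q, (Sd_rel X q `` {(n1, x, s1)}, Sd_rel Y q `` {(n2, y, s2)}), t), z)
      \<in> realization_rel (sset_prod (Sd X) (Sd Y))})"

lemma realize_pair:
  assumes "x \<in> simplices X n1" "y \<in> simplices Y n2" "s1 \<in> simplices (subdivided_simplex n1) q"
    "s2 \<in> simplices (subdivided_simplex n2) q" "t \<in> standard_simplex q"
  shows "realize_pair X Y (n1, x, chain_weight q s1 t) (n2, y, chain_weight q s2 t)
    = realization_rel (sset_prod (Sd X) (Sd Y)) ``
      {(q, (Sd_rel X q `` {(n1, x, s1)}, Sd_rel Y q `` {(n2, y, s2)}), t)}" (is "?L = ?R")
proof (intro equalityI subsetI)
  fix z assume "z \<in> ?L"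
  then obtain q' s1' s2' t' where *: "s1' \<in> simplices (subdivided_simplex n1) q'"
    "s2' \<in> simplices (subdivided_simplex n2) q'" "t' \<in> standard_simplex q'"
    "chain_weight q' s1' t' = chain_weight q s1 t" "chain_weight q' s2' t' = chain_weight q s2 t"
    "((q', (Sd_rel X q' `` {(n1, x, s1')}, Sd_rel Y q' `` {(n2, y, s2')}), t'), z)
      \<in> realization_rel (sset_prod (Sd X) (Sd Y))"
    unfolding realize_pair_def prod.case by blast
  from coend_rel_trans[OF joint_realization_inject[OF assms *(1-3) *(4,5)[symmetric]] *(6)]
  show "z \<in> ?R" by simp
qed (use assms in \<open>auto simp: realize_pair_def\<close>)

text \<open>The two weights of a generating step's source and of \<open>p2\<close> are realized on a
  common chain; the step pushes its first component forward, which is an identification already made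
  in \<open>Sd X\<close>.\<close>

lemma realize_pair_invariant_left:
  assumes X: "is_sset X" and r: "(p, p') \<in> max_rel X" and p2: "p2 \<in> max_points Y"
  shows "realize_pair X Y p p2 = realize_pair X Y p' p2"
proof -
  obtain n2 y w2 where p2': "p2 = (n2, y, w2)" and y: "y \<in> simplices Y n2" and w2: "w2 \<in> max_simplex n2"
    using p2 unfolding coend_points_def by auto
  have "(p, p') \<in> {(p, p'). realize_pair X Y p p2 = realize_pair X Y p' p2}"
  proof (rule coend_rel_induct[OF r equiv_kernel, where h = "\<lambda>p. p"])
    fix p p' assume "(p, p') \<in> coend_step X max_simplex max_simplex_push"
    then obtain k n \<alpha> x w where p: "p = (k, action X k n \<alpha> x, w)" "p' = (n, x, max_simplex_push k n \<alpha> w)"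
      and a: "\<alpha> \<in> operators k n" "x \<in> simplices X n" and w: "w \<in> max_simplex k"
      unfolding coend_step_def by blast
    obtain q s s2 t where s: "s \<in> simplices (subdivided_simplex k) q" and s2: "s2 \<in> simplices (subdivided_simplex n2) q"
      and t: "t \<in> standard_simplex q" and cw: "chain_weight q s t = w" and cw2: "chain_weight q s2 t = w2"
      using joint_chain_exists[OF w w2] by metis
    have push: "subdivided_push q k n \<alpha> s \<in> simplices (subdivided_simplex n) q"
      using sset_map_subdivided_push[OF a(1)] s by (simp add: sset_map_def)
    have "realize_pair X Y p p2 = realize_pair X Y p' p2"
      unfolding p p2' cw[symmetric] cw2[symmetric] chain_weight_image[OF s t, symmetric]
        realize_pair[OF action_simplices[OF X a] y s s2 t] realize_pair[OF a(2) y push s2 t]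
        Sd_cocone_natural[OF a s] ..
    then show "(p, p') \<in> {(p, p'). realize_pair X Y p p2 = realize_pair X Y p' p2}" by simp
  qed
  then show ?thesis by simp
qed

lemma realize_pair_invariant_right:
  assumes Y: "is_sset Y" and r: "(p, p') \<in> max_rel Y" and p1: "p1 \<in> max_points X"
  shows "realize_pair X Y p1 p = realize_pair X Y p1 p'"
proof -
  obtain n1 x w1 where p1': "p1 = (n1, x, w1)" and x: "x \<in> simplices X n1" and w1: "w1 \<in> max_simplex n1"
    using p1 unfolding coend_points_def by auto
  have "(p, p') \<in> {(p, p'). realize_pair X Y p1 p = realize_pair X Y p1 p'}"
  proof (rule coend_rel_induct[OF r equiv_kernel, where h = "\<lambda>p. p"])
    fix p p' assume "(p, p') \<in> coend_step Y max_simplex max_simplex_push"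
    then obtain k n \<alpha> y w where p: "p = (k, action Y k n \<alpha> y, w)" "p' = (n, y, max_simplex_push k n \<alpha> w)"
      and a: "\<alpha> \<in> operators k n" "y \<in> simplices Y n" and w: "w \<in> max_simplex k"
      unfolding coend_step_def by blast
    obtain q s s1 t where s: "s \<in> simplices (subdivided_simplex k) q" and s1: "s1 \<in> simplices (subdivided_simplex n1) q"
      and t: "t \<in> standard_simplex q" and cw: "chain_weight q s t = w" and cw1: "chain_weight q s1 t = w1"
      using joint_chain_exists[OF w w1] by metis
    have push: "subdivided_push q k n \<alpha> s \<in> simplices (subdivided_simplex n) q"
      using sset_map_subdivided_push[OF a(1)] s by (simp add: sset_map_def)
    have "realize_pair X Y p1 p = realize_pair X Y p1 p'"
      unfolding p p1' cw[symmetric] cw1[symmetric] chain_weight_image[OF s t, symmetric]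
        realize_pair[OF x action_simplices[OF Y a] s1 s t] realize_pair[OF x a(2) s1 push t]
        Sd_cocone_natural[OF a s] ..
    then show "(p, p') \<in> {(p, p'). realize_pair X Y p1 p = realize_pair X Y p1 p'}" by simp
  qed
  then show ?thesis by simp
qed

lemma coend_rel_eq_iff: "coend_rel X T F `` {p} = coend_rel X T F `` {p'} \<longleftrightarrow> (p, p') \<in> coend_rel X T F"
  using eq_equiv_class_iff[OF equiv_coend_rel, of p p'] by simp

lemma Sd_simplexE:
  assumes "c \<in> simplices (Sd X) q"
  obtains n x s where "c = Sd_rel X q `` {(n, x, s)}" "x \<in> simplices X n" "s \<in> simplices (subdivided_simplex n) q"
  using assms unfolding Sd_simplices_iff by blast

text \<open>Replaces the comparison of the realization of a product with the product of
  realizations: the two max-plus classes separate points. In the converse direction one argument is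
  moved at a time.\<close>

lemma max_coordinates_pair:
  assumes X: "is_sset X" and Y: "is_sset Y"
    and c: "c \<in> simplices (Sd X) q" and d: "d \<in> simplices (Sd Y) q" and t: "t \<in> standard_simplex q"
    and c': "c' \<in> simplices (Sd X) q'" and d': "d' \<in> simplices (Sd Y) q'" and t': "t' \<in> standard_simplex q'"
  shows "((q, (c, d), t), (q', (c', d'), t')) \<in> realization_rel (sset_prod (Sd X) (Sd Y)) \<longleftrightarrow>
    max_coordinates X (q, c, t) = max_coordinates X (q', c', t') \<and>
    max_coordinates Y (q, d, t) = max_coordinates Y (q', d', t')" (is "?L \<longleftrightarrow> ?R")
proof
  define h where "h = (\<lambda>(q, (c, d), t). (max_coordinates X (q, c, t), max_coordinates Y (q, d, t)))"
  assume ?L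
  then have "(h (q, (c, d), t), h (q', (c', d'), t')) \<in> Id"
  proof (rule coend_rel_induct)
    show "equiv UNIV (Id :: ((nat \<times> 'a \<times> (nat \<Rightarrow> real)) set \<times> (nat \<times> 'b \<times> (nat \<Rightarrow> real)) set) rel)"
      by (auto simp: equiv_def refl_Id sym_Id trans_Id)
    fix p p' assume "(p, p') \<in> coend_step (sset_prod (Sd X) (Sd Y)) standard_simplex simplex_push"
    then obtain k q \<beta> c d t where p: "p = (k, (action (Sd X) k q \<beta> c, action (Sd Y) k q \<beta> d), t)"
      "p' = (q, (c, d), simplex_push k q \<beta> t)" and *: "\<beta> \<in> operators k q" "c \<in> simplices (Sd X) q"
      "d \<in> simplices (Sd Y) q" "t \<in> standard_simplex k"
      unfolding coend_step_def sset_prod_def by auto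
    have "((k, action (Sd X) k q \<beta> c, t), (q, c, simplex_push k q \<beta> t)) \<in> realization_rel (Sd X)"
      "((k, action (Sd Y) k q \<beta> d, t), (q, d, simplex_push k q \<beta> t)) \<in> realization_rel (Sd Y)"
      by (rule coend_step_rel, use * in \<open>auto simp: coend_step_def\<close>)+
    from max_coordinates_invariant[OF this(1)] max_coordinates_invariant[OF this(2)]
    show "(h p, h p') \<in> Id" by (simp add: p h_def)
  qed
  then show ?R by (simp add: h_def)
next
  assume R: ?R
  obtain n x s where 1: "c = Sd_rel X q `` {(n, x, s)}" "x \<in> simplices X n" "s \<in> simplices (subdivided_simplex n) q"
    by (rule Sd_simplexE[OF c])
  obtain n' x' s' where 2: "c' = Sd_rel X q' `` {(n', x', s')}" "x' \<in> simplices X n'" "s' \<in> simplices (subdivided_simplex n') q'"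
    by (rule Sd_simplexE[OF c'])
  obtain k y r where 3: "d = Sd_rel Y q `` {(k, y, r)}" "y \<in> simplices Y k" "r \<in> simplices (subdivided_simplex k) q"
    by (rule Sd_simplexE[OF d])
  obtain k' y' r' where 4: "d' = Sd_rel Y q' `` {(k', y', r')}" "y' \<in> simplices Y k'" "r' \<in> simplices (subdivided_simplex k') q'"
    by (rule Sd_simplexE[OF d'])
  have rX: "((n, x, chain_weight q s t), (n', x', chain_weight q' s' t')) \<in> max_rel X"
    using R unfolding 1(1) 2(1) max_coordinates[OF t] max_coordinates[OF t'] coend_rel_eq_iff by blast
  have rY: "((k, y, chain_weight q r t), (k', y', chain_weight q' r' t')) \<in> max_rel Y"
    using R unfolding 3(1) 4(1) max_coordinates[OF t] max_coordinates[OF t'] coend_rel_eq_iff by blast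
  have mem: "(k, y, chain_weight q r t) \<in> max_points Y" "(n', x', chain_weight q' s' t') \<in> max_points X"
    using 2 3 chain_weight_max_simplex t t' by (auto simp: coend_points_def)
  have "realize_pair X Y (n, x, chain_weight q s t) (k, y, chain_weight q r t)
    = realize_pair X Y (n', x', chain_weight q' s' t') (k', y', chain_weight q' r' t')"
    by (rule trans[OF realize_pair_invariant_left[OF X rX mem(1)] realize_pair_invariant_right[OF Y rY mem(2)]])
  then show ?L
    unfolding realize_pair[OF 1(2) 3(2) 1(3) 3(3) t] realize_pair[OF 2(2) 4(2) 2(3) 4(3) t']
      coend_rel_eq_iff 1(1) 2(1) 3(1) 4(1) .
qed

text \<open>The case of a diagonal pair, projected to one factor.\<close>

lemma max_coordinates_inject:
  assumes X: "is_sset X" and c: "c \<in> simplices (Sd X) q" "t \<in> standard_simplex q"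
    and c': "c' \<in> simplices (Sd X) q'" "t' \<in> standard_simplex q'"
    and eq: "max_coordinates X (q, c, t) = max_coordinates X (q', c', t')"
  shows "((q, c, t), (q', c', t')) \<in> realization_rel (Sd X)"
proof -
  have "((q, (c, c), t), (q', (c', c'), t')) \<in> realization_rel (sset_prod (Sd X) (Sd X))"
    using max_coordinates_pair[OF X X c(1) c(1) c(2) c'(1) c'(1) c'(2)] eq by simp
  from coend_rel_sset_map[OF sset_map_fst this] show ?thesis by simp
qed

section \<open>Finiteness and the fibres\<close>

lemma finite_operators: "finite (operators m n)"
  by (rule finite_subset[of _ "{..m} \<rightarrow>\<^sub>E {..n}"]) (auto simp: operators_def intro!: finite_PiE)

text \<open>If the sum of the two Eilenberg-Zilber surjections repeats a value at neighbours, both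
  do so there and the pair is degenerate. This bounds the dimension of nondegenerate pairs by
  \<open>m + m'\<close>.\<close>

lemma finite_sset_prod:
  assumes "finite_sset X" "finite_sset Y"
  shows "finite_sset (sset_prod X Y)"
proof -
  have X: "is_sset X" and Y: "is_sset Y"
    and fin: "finite {(n, x). x \<in> simplices X n \<and> \<not> degenerate X n x}" (is "finite ?NX")
      "finite {(n, y). y \<in> simplices Y n \<and> \<not> degenerate Y n y}" (is "finite ?NY")
    using assms by (auto simp: finite_sset_def)
  let ?Z = "sset_prod X Y"
  define F where "F = (\<lambda>((m, x), (m', y)). \<Union>n\<le>m + m'. (\<lambda>(\<sigma>, \<tau>). (n, (action X n m \<sigma> x, action Y n m' \<tau> y))) `
    (operators n m \<times> operators n m'))"
  have "finite (\<Union>p\<in>?NX \<times> ?NY. F p)"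
    using fin by (intro finite_UN_I finite_cartesian_product)
      (auto simp: F_def finite_operators intro!: finite_imageI finite_cartesian_product)
  moreover have "{(n, z). z \<in> simplices ?Z n \<and> \<not> degenerate ?Z n z} \<subseteq> (\<Union>p\<in>?NX \<times> ?NY. F p)"
  proof clarify
    fix n x y assume z: "(x, y) \<in> simplices ?Z n" "\<not> degenerate ?Z n (x, y)"
    then have x: "x \<in> simplices X n" and y: "y \<in> simplices Y n" by (auto simp: sset_prod_def)
    obtain m \<sigma> x0 where s: "\<sigma> \<in> operators n m" "x0 \<in> simplices X m" "\<not> degenerate X m x0" "x = action X n m \<sigma> x0"
      using Eilenberg_Zilber_exists[OF X x] by metis
    obtain m' \<tau> y0 where t: "\<tau> \<in> operators n m'" "y0 \<in> simplices Y m'" "\<not> degenerate Y m' y0" "y = action Y n m' \<tau> y0"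
      using Eilenberg_Zilber_exists[OF Y y] by metis
    define \<rho> where "\<rho> = (\<lambda>l\<in>{..n}. \<sigma> l + \<tau> l)"
    have r: "\<rho> \<in> operators n (m + m')"
      unfolding \<rho>_def by (rule operatorsI)
        (use operators_app[OF s(1)] operators_app[OF t(1)] operators_mono[OF s(1)] operators_mono[OF t(1)]
          in \<open>auto intro!: add_mono\<close>)
    have "inj_on \<rho> {..n}"
    proof (rule ccontr)
      assume "\<not> inj_on \<rho> {..n}"
      then obtain i where i: "i < n" "\<rho> i = \<rho> (Suc i)" using operators_not_inj[OF r] by metis
      have "\<sigma> i \<le> \<sigma> (Suc i)" "\<tau> i \<le> \<tau> (Suc i)"
        using operators_mono[OF s(1), of i "Suc i"] operators_mono[OF t(1), of i "Suc i"] i(1) by auto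
      with i have eq: "\<sigma> i = \<sigma> (Suc i)" "\<tau> i = \<tau> (Suc i)" by (auto simp: \<rho>_def)
      have "action ?Z n n (glue n i) (x, y) = (x, y)"
        using action_glue[OF X s(1,2) eq(1)] action_glue[OF Y t(1,2) eq(2)] s(4) t(4)
        by (simp add: sset_prod_def)
      then show False using degenerate_glue[OF is_sset_prod[OF X Y] z(1) i(1)] z(2) by simp
    qed
    then have "n \<le> m + m'" by (rule operators_inj_le[OF r])
    then have "(n, (x, y)) \<in> F ((m, x0), (m', y0))"
      unfolding F_def using s t by auto
    then show "(n, x, y) \<in> (\<Union>p\<in>?NX \<times> ?NY. F p)" using s t by blast
  qed
  ultimately show ?thesis
    unfolding finite_sset_def using is_sset_prod[OF X Y] finite_subset by blast
qed

lemma Sd_normal: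
  assumes X: "is_sset X" and c: "c \<in> simplices (Sd X) q"
  obtains m x s where "x \<in> simplices X m" "\<not> degenerate X m x" "s \<in> simplices (subdivided_simplex m) q"
    "c = Sd_rel X q `` {(m, x, s)}"
proof -
  obtain n y r where *: "c = Sd_rel X q `` {(n, y, r)}" "y \<in> simplices X n" "r \<in> simplices (subdivided_simplex n) q"
    by (rule Sd_simplexE[OF c])
  obtain m \<sigma> x where s: "\<sigma> \<in> operators n m" "x \<in> simplices X m" "\<not> degenerate X m x" "y = action X n m \<sigma> x"
    using Eilenberg_Zilber_exists[OF X *(2)] by metis
  have "subdivided_push q n m \<sigma> r \<in> simplices (subdivided_simplex m) q"
    using sset_map_subdivided_push[OF s(1)] *(3) by (simp add: sset_map_def)
  moreover have "c = Sd_rel X q `` {(m, x, subdivided_push q n m \<sigma> r)}"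
    unfolding *(1) s(4) by (rule Sd_cocone_natural[OF s(1,2) *(3)])
  ultimately show thesis using that s by blast
qed

text \<open>Cardinality minus 1 is an operator from [q] to [m]. Where it repeats a value, the chain
  repeats a set and the simplex is degenerate; otherwise it is injective and
  \<open>q \<le> m\<close>.\<close>

lemma finite_sset_Sd:
  assumes "finite_sset X"
  shows "finite_sset (Sd X)"
proof -
  have X: "is_sset X" and fin: "finite {(n, x). x \<in> simplices X n \<and> \<not> degenerate X n x}" (is "finite ?N")
    using assms by (auto simp: finite_sset_def)
  define F where "F = (\<lambda>(m, x). \<Union>q\<le>m. (\<lambda>s. (q, Sd_rel X q `` {(m, x, s)})) ` simplices (subdivided_simplex m) q)"
  have finT: "finite (simplices (subdivided_simplex m) q)" for m q
  proof (rule finite_subset)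
    show "simplices (subdivided_simplex m) q \<subseteq> {..q} \<rightarrow>\<^sub>E Pow {..m}"
    proof -
      have "{..q} \<rightarrow>\<^sub>E nonempty_subsets m \<subseteq> {..q} \<rightarrow>\<^sub>E Pow {..m}"
        by (rule PiE_mono) (auto simp: nonempty_subsets_def)
      then show ?thesis unfolding subdivided_simplex_def nerve_def by (simp add: subset_iff)
    qed
  qed (auto intro!: finite_PiE)
  have "finite (\<Union>p\<in>?N. F p)"
    using fin by (intro finite_UN_I) (auto simp: F_def finT)
  moreover have "{(q, c). c \<in> simplices (Sd X) q \<and> \<not> degenerate (Sd X) q c} \<subseteq> (\<Union>p\<in>?N. F p)"
  proof clarify
    fix q c assume c: "c \<in> simplices (Sd X) q" "\<not> degenerate (Sd X) q c"
    obtain m x s where x: "x \<in> simplices X m" "\<not> degenerate X m x" and s: "s \<in> simplices (subdivided_simplex m) q"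
      and c': "c = Sd_rel X q `` {(m, x, s)}" by (rule Sd_normal[OF X c(1)])
    have ch: "s \<in> chains (nonempty_subsets m) q" using s by (simp add: subdivided_simplex_def)
    have sub: "s l \<subseteq> {..m}" "s l \<noteq> {}" "finite (s l)" if "l \<le> q" for l
      using chainsD(1)[OF ch that] finite_subset[of "s l" "{..m}"] by (auto simp: nonempty_subsets_def)
    define \<rho> where "\<rho> = (\<lambda>l\<in>{..q}. card (s l) - 1)"
    have r: "\<rho> \<in> operators q m"
      unfolding \<rho>_def
    proof (rule operatorsI)
      fix l assume "l \<le> q"
      from card_mono[OF _ sub(1)[OF this]] show "card (s l) - 1 \<le> m" by simp
    next
      fix l k assume "l \<le> k" "k \<le> q"
      from card_mono[OF sub(3)[OF this(2)] chainsD(2)[OF ch this]] show "card (s l) - 1 \<le> card (s k) - 1" by simp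
    qed
    have "inj_on \<rho> {..q}"
    proof (rule ccontr)
      assume "\<not> inj_on \<rho> {..q}"
      then obtain i where i: "i < q" "\<rho> i = \<rho> (Suc i)" using operators_not_inj[OF r] by metis
      have "card (s i) > 0" "card (s (Suc i)) > 0" using sub[of i] sub[of "Suc i"] i(1) by (auto simp: card_gt_0_iff)
      with i have "card (s i) = card (s (Suc i))" by (simp add: \<rho>_def)
      then have eq: "s i = s (Suc i)"
        using card_subset_eq[OF sub(3)[of "Suc i"] chainsD(2)[OF ch, of i "Suc i"]] i(1) by simp
      have "s \<in> {..q} \<rightarrow>\<^sub>E nonempty_subsets m" using ch by (simp add: nerve_def)
      then have "s l = undefined" if "\<not> l \<le> q" for l using PiE_arb[of s _ _ l] that by simp
      then have "compose {..q} s (glue q i) = s"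
        using eq by (auto simp: compose_def glue_def fun_eq_iff)
      then have "action (Sd X) q q (glue q i) c = c"
        unfolding c' Sd_action_class[OF glue_operators] by (simp add: subdivided_simplex_def nerve_def)
      then show False using degenerate_glue[OF is_sset_Sd c(1) i(1)] c(2) by simp
    qed
    then have "q \<le> m" by (rule operators_inj_le[OF r])
    then have "(q, c) \<in> F (m, x)" unfolding F_def using s c' by auto
    then show "(q, c) \<in> (\<Union>p\<in>?N. F p)" using x by blast
  qed
  ultimately show ?thesis unfolding finite_sset_def using is_sset_Sd finite_subset by blast
qed

section \<open>Topology of the realization\<close>

lemma topspace_simplex_space [simp]: "topspace (simplex_space q) = standard_simplex q"
  by (simp add: simplex_space_def)

lemma compact_space_simplex_space: "compact_space (simplex_space q)"
  unfolding simplex_space_def by (rule compact_space_subtopology[OF compactin_standard_simplex])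

abbreviation realization_point :: "'a sset \<Rightarrow> nat \<times> 'a \<times> (nat \<Rightarrow> real) \<Rightarrow> (nat \<times> 'a \<times> (nat \<Rightarrow> real)) set" where
  "realization_point X p \<equiv> realization_rel X `` {p}"

lemma continuous_map_realization_point:
  assumes "c \<in> simplices X q"
  shows "continuous_map (simplex_space q) (realization X) (\<lambda>t. realization_point X (q, c, t))"
proof -
  have "continuous_map (simplex_space q) (realization_sum X) ((\<lambda>x. (q, x)) \<circ> (\<lambda>t. (c, t)))"
    unfolding realization_sum_def
    by (rule continuous_map_compose[OF _ continuous_map_component_injection])
      (use assms in \<open>auto intro!: continuous_map_pairedI\<close>)
  from continuous_map_compose[OF this quotient_imp_continuous_map[OF quotient_map_realization]]
  show ?thesis by (simp add: comp_def)
qed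

text \<open>By Eilenberg-Zilber the images of the finitely many nondegenerate simplices cover the
  realization.\<close>

lemma compact_space_realization:
  assumes "finite_sset X"
  shows "compact_space (realization X)"
proof -
  have X: "is_sset X" and fin: "finite {(n, x). x \<in> simplices X n \<and> \<not> degenerate X n x}" (is "finite ?N")
    using assms by (auto simp: finite_sset_def)
  define K where "K = (\<lambda>(m, y). (\<lambda>t. realization_point X (m, y, t)) ` standard_simplex m)"
  have "compactin (realization X) (K p)" if pN: "p \<in> ?N" for p
  proof -
    obtain m y where p: "p = (m, y)" "y \<in> simplices X m" using pN by blast
    have "compactin (simplex_space m) (standard_simplex m)"
      using compact_space_simplex_space[of m] by (simp add: compact_space_def)
    from image_compactin[OF this continuous_map_realization_point[OF p(2)]] show ?thesis
      by (simp add: p K_def)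
  qed
  then have "compactin (realization X) (\<Union>(K ` ?N))" using fin by (intro compactin_Union) auto
  moreover have "\<Union>(K ` ?N) = topspace (realization X)"
  proof
    show "\<Union>(K ` ?N) \<subseteq> topspace (realization X)" using calculation compactin_subset_topspace by blast
    show "topspace (realization X) \<subseteq> \<Union>(K ` ?N)"
    proof
      fix a assume "a \<in> topspace (realization X)"
      then obtain n x t where a: "a = realization_point X (n, x, t)" "x \<in> simplices X n" "t \<in> standard_simplex n"
        by (auto simp: coend_def coend_points_def quotient_def)
      obtain m \<sigma> y where s: "\<sigma> \<in> operators n m" "y \<in> simplices X m" "\<not> degenerate X m y" "x = action X n m \<sigma> y"
        using Eilenberg_Zilber_exists[OF X a(2)] by metis
      have "((n, x, t), (m, y, simplex_push n m \<sigma> t)) \<in> realization_rel X"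
        by (rule coend_step_rel) (use s a in \<open>auto simp: coend_step_def\<close>)
      then have "a = realization_point X (m, y, simplex_push n m \<sigma> t)"
        unfolding a(1) by (rule equiv_class_eq[OF equiv_coend_rel])
      with simplex_push_standard_simplex[OF s(1) a(3)] have "a \<in> K (m, y)" by (simp add: K_def)
      with s(2,3) show "a \<in> \<Union>(K ` ?N)" by blast
    qed
  qed
  ultimately show ?thesis by (simp add: compact_space_def)
qed

text \<open>The complement is treated since the factor of simplices is discrete: over each simplex
  it is an open slice, and arbitrary unions of these are open.\<close>

lemma closedin_realizationI:
  assumes C: "C \<subseteq> topspace (realization X)"
    and slices: "\<And>q c. c \<in> simplices X q \<Longrightarrow>
      closedin (simplex_space q) {t \<in> standard_simplex q. realization_point X (q, c, t) \<in> C}"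
  shows "closedin (realization X) C"
proof -
  let ?U = "{p \<in> topspace (realization_sum X). realization_point X p \<in> C}"
  have "closedin (realization_sum X) ?U"
    unfolding realization_sum_def
  proof (subst closedin_sum_topology, intro conjI ballI)
    show "{p \<in> topspace (sum_topology (\<lambda>n. prod_topology (discrete_topology (simplices X n)) (simplex_space n)) UNIV).
        realization_point X p \<in> C} \<subseteq> Sigma UNIV (topspace \<circ> (\<lambda>n. prod_topology (discrete_topology (simplices X n)) (simplex_space n)))"
      by auto
    fix q
    define V where "V = {x. (q, x) \<in> {p \<in> topspace (sum_topology (\<lambda>n. prod_topology (discrete_topology (simplices X n)) (simplex_space n)) UNIV).
        realization_point X p \<in> C}}"
    have V: "V = {(c, t). c \<in> simplices X q \<and> t \<in> standard_simplex q \<and> realization_point X (q, c, t) \<in> C}"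
      by (auto simp: V_def)
    let ?T = "prod_topology (discrete_topology (simplices X q)) (simplex_space q)"
    have "topspace ?T - V = (\<Union>c\<in>simplices X q. {c} \<times>
        (topspace (simplex_space q) - {t \<in> standard_simplex q. realization_point X (q, c, t) \<in> C}))"
      by (auto simp: V)
    also have "openin ?T \<dots>"
      using slices by (intro openin_Union ballI) (auto simp: openin_prod_Times_iff closedin_def)
    finally show "closedin ?T V" unfolding closedin_def by (auto simp: V)
  qed
  then show ?thesis
    using quotient_map_realization[of X] C unfolding quotient_map_closedin by blast
qed

lemma continuous_map_chain_weight:
  "continuous_map (simplex_space q) euclideanreal (\<lambda>t. chain_weight q s t i)"
  unfolding chain_weight_def simplex_space_def
  by (intro continuous_map_sum continuous_map_from_subtopology continuous_map_product_projection) auto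

lemma max_push_insert:
  "finite S \<Longrightarrow> max_push (insert a S) f w j = (if f a = j then max (w a) (max_push S f w j) else max_push S f w j)"
proof -
  assume S: "finite S"
  have "{b \<in> insert a S. f b = j} = (if f a = j then insert a {b \<in> S. f b = j} else {b \<in> S. f b = j})" by auto
  with S show ?thesis by (simp add: max_push_def insert_commute[of 0])
qed

lemma continuous_map_max_push:
  assumes "finite S"
  shows "continuous_map (simplex_space q) euclideanreal (\<lambda>t. max_push S f (chain_weight q s t) j)"
  using assms
proof induction
  case empty
  show ?case by (simp add: max_push_def)
next
  case (insert a S)
  then show ?case
    by (cases "f a = j") (auto simp: max_push_insert intro!: continuous_map_real_max continuous_map_chain_weight)
qed

lemma continuous_map_max_push_fun:
  assumes "finite S"
  shows "continuous_map (simplex_space q) euclidean (\<lambda>t. max_push S f (chain_weight q s t))"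
  unfolding euclidean_product_topology[symmetric] continuous_map_componentwise_UNIV
  by (intro allI continuous_map_max_push[OF assms])

lemma closedin_max_push:
  assumes "finite S" "closed D"
  shows "closedin (simplex_space q) {t \<in> standard_simplex q. max_push S f (chain_weight q s t) \<in> D}"
  using closedin_continuous_map_preimage[OF continuous_map_max_push_fun[OF assms(1)], of D q f s] assms(2) by simp

section \<open>The fibre over a pair of normal forms\<close>

locale kappa_fibre =
  fixes X :: "'a sset" and Y :: "'b sset" and m m' x0 y0 u v
  assumes X: "is_sset X" and Y: "is_sset Y"
    and x0: "x0 \<in> simplices X m" "\<not> degenerate X m x0" and y0: "y0 \<in> simplices Y m'" "\<not> degenerate Y m' y0"
    and um: "u \<in> max_simplex m" and u: "\<And>i. i \<le> m \<Longrightarrow> 0 < u i"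
    and vm: "v \<in> max_simplex m'" and v: "\<And>i. i \<le> m' \<Longrightarrow> 0 < v i"
begin

abbreviation "Z \<equiv> sset_prod X Y"
abbreviation "couplings \<equiv> tropical_couplings {..m} {..m} {..m'} {..m'} u v"
abbreviation "coupled_to \<equiv> coupled X Y m x0 u m' y0 v"

lemma Z: "is_sset Z" by (rule is_sset_prod[OF X Y])

lemma Z_simplices: "(x, y) \<in> simplices Z n \<longleftrightarrow> x \<in> simplices X n \<and> y \<in> simplices Y n"
  by (simp add: sset_prod_def)

text \<open>Explicit coordinates of a point of the realization, kept as a relation because they are
  not unique.\<close>

definition presents where
  "presents a q n x y s t \<longleftrightarrow> (x, y) \<in> simplices Z n \<and> s \<in> simplices (subdivided_simplex n) q \<and>
    t \<in> standard_simplex q \<and> a = realization_point (Sd Z) (q, Sd_rel Z q `` {(n, (x, y), s)}, t)"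

lemma presents_exists:
  assumes "a \<in> topspace (realization (Sd Z))"
  obtains q n x y s t where "presents a q n x y s t"
proof -
  obtain q c t where c: "c \<in> simplices (Sd Z) q" "t \<in> standard_simplex q" "a = realization_point (Sd Z) (q, c, t)"
    using assms by (auto simp: coend_def coend_points_def quotient_def)
  obtain n z s where z: "c = Sd_rel Z q `` {(n, z, s)}" "z \<in> simplices Z n" "s \<in> simplices (subdivided_simplex n) q"
    by (rule Sd_simplexE[OF c(1)])
  obtain x y where "z = (x, y)" by (cases z)
  with z c that show thesis unfolding presents_def by blast
qed

lemma presents_topspace:
  assumes "presents a q n x y s t"
  shows "a \<in> topspace (realization (Sd Z))"
proof -
  have "Sd_rel Z q `` {(n, (x, y), s)} \<in> simplices (Sd Z) q"
    using assms unfolding presents_def Sd_simplices_iff by blast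
  then show ?thesis
    using assms unfolding presents_def by (auto simp: coend_def coend_points_def intro!: quotientI)
qed

lemma presents_rel:
  assumes 1: "presents a q n x y s t" and 2: "presents a q' n' x' y' s' t'"
  shows "((n, (x, y), chain_weight q s t), (n', (x', y'), chain_weight q' s' t')) \<in> max_rel Z"
proof -
  have "((q, Sd_rel Z q `` {(n, (x, y), s)}, t), (q', Sd_rel Z q' `` {(n', (x', y'), s')}, t')) \<in> realization_rel (Sd Z)"
    using 1 2 unfolding presents_def by (metis coend_rel_eq_iff)
  from max_coordinates_invariant[OF this] show ?thesis
    using 1 2 unfolding presents_def by (simp add: max_coordinates coend_rel_eq_iff)
qed

lemma presents_unique:
  assumes 1: "presents a q n x y s t" and 2: "presents a' q' n' x' y' s' t'"
    and r: "((n, (x, y), chain_weight q s t), (n', (x', y'), chain_weight q' s' t')) \<in> max_rel Z"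
  shows "a = a'"
proof -
  have c: "Sd_rel Z q `` {(n, (x, y), s)} \<in> simplices (Sd Z) q" "Sd_rel Z q' `` {(n', (x', y'), s')} \<in> simplices (Sd Z) q'"
    using 1 2 unfolding presents_def Sd_simplices_iff by blast+
  have t: "t \<in> standard_simplex q" "t' \<in> standard_simplex q'" using 1 2 unfolding presents_def by blast+
  have "max_coordinates Z (q, Sd_rel Z q `` {(n, (x, y), s)}, t) = max_coordinates Z (q', Sd_rel Z q' `` {(n', (x', y'), s')}, t')"
    using r by (simp add: max_coordinates t coend_rel_eq_iff)
  from max_coordinates_inject[OF Z c(1) t(1) c(2) t(2) this] show ?thesis
    using 1 2 unfolding presents_def by (simp add: coend_rel_eq_iff)
qed

text \<open>The comparison of points with couplings. Its domain will turn out to be the fibre;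
  uniqueness in either argument makes it a bijection onto the couplings.\<close>

definition graph where
  "graph a \<omega> \<longleftrightarrow> (\<exists>q n x y s t. presents a q n x y s t \<and> coupled_to (n, (x, y), chain_weight q s t) \<omega>)"

lemma graph_iff:
  assumes "presents a q n x y s t"
  shows "graph a \<omega> \<longleftrightarrow> coupled_to (n, (x, y), chain_weight q s t) \<omega>"
proof
  assume "graph a \<omega>"
  then obtain q' n' x' y' s' t' where *: "presents a q' n' x' y' s' t'"
    "coupled_to (n', (x', y'), chain_weight q' s' t') \<omega>" unfolding graph_def by blast
  from coupled_invariant[OF X Y presents_rel[OF *(1) assms]] *(2)
  show "coupled_to (n, (x, y), chain_weight q s t) \<omega>" by simp
next
  assume "coupled_to (n, (x, y), chain_weight q s t) \<omega>"
  with assms show "graph a \<omega>" unfolding graph_def by blast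
qed

lemma presents_max_simplex: "presents a q n x y s t \<Longrightarrow> chain_weight q s t \<in> max_simplex n"
  unfolding presents_def using chain_weight_max_simplex by blast

lemma graph_unique:
  assumes "graph a \<omega>" "graph a \<omega>'" shows "\<omega> = \<omega>'"
proof -
  obtain q n x y s t where p: "presents a q n x y s t" using assms(1) unfolding graph_def by blast
  show ?thesis
    using coupled_unique[OF X Y presents_max_simplex[OF p]] assms unfolding graph_iff[OF p] by blast
qed

lemma graph_couplings:
  assumes "graph a \<omega>" shows "\<omega> \<in> couplings"
proof -
  obtain q n x y s t where p: "presents a q n x y s t" using assms unfolding graph_def by blast
  show ?thesis
    by (rule coupled_tropical_coupling[OF presents_max_simplex[OF p] assms[unfolded graph_iff[OF p]] u v])
qed

text \<open>Both points are equivalent to the canonical point of the common coupling.\<close>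

lemma graph_inject:
  assumes "graph a \<omega>" "graph a' \<omega>" shows "a = a'"
proof -
  obtain q n x y s t where p: "presents a q n x y s t" using assms(1) unfolding graph_def by blast
  obtain q' n' x' y' s' t' where p': "presents a' q' n' x' y' s' t'" using assms(2) unfolding graph_def by blast
  have pts: "(n, (x, y), chain_weight q s t) \<in> max_points Z" "(n', (x', y'), chain_weight q' s' t') \<in> max_points Z"
    using p p' presents_max_simplex unfolding coend_points_def presents_def by blast+
  have "((n, (x, y), chain_weight q s t), canonical_point X Y m x0 m' y0 \<omega>) \<in> max_rel Z"
    by (rule coupled_canonical_point[OF X Y pts(1) assms(1)[unfolded graph_iff[OF p]] u v])
  moreover have "((n', (x', y'), chain_weight q' s' t'), canonical_point X Y m x0 m' y0 \<omega>) \<in> max_rel Z"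
    by (rule coupled_canonical_point[OF X Y pts(2) assms(2)[unfolded graph_iff[OF p']] u v])
  ultimately show ?thesis
    using presents_unique[OF p p'] coend_rel_trans coend_rel_sym by metis
qed

lemma graph_surjective:
  assumes "\<omega> \<in> couplings"
  obtains a where "graph a \<omega>"
proof -
  note c = canonical_point_coupled[OF X Y x0 y0 um u vm v assms]
  obtain n x y w where p: "canonical_point X Y m x0 m' y0 \<omega> = (n, (x, y), w)"
    by (metis prod.exhaust)
  have z: "(x, y) \<in> simplices Z n" and w: "w \<in> max_simplex n"
    using c(1) unfolding p coend_points_def by auto
  obtain q s t where s: "s \<in> simplices (subdivided_simplex n) q" "t \<in> standard_simplex q" "chain_weight q s t = w"
    using joint_chain_exists[OF w w] by metis
  have "graph (realization_point (Sd Z) (q, Sd_rel Z q `` {(n, (x, y), s)}, t)) \<omega>"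
    unfolding graph_def presents_def using z s c(2) unfolding p by blast
  then show thesis by (rule that)
qed

text \<open>On the closed set of points supported on \<open>A\<close>, the coupling is a continuous function of the
  barycentric coordinates; finitely many of these sets cover the fibre.\<close>

lemma closedin_graph:
  assumes D: "closed D"
  shows "closedin (realization (Sd Z)) {a \<in> topspace (realization (Sd Z)). \<exists>\<omega>\<in>D. graph a \<omega>}"
proof (rule closedin_realizationI)
  fix q c assume "c \<in> simplices (Sd Z) q"
  then obtain n z s where c: "c = Sd_rel Z q `` {(n, z, s)}" and z': "z \<in> simplices Z n"
    and s: "s \<in> simplices (subdivided_simplex n) q" by (rule Sd_simplexE)
  obtain x y where "z = (x, y)" by (cases z)
  with c z' have c: "c = Sd_rel Z q `` {(n, (x, y), s)}" and z: "(x, y) \<in> simplices Z n" by simp_all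
  \<comment> \<open>Restricting \<open>f\<close> and \<open>g\<close> to \<open>A\<close> leaves
    only finitely many triples.\<close>
  define I where "I = {(A, f, g). A \<subseteq> {..n} \<and> f \<in> A \<rightarrow>\<^sub>E {..m} \<and> g \<in> A \<rightarrow>\<^sub>E {..m'} \<and>
    face_factors X n x A m x0 f \<and> face_factors Y n y A m' y0 g}"
  \<comment> \<open>The first condition says that the weights vanish off \<open>A\<close>. It is
    closed, whereas equality of \<open>A\<close> with the support would not be.\<close>
  define P where "P = (\<lambda>(A, f, g). {t \<in> standard_simplex q.
    max_push ({..n} - A) (\<lambda>i. i) (chain_weight q s t) \<in> {\<lambda>i. 0} \<and>
    max_push A f (chain_weight q s t) \<in> {u} \<and> max_push A g (chain_weight q s t) \<in> {v} \<and>
    max_push A (\<lambda>a. (f a, g a)) (chain_weight q s t) \<in> D})"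
  have "I \<subseteq> (SIGMA A : Pow {..n}. (A \<rightarrow>\<^sub>E {..m}) \<times> (A \<rightarrow>\<^sub>E {..m'}))" by (auto simp: I_def)
  moreover have "finite (SIGMA A : Pow {..n}. (A \<rightarrow>\<^sub>E {..m}) \<times> (A \<rightarrow>\<^sub>E {..m'}))"
    by (intro finite_SigmaI finite_cartesian_product finite_PiE) (auto intro: finite_subset)
  ultimately have I: "finite I" by (rule finite_subset)
  have "closedin (simplex_space q) (P p)" if "p \<in> I" for p
  proof -
    obtain A f g where p: "p = (A, f, g)" by (cases p)
    have A: "finite A" using that finite_subset[of A "{..n}"] by (auto simp: p I_def)
    have cl: "closedin (simplex_space q) {t \<in> standard_simplex q. Q t \<and> R t}"
      if "closedin (simplex_space q) {t \<in> standard_simplex q. Q t}" "closedin (simplex_space q) {t \<in> standard_simplex q. R t}"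
      for Q R
      using closedin_Int[OF that] by (rule back_subst[of "closedin _"]) auto
    show ?thesis
      unfolding P_def p prod.case by (intro cl closedin_max_push) (use A D in auto)
  qed
  then have "closedin (simplex_space q) (\<Union>(P ` I))" using I by (intro closedin_Union) auto
  moreover have "{t \<in> standard_simplex q. realization_point (Sd Z) (q, c, t)
      \<in> {a \<in> topspace (realization (Sd Z)). \<exists>\<omega>\<in>D. graph a \<omega>}} = \<Union>(P ` I)"
  proof (intro equalityI subsetI)
    fix t assume "t \<in> {t \<in> standard_simplex q. realization_point (Sd Z) (q, c, t)
      \<in> {a \<in> topspace (realization (Sd Z)). \<exists>\<omega>\<in>D. graph a \<omega>}}"
    then obtain \<omega> where t: "t \<in> standard_simplex q" and \<omega>: "\<omega> \<in> D" "graph (realization_point (Sd Z) (q, c, t)) \<omega>" by auto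
    let ?w = "chain_weight q s t"
    have p: "presents (realization_point (Sd Z) (q, c, t)) q n x y s t"
      using z s t unfolding presents_def c by blast
    have w: "?w \<in> max_simplex n" by (rule presents_max_simplex[OF p])
    obtain f g where fg: "face_factors X n x (supp ?w) m x0 f" "face_factors Y n y (supp ?w) m' y0 g"
      "max_push (supp ?w) f ?w = u" "max_push (supp ?w) g ?w = v" "max_push (supp ?w) (\<lambda>a. (f a, g a)) ?w = \<omega>"
      using \<omega>(2) unfolding graph_iff[OF p] coupled_iff by blast
    let ?f = "restrict f (supp ?w)" and ?g = "restrict g (supp ?w)"
    have im: "f ` supp ?w = {..m}" "g ` supp ?w = {..m'}" using fg(1,2) unfolding face_factors_def by blast+
    have "(supp ?w, ?f, ?g) \<in> I"
      unfolding I_def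
      using max_simplexD(3)[OF w] face_factors_cong[OF fg(1), of ?f] face_factors_cong[OF fg(2), of ?g] im by auto
    moreover have "t \<in> P (supp ?w, ?f, ?g)"
    proof -
      have "max_push ({..n} - supp ?w) (\<lambda>i. i) ?w = (\<lambda>i. 0)"
      proof
        fix i
        show "max_push ({..n} - supp ?w) (\<lambda>i. i) ?w i = 0"
          using max_push_support[of "{..n} - supp ?w" ?w "\<lambda>i. i" i] by auto
      qed
      moreover have "max_push (supp ?w) ?f ?w = u" "max_push (supp ?w) ?g ?w = v"
        "max_push (supp ?w) (\<lambda>a. (?f a, ?g a)) ?w = \<omega>"
        unfolding fg(3-5)[symmetric] by (rule max_push_cong; simp)+
      ultimately show ?thesis using t \<omega>(1) by (simp add: P_def)
    qed
    ultimately show "t \<in> \<Union>(P ` I)" by blast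
  next
    fix t assume "t \<in> \<Union>(P ` I)"
    then obtain A f g where I: "(A, f, g) \<in> I" and "t \<in> P (A, f, g)" by auto
    then have t: "t \<in> standard_simplex q" and off: "max_push ({..n} - A) (\<lambda>i. i) (chain_weight q s t) = (\<lambda>i. 0)"
      and fu: "max_push A f (chain_weight q s t) = u" and gv: "max_push A g (chain_weight q s t) = v"
      and fgD: "max_push A (\<lambda>a. (f a, g a)) (chain_weight q s t) \<in> D"
      unfolding P_def by auto
    let ?w = "chain_weight q s t"
    have p: "presents (realization_point (Sd Z) (q, c, t)) q n x y s t"
      using z s t unfolding presents_def c by blast
    have w: "?w \<in> max_simplex n" by (rule presents_max_simplex[OF p])
    have A: "A \<subseteq> {..n}" "finite A" and f: "face_factors X n x A m x0 f" and g: "face_factors Y n y A m' y0 g"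
      using I finite_subset[of A "{..n}"] by (auto simp: I_def)
    have sub: "supp ?w \<subseteq> A"
    proof
      fix i assume i: "i \<in> supp ?w"
      show "i \<in> A"
      proof (rule ccontr)
        assume "i \<notin> A"
        with i max_simplexD(3)[OF w] have "i \<in> {..n} - A" by blast
        from max_push_ge[OF _ this, of ?w "\<lambda>i. i"] off i max_simplexD(1)[OF w, of i] show False by (simp add: fun_eq_iff)
      qed
    qed
    have restrict_supp: "max_push A h ?w = max_push (supp ?w) h ?w" for h :: "nat \<Rightarrow> 'c"
      by (rule max_push_subset[OF A(2) sub]) auto
    \<comment> \<open>A support smaller than \<open>A\<close> still meets every fibre, as the
      pushforward is positive on \<open>{..k}\<close>. So the factorization over \<open>A\<close>
      restricts to the support.\<close>
    have surj: "h ` supp ?w = {..k}" if "max_push A h ?w = r" "\<And>i. i \<le> k \<Longrightarrow> 0 < r i" "h ` A \<subseteq> {..k}" for h k and r :: "nat \<Rightarrow> real"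
    proof
      show "{..k} \<subseteq> h ` supp ?w"
      proof
        fix i assume "i \<in> {..k}"
        then have "max_push A h ?w i \<noteq> 0" using that(1,2) by (metis atMost_iff less_irrefl)
        then show "i \<in> h ` supp ?w" using max_push_support[OF A(2), of ?w h i] max_simplexD(1)[OF w] by auto
      qed
    qed (use that(3) sub in auto)
    have img: "g ` A \<subseteq> {..m'}" using g unfolding face_factors_def by simp
    have imf: "f ` A \<subseteq> {..m}" using f unfolding face_factors_def by simp
    have "coupled_to (n, (x, y), ?w) (max_push A (\<lambda>a. (f a, g a)) ?w)"
      unfolding coupled_iff
      using face_factors_mono[OF f sub surj[OF fu u imf]] face_factors_mono[OF g sub surj[OF gv v img]] fu gv
      unfolding restrict_supp by blast
    then have "graph (realization_point (Sd Z) (q, c, t)) (max_push A (\<lambda>a. (f a, g a)) ?w)"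
      unfolding graph_iff[OF p] .
    with fgD t presents_topspace[OF p]
    show "t \<in> {t \<in> standard_simplex q. realization_point (Sd Z) (q, c, t)
      \<in> {a \<in> topspace (realization (Sd Z)). \<exists>\<omega>\<in>D. graph a \<omega>}}" by blast
  qed
  ultimately show "closedin (simplex_space q) {t \<in> standard_simplex q. realization_point (Sd Z) (q, c, t)
      \<in> {a \<in> topspace (realization (Sd Z)). \<exists>\<omega>\<in>D. graph a \<omega>}}" by simp
qed auto

text \<open>Both weights have maximum 1, attained at a vertex.\<close>

lemma balanced_weights: "balanced {..m} {..m'} u v"
proof -
  obtain i j where ij: "u i = 1" "v j = 1" using um vm unfolding max_simplex_def by blast
  then have "i \<le> m" "j \<le> m'" using max_simplexD(3)[OF um] max_simplexD(3)[OF vm] by force+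
  then show ?thesis
    unfolding balanced_def using ij max_simplexD(2)[OF um] max_simplexD(2)[OF vm] by (metis atMost_iff)
qed

text \<open>The graph is a continuous bijection onto the couplings; the fibre is closed in a compact
  space and the couplings are Hausdorff, so it is a homeomorphism.\<close>

lemma contractible_graph_domain:
  assumes fin: "finite_sset (Sd Z)"
  defines "fibre \<equiv> {a \<in> topspace (realization (Sd Z)). \<exists>\<omega>. graph a \<omega>}"
  shows "fibre \<noteq> {}" and "contractible_space (subtopology (realization (Sd Z)) fibre)"
proof -
  have uT: "\<And>r. r \<in> {..m} \<Longrightarrow> 0 < u r" and vT: "\<And>c. c \<in> {..m'} \<Longrightarrow> 0 < v c" using u v by auto
  note T = contractible_tropical_couplings[OF finite_atMost finite_atMost uT vT balanced_weights]
  let ?R = "realization (Sd Z)"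
  define \<psi> where "\<psi> a = (SOME \<omega>. graph a \<omega>)" for a
  have psi: "graph a (\<psi> a)" if "a \<in> fibre" for a
    using that someI_ex[of "graph a"] by (auto simp: fibre_def \<psi>_def)
  have psi_eq: "\<psi> a = \<omega>" if "graph a \<omega>" for a \<omega>
    using graph_unique[OF _ that] someI[of "graph a", OF that] by (auto simp: \<psi>_def)
  have graph_top: "a \<in> topspace ?R" if "graph a \<omega>" for a \<omega>
    using that presents_topspace unfolding graph_def by blast
  have top: "topspace (subtopology ?R fibre) = fibre" by (auto simp: fibre_def)
  obtain \<omega> where "\<omega> \<in> couplings" using T(2) by blast
  then obtain a where "graph a \<omega>" by (rule graph_surjective)
  then show "fibre \<noteq> {}" using graph_top by (auto simp: fibre_def)
  have "homeomorphic_map (subtopology ?R fibre) (top_of_set couplings) \<psi>"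
  proof (rule continuous_imp_homeomorphic_map)
    have "closedin ?R fibre" using closedin_graph[OF closed_UNIV] by (simp add: fibre_def)
    then show "compact_space (subtopology ?R fibre)"
      using closedin_compact_space[OF compact_space_realization[OF fin]] compact_space_subtopology by blast
    show "Hausdorff_space (top_of_set couplings)"
      by (simp add: Hausdorff_space_subtopology)
    show "\<psi> ` topspace (subtopology ?R fibre) = topspace (top_of_set couplings)"
    proof
      show "\<psi> ` topspace (subtopology ?R fibre) \<subseteq> topspace (top_of_set couplings)"
        unfolding top using psi graph_couplings by auto
      show "topspace (top_of_set couplings) \<subseteq> \<psi> ` topspace (subtopology ?R fibre)"
      proof
        fix \<omega> assume "\<omega> \<in> topspace (top_of_set couplings)"
        then have "\<omega> \<in> couplings" by simp
        then obtain a where a: "graph a \<omega>" by (rule graph_surjective)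
        then have "a \<in> fibre" "\<psi> a = \<omega>" using graph_top psi_eq by (auto simp: fibre_def)
        then show "\<omega> \<in> \<psi> ` topspace (subtopology ?R fibre)" unfolding top by blast
      qed
    qed
    show "inj_on \<psi> (topspace (subtopology ?R fibre))"
      unfolding top
    proof (rule inj_onI)
      fix a a' assume "a \<in> fibre" "a' \<in> fibre" "\<psi> a = \<psi> a'"
      then show "a = a'" using psi[of a] psi[of a'] graph_inject by simp
    qed
    show "continuous_map (subtopology ?R fibre) (top_of_set couplings) \<psi>"
    proof (rule continuous_map_into_subtopology)
      show "\<psi> \<in> topspace (subtopology ?R fibre) \<rightarrow> couplings"
        unfolding top using psi graph_couplings by blast
      show "continuous_map (subtopology ?R fibre) euclidean \<psi>"
        unfolding continuous_map_closedin
      proof (intro conjI allI impI)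
        fix D :: "(nat \<times> nat \<Rightarrow> real) set" assume "closedin euclidean D"
        then have "closedin ?R {a \<in> topspace ?R. \<exists>\<omega>\<in>D. graph a \<omega>}" by (intro closedin_graph) simp
        moreover have "{a \<in> topspace (subtopology ?R fibre). \<psi> a \<in> D} = fibre \<inter> {a \<in> topspace ?R. \<exists>\<omega>\<in>D. graph a \<omega>}"
          unfolding top using psi psi_eq by (auto simp: fibre_def)
        ultimately show "closedin (subtopology ?R fibre) {a \<in> topspace (subtopology ?R fibre). \<psi> a \<in> D}"
          by (simp add: closedin_subtopology_Int_closed)
      qed auto
    qed
  qed
  then have "subtopology ?R fibre homeomorphic_space top_of_set couplings"
    by (rule homeomorphic_map_imp_homeomorphic_space)
  with T(1) show "contractible_space (subtopology ?R fibre)"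
    by (simp add: homeomorphic_space_contractibility)
qed

end

theorem theorem1p2:
  fixes X :: "'a sset" and Y :: "'b sset"
  assumes "finite_sset X" and "finite_sset Y"
  shows "simple_map (Sd (sset_prod X Y)) (sset_prod (Sd X) (Sd Y)) (kappa X Y)"
  unfolding simple_map_def Let_def
proof (intro conjI ballI)
  let ?Z = "sset_prod X Y" and ?B = "sset_prod (Sd X) (Sd Y)"
  have X: "is_sset X" and Y: "is_sset Y" using assms by (simp_all add: finite_sset_def)
  show fin: "finite_sset (Sd ?Z)" by (intro finite_sset_Sd finite_sset_prod assms)
  show "finite_sset ?B" by (intro finite_sset_Sd finite_sset_prod assms)
  show map: "sset_map (Sd ?Z) ?B (kappa X Y)" by (rule sset_map_kappa)
  fix b assume "b \<in> topspace (realization ?B)"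
  then obtain q0 c0 d0 t0 where b: "b = realization_point ?B (q0, (c0, d0), t0)"
    and c0: "c0 \<in> simplices (Sd X) q0" and d0: "d0 \<in> simplices (Sd Y) q0" and t0: "t0 \<in> standard_simplex q0"
    by (auto simp: coend_def coend_points_def quotient_def sset_prod_def)
  obtain n1 x1 s1 where 1: "c0 = Sd_rel X q0 `` {(n1, x1, s1)}" "x1 \<in> simplices X n1" "s1 \<in> simplices (subdivided_simplex n1) q0"
    by (rule Sd_simplexE[OF c0])
  obtain n2 y2 s2 where 2: "d0 = Sd_rel Y q0 `` {(n2, y2, s2)}" "y2 \<in> simplices Y n2" "s2 \<in> simplices (subdivided_simplex n2) q0"
    by (rule Sd_simplexE[OF d0])
  note w1 = chain_weight_max_simplex[OF 1(3) t0] and w2 = chain_weight_max_simplex[OF 2(3) t0]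
  \<comment> \<open>The normal forms of the two components of \<open>b\<close> are the marginals of
    all couplings over \<open>b\<close>.\<close>
  obtain m x0 u where nf1: "normal_form X m x0 u (n1, x1, chain_weight q0 s1 t0)"
    and x0: "x0 \<in> simplices X m" "\<not> degenerate X m x0" "u \<in> max_simplex m" "\<And>i. i \<le> m \<Longrightarrow> 0 < u i"
    by (rule normal_form_exists[OF X 1(2) w1]) (rule that)
  obtain m' y0 v where nf2: "normal_form Y m' y0 v (n2, y2, chain_weight q0 s2 t0)"
    and y0: "y0 \<in> simplices Y m'" "\<not> degenerate Y m' y0" "v \<in> max_simplex m'" "\<And>i. i \<le> m' \<Longrightarrow> 0 < v i"
    by (rule normal_form_exists[OF Y 2(2) w2]) (rule that)
  interpret kappa_fibre X Y m m' x0 y0 u v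
    by unfold_locales (use X Y x0 y0 in auto)
  \<comment> \<open>A triple is equivalent to its normal form, and normal forms are invariant. So
    being equivalent to \<open>p\<close> means having the normal form of \<open>p\<close>.\<close>
  have rel_iff: "((k, z, w), p) \<in> max_rel W \<longleftrightarrow> normal_form W l e r (k, z, w)"
    if W: "is_sset W" and z: "z \<in> simplices W k" "w \<in> max_simplex k" and p: "p = (n, z', w')" "z' \<in> simplices W n" "w' \<in> max_simplex n"
      "normal_form W l e r p"
    for W :: "'c sset" and k z w p l e r n z' w'
    using normal_form_invariant[OF W, of k z w n z' w'] that normal_form_rel[OF W z]
      normal_form_rel[OF W p(2,3)] coend_rel_trans coend_rel_sym by metis
  have "realization_map ?B (kappa X Y) a = b \<longleftrightarrow> (\<exists>\<omega>. graph a \<omega>)" if "a \<in> topspace (realization (Sd ?Z))" for a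
  proof -
    obtain q n x y s t where p: "presents a q n x y s t" by (rule presents_exists[OF \<open>a \<in> topspace _\<close>])
    then have xy: "x \<in> simplices X n" "y \<in> simplices Y n" and s: "s \<in> simplices (subdivided_simplex n) q"
      and t: "t \<in> standard_simplex q" and a: "a = realization_point (Sd ?Z) (q, Sd_rel ?Z q `` {(n, (x, y), s)}, t)"
      unfolding presents_def Z_simplices by blast+
    note w = presents_max_simplex[OF p]
    let ?c = "Sd_rel X q `` {(n, x, s)}" and ?d = "Sd_rel Y q `` {(n, y, s)}"
    have cd: "?c \<in> simplices (Sd X) q" "?d \<in> simplices (Sd Y) q"
      using xy s unfolding Sd_simplices_iff by blast+
    have "kappa X Y q (Sd_rel ?Z q `` {(n, (x, y), s)}) = (?c, ?d)"
      by (simp add: kappa_def Sd_map_def coend_map_induced_class[OF sset_map_fst] coend_map_induced_class[OF sset_map_snd])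
    then have "realization_map ?B (kappa X Y) a = realization_point ?B (q, (?c, ?d), t)"
      unfolding a realization_map_def by (simp add: coend_map_induced_class[OF map])
    then have "realization_map ?B (kappa X Y) a = b \<longleftrightarrow>
        ((q, (?c, ?d), t), (q0, (c0, d0), t0)) \<in> realization_rel ?B"
      by (simp add: b coend_rel_eq_iff)
    also have "\<dots> \<longleftrightarrow> ((n, x, chain_weight q s t), (n1, x1, chain_weight q0 s1 t0)) \<in> max_rel X \<and>
        ((n, y, chain_weight q s t), (n2, y2, chain_weight q0 s2 t0)) \<in> max_rel Y"
      using max_coordinates_pair[OF X Y cd t c0 d0 t0]
      unfolding 1(1) 2(1) max_coordinates[OF t] max_coordinates[OF t0] coend_rel_eq_iff .
    also have "\<dots> \<longleftrightarrow> normal_form X m x0 u (n, x, chain_weight q s t) \<and> normal_form Y m' y0 v (n, y, chain_weight q s t)"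
      using rel_iff[OF X xy(1) w refl 1(2) w1 nf1] rel_iff[OF Y xy(2) w refl 2(2) w2 nf2] by blast
    also have "\<dots> \<longleftrightarrow> (\<exists>\<omega>. graph a \<omega>)"
      unfolding graph_iff[OF p] using coupled_exists coupled_normal_form by metis
    finally show ?thesis .
  qed
  then have fibre: "{a \<in> topspace (realization (Sd ?Z)). realization_map ?B (kappa X Y) a = b}
      = {a \<in> topspace (realization (Sd ?Z)). \<exists>\<omega>. graph a \<omega>}" by blast
  show "{a \<in> topspace (realization (Sd ?Z)). realization_map ?B (kappa X Y) a = b} \<noteq> {}"
    "contractible_space (subtopology (realization (Sd ?Z))
      {a \<in> topspace (realization (Sd ?Z)). realization_map ?B (kappa X Y) a = b})"
    unfolding fibre by (rule contractible_graph_domain[OF fin])+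
qed

end
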